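(* The following decision problem is NP-complete: given a connected graph $G=(V,E)$ and a positive integer $k$, decide whether $b(G)<k$.
   Context: All graphs are finite, simple, unweighted (each edge has length $1$); $\mathrm{diam}(G)$ is the maximum shortest-path distance between two vertices. The Borsuk number $b(G)$ of a connected graph $G$ is the minimum $k$ such that there is a set $F$ of edges for which the connected components $G_1,\dots,G_k$ of $G-F$ satisfy $\max\{\mathrm{diam}(G_1),\dots,\mathrm{diam}(G_k)\}<\mathrm{diam}(G)$. *)

theory Defs
  imports
    "Graph_Theory.Digraph_Component"
    "Graph_Theory.Shortest_Path"
    "HOL-Library.Extended_Nat"
    "HOL-Computational_Algebra.Polynomial"
begin

section \<open>Polynomial time on Turing machines\<close>

text \<open>
  Deterministic multi-tape Turing machines with two-way infinite tapes. The working states are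
  \<open>0, \<dots>, num_states - 1\<close>, with \<open>0\<close> the start state, and \<open>num_states\<close> is the halting state. The tape
  symbols are \<open>0, \<dots>, num_symbols - 1\<close>, where \<open>0\<close> is the blank and \<open>1\<close>, \<open>2\<close> stand for the input/output
  bits. Tape \<open>0\<close> carries the input, tape \<open>1\<close> the output.
\<close>

datatype move = Move_Left | Stay | Move_Right

record tm =
  num_tapes :: nat
  num_symbols :: nat
  num_states :: nat
  delta :: "nat \<Rightarrow> nat list \<Rightarrow> nat \<times> (nat \<times> move) list"

definition turing_machine :: "tm \<Rightarrow> bool" where
  "turing_machine M \<longleftrightarrow>
     num_tapes M \<ge> 2 \<and> num_symbols M \<ge> 3 \<and>
     (\<forall>q rs. q < num_states M \<and> length rs = num_tapes M \<and> set rs \<subseteq> {..<num_symbols M} \<longrightarrow>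
        (case delta M q rs of (q', acts) \<Rightarrow>
           q' \<le> num_states M \<and> length acts = num_tapes M \<and> fst ` set acts \<subseteq> {..<num_symbols M}))"

type_synonym tape = "(int \<Rightarrow> nat) \<times> int"
type_synonym config = "nat \<times> tape list"

definition read_tape :: "tape \<Rightarrow> nat" where
  "read_tape t = fst t (snd t)"

fun move_head :: "move \<Rightarrow> int \<Rightarrow> int" where
  "move_head Move_Left h = h - 1"
| "move_head Stay h = h"
| "move_head Move_Right h = h + 1"

definition act_tape :: "nat \<times> move \<Rightarrow> tape \<Rightarrow> tape" where
  "act_tape a t = ((fst t)(snd t := fst a), move_head (snd a) (snd t))"

definition halted :: "tm \<Rightarrow> config \<Rightarrow> bool" where
  "halted M c \<longleftrightarrow> fst c = num_states M"

definition step :: "tm \<Rightarrow> config \<Rightarrow> config" where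
  "step M c =
     (if halted M c then c
      else let (q', acts) = delta M (fst c) (map read_tape (snd c))
           in (q', map2 act_tape acts (snd c)))"

definition bit_symbol :: "bool \<Rightarrow> nat" where
  "bit_symbol b = (if b then 2 else 1)"

definition string_tape :: "bool list \<Rightarrow> int \<Rightarrow> nat" where
  "string_tape x i = (if 0 \<le> i \<and> i < int (length x) then bit_symbol (x ! nat i) else 0)"

definition init_config :: "tm \<Rightarrow> bool list \<Rightarrow> config" where
  "init_config M x = (0, (string_tape x, 0) # replicate (num_tapes M - 1) (\<lambda>_. 0, 0))"

text \<open>The output is the string that starts in cell \<open>0\<close> of tape \<open>1\<close> and ends at the first blank.\<close>

definition has_output :: "config \<Rightarrow> bool list \<Rightarrow> bool" where
  "has_output c y \<longleftrightarrow>
     (\<forall>i<length y. fst (snd c ! 1) (int i) = bit_symbol (y ! i)) \<and>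
     fst (snd c ! 1) (int (length y)) = 0"

definition computes_in_time :: "tm \<Rightarrow> (bool list \<Rightarrow> bool list) \<Rightarrow> (nat \<Rightarrow> nat) \<Rightarrow> bool" where
  "computes_in_time M f T \<longleftrightarrow>
     (\<forall>x. \<exists>t \<le> T (length x).
        let c = (step M ^^ t) (init_config M x) in halted M c \<and> has_output c (f x))"

definition polytime_computable :: "(bool list \<Rightarrow> bool list) \<Rightarrow> bool" where
  "polytime_computable f \<longleftrightarrow>
     (\<exists>M p. turing_machine M \<and> computes_in_time M f (poly (p :: nat poly)))"

section \<open>NP-completeness\<close>

type_synonym language = "bool list set"

definition polytime_decidable :: "language \<Rightarrow> bool" where
  "polytime_decidable A \<longleftrightarrow> polytime_computable (\<lambda>x. [x \<in> A])"

text \<open>Pairs of strings: the bits of the first component are doubled, \<open>01\<close> is the separator.\<close>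

definition string_pair :: "bool list \<Rightarrow> bool list \<Rightarrow> bool list" where
  "string_pair x y = concat (map (\<lambda>b. [b, b]) x) @ [False, True] @ y"

definition NP :: "language set" where
  "NP = {L. \<exists>A p. polytime_decidable A \<and>
     (\<forall>x. x \<in> L \<longleftrightarrow> (\<exists>y. length y \<le> poly (p :: nat poly) (length x) \<and> string_pair x y \<in> A))}"

definition polytime_reducible :: "language \<Rightarrow> language \<Rightarrow> bool" where
  "polytime_reducible K L \<longleftrightarrow> (\<exists>f. polytime_computable f \<and> (\<forall>x. x \<in> K \<longleftrightarrow> f x \<in> L))"

definition NP_hard :: "language \<Rightarrow> bool" where
  "NP_hard L \<longleftrightarrow> (\<forall>K\<in>NP. polytime_reducible K L)"

definition NP_complete :: "language \<Rightarrow> bool" where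
  "NP_complete L \<longleftrightarrow> L \<in> NP \<and> NP_hard L"

section \<open>The Borsuk number of a graph\<close>

text \<open>
  A finite simple graph is a \<^const>\<open>pair_graph\<close>, i.e. each edge is represented by its two
  orientations. Hence a set of edges is a symmetric set of arcs, and the connected components are
  the strongly connected components.
\<close>

definition graph_dist :: "('a, 'b) pre_digraph \<Rightarrow> 'a \<Rightarrow> 'a \<Rightarrow> ereal" where
  "graph_dist G u v = wf_digraph.\<mu> G (\<lambda>_. 1) u v"

definition diam :: "('a, 'b) pre_digraph \<Rightarrow> ereal" where
  "diam G = Max {graph_dist G u v | u v. u \<in> verts G \<and> v \<in> verts G}"

definition delete_edges :: "'a pair_pre_digraph \<Rightarrow> ('a \<times> 'a) set \<Rightarrow> 'a pair_pre_digraph" where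
  "delete_edges G F = G\<lparr>parcs := parcs G - F\<rparr>"

definition components :: "'a pair_pre_digraph \<Rightarrow> ('a, 'a \<times> 'a) pre_digraph set" where
  "components G = pre_digraph.sccs (with_proj G)"

definition borsuk_cut :: "'a pair_pre_digraph \<Rightarrow> ('a \<times> 'a) set \<Rightarrow> bool" where
  "borsuk_cut G F \<longleftrightarrow>
     F \<subseteq> parcs G \<and> sym F \<and> Max (diam ` components (delete_edges G F)) < diam (with_proj G)"

text \<open>
  The value is \<open>\<infinity>\<close> if there is no suitable edge set. Among the connected graphs this concerns only
  the one-vertex graph.
\<close>

definition borsuk_number :: "'a pair_pre_digraph \<Rightarrow> enat" where
  "borsuk_number G = Inf {enat (card (components (delete_edges G F))) | F. borsuk_cut G F}"

section \<open>Encoding of instances\<close>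

text \<open>
  A graph on the vertices \<open>0, \<dots>, n - 1\<close> is encoded by \<open>n\<close> in unary, terminated by \<open>0\<close>, and its
  adjacency matrix in row-major order. The number \<open>k\<close> follows in binary, least significant bit first.
\<close>

fun binary :: "nat \<Rightarrow> bool list" where
  "binary k = (if k = 0 then [] else odd k # binary (k div 2))"

declare binary.simps [simp del]

definition encode_graph :: "nat \<Rightarrow> nat pair_pre_digraph \<Rightarrow> bool list" where
  "encode_graph n G =
     replicate n True @ [False] @ [(i, j) \<in> parcs G. i \<leftarrow> [0..<n], j \<leftarrow> [0..<n]]"

definition encode_instance :: "nat \<Rightarrow> nat pair_pre_digraph \<Rightarrow> nat \<Rightarrow> bool list" where
  "encode_instance n G k = encode_graph n G @ binary k"

lemma binary_inject: "binary k = binary l \<Longrightarrow> k = l"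
proof (induction k arbitrary: l rule: binary.induct)
  case (1 k)
  show ?case
  proof (cases "k = 0 \<or> l = 0")
    case True then show ?thesis using 1(2) by (auto simp: binary.simps[of k] binary.simps[of l] split: if_splits)
  next
    case False
    then have "odd k = odd l" "binary (k div 2) = binary (l div 2)" using 1(2)
      by (auto simp: binary.simps[of k] binary.simps[of l])
    then show ?thesis using 1(1) False by (metis bit_eq_rec)
  qed
qed

lemma replicate_True_False_inject: "replicate n True @ False # xs = replicate m True @ False # ys \<Longrightarrow> n = m \<and> xs = ys"
  by (induction n arbitrary: m) (case_tac m; auto)+

lemma length_matrix: "length [(i, j) \<in> A. i \<leftarrow> [0..<n], j \<leftarrow> [0..<m]] = n*m"
  by (induction n) auto

lemma matrix_inject: "[(i, j) \<in> A. i \<leftarrow> [0..<n], j \<leftarrow> [0..<m]] = [(i, j) \<in> B. i \<leftarrow> [0..<n], j \<leftarrow> [0..<m]]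
   \<Longrightarrow> i < n \<Longrightarrow> j < m \<Longrightarrow> (i,j) \<in> A \<longleftrightarrow> (i,j) \<in> B"
proof (induction n)
  case (Suc n) then show ?case
    using append_eq_append_conv[of "[(i, j) \<in> A. i \<leftarrow> [0..<n], j \<leftarrow> [0..<m]]" "[(i, j) \<in> B. i \<leftarrow> [0..<n], j \<leftarrow> [0..<m]]"] 
    by (auto simp: length_matrix[simplified] less_Suc_eq)
qed simp

lemma encode_instance_inject:
  assumes "encode_instance n G k = encode_instance m H l"
  "pair_graph G" "pair_graph H" "pverts G = {..<n}" "pverts H = {..<m}"
  shows "n = m \<and> G = H \<and> k = l"
proof -
  interpret G: pair_graph G by fact
  interpret H: pair_graph H by fact
  have nm: "n = m" and e: "[(i, j) \<in> parcs G. i \<leftarrow> [0..<n], j \<leftarrow> [0..<n]] @ binary k = [(i, j) \<in> parcs H. i \<leftarrow> [0..<n], j \<leftarrow> [0..<n]] @ binary l"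
    using assms(1) replicate_True_False_inject unfolding encode_instance_def encode_graph_def by (auto simp only: append.simps append_assoc)
  then have a: "[(i, j) \<in> parcs G. i \<leftarrow> [0..<n], j \<leftarrow> [0..<n]] = [(i, j) \<in> parcs H. i \<leftarrow> [0..<n], j \<leftarrow> [0..<n]]" "binary k = binary l"
    using append_eq_append_conv length_matrix by metis+
  have "(i, j) \<in> parcs G \<longleftrightarrow> (i, j) \<in> parcs H" for i j
  proof (cases "i < n \<and> j < n")
    case True
    then show ?thesis using matrix_inject[OF a(1)] by blast
  next
    case False
    then show ?thesis
      using G.in_arcsD1 G.in_arcsD2 H.in_arcsD1 H.in_arcsD2 assms(4,5) nm by blast
  qed
  then have "parcs G = parcs H" by auto
  then show ?thesis using nm binary_inject[OF a(2)] assms(4,5) by (auto intro: pair_pre_digraph.equality)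
qed

end

theory Submission
  imports Defs
begin

text \<open>
  Deleting edges may be replaced by partitioning the vertices: the Borsuk number is less than \<open>k\<close> iff
  the vertices have a colouring with fewer than \<open>k\<close> colours and there is a \<open>d\<close> such that any two
  vertices of the same colour are joined by a monochromatic walk of length at most \<open>d\<close>, while some
  two vertices of the graph have distance greater than \<open>d\<close>. Such a colouring is an NP certificate.

  For hardness, the computation of a polynomial-time verifier is described by propositional clauses,
  whose satisfiability is reduced to colourability by Karp's construction. In a non-complete graph
  with a universal vertex the diameter is 2, so that the parts of a Borsuk partition are cliques,
  and the Borsuk number is the chromatic number of the complement.

  Both the verifier and the reduction are definable by arithmetic expressions with bounded sums over
  the bits of the input. As such expressions take polynomially bounded values, Turing machines that
  keep numbers in unary evaluate them in polynomial time.
\<close>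

section \<open>A structured language for Turing machines\<close>

text \<open>Deleting an edge inside a part only lengthens distances, so a cut may be replaced by the
  one that removes exactly the edges between different parts; this is why colourings suffice. Fixing
  a number \<open>d\<close> between the two diameters makes the condition checkable: walks certify
  the upper bound \<open>d\<close>, and a vertex potential that grows by at most one along each edge
  certifies a distance above \<open>d\<close>. Running times have to be established down to single
  machine steps. Bounded sums can be compiled uniformly, but they only form polynomially bounded
  numbers, while \<open>k\<close> is given in binary and may be exponential in the length of the
  instance. The verifier therefore never evaluates \<open>k\<close>; it compares its bits with a
  number of colours that is at most the number of vertices. In the reduction \<open>k\<close> is
  small, and its digits are found by searching for powers of two. Karp's construction accepts
  clauses of any length, so the clauses describing a computation enter it unchanged.\<close>

datatype com =
    Act "nat list \<Rightarrow> (nat \<times> move) list"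
  | Seq com com (infixr \<open>;;\<close> 60)
  | Cond "nat list \<Rightarrow> bool" com com
  | While "nat list \<Rightarrow> bool" com

text \<open>Each unfolding of \<open>;;\<close>, \<open>Cond\<close> or \<open>While\<close> is
  charged one idle step, so the count is the exact number of steps of the machine that works through
  \<open>next_stack\<close>.\<close>

inductive exec :: "com \<Rightarrow> tape list \<Rightarrow> nat \<Rightarrow> tape list \<Rightarrow> bool" where
  exec_Act: "exec (Act f) ts 1 (map2 act_tape (f (map read_tape ts)) ts)"
| exec_Seq: "exec a ts m ts' \<Longrightarrow> exec b ts' n ts'' \<Longrightarrow> exec (a ;; b) ts (Suc (m + n)) ts''"
| exec_CondT: "P (map read_tape ts) \<Longrightarrow> exec a ts n ts' \<Longrightarrow> exec (Cond P a b) ts (Suc n) ts'"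
| exec_CondF: "\<not> P (map read_tape ts) \<Longrightarrow> exec b ts n ts' \<Longrightarrow> exec (Cond P a b) ts (Suc n) ts'"
| exec_WhileF: "\<not> P (map read_tape ts) \<Longrightarrow> exec (While P c) ts 1 ts"
| exec_WhileT: "P (map read_tape ts) \<Longrightarrow> exec c ts m ts' \<Longrightarrow> exec (While P c) ts' n ts'' \<Longrightarrow>
    exec (While P c) ts (Suc (m + n)) ts''"

definition idle :: "nat list \<Rightarrow> (nat \<times> move) list" where
  "idle rs = map (\<lambda>s. (s, Stay)) rs"

fun next_stack :: "com list \<Rightarrow> nat list \<Rightarrow> com list \<times> (nat \<times> move) list" where
  "next_stack [] rs = ([], idle rs)"
| "next_stack (Act f # K) rs = (K, f rs)"
| "next_stack ((a ;; b) # K) rs = (a # b # K, idle rs)"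
| "next_stack (Cond P a b # K) rs = ((if P rs then a else b) # K, idle rs)"
| "next_stack (While P c # K) rs = (if P rs then c # While P c # K else K, idle rs)"

text \<open>All continuation stacks that occur before control reaches \<open>K\<close>; they become
  the control states. Recursion on the command alone keeps the set finite, although a loop body
  returns to the stack of its own loop.\<close>

fun stacks :: "com \<Rightarrow> com list \<Rightarrow> com list set" where
  "stacks (Act f) K = {Act f # K}"
| "stacks (a ;; b) K = insert ((a ;; b) # K) (stacks a (b # K) \<union> stacks b K)"
| "stacks (Cond P a b) K = insert (Cond P a b # K) (stacks a K \<union> stacks b K)"
| "stacks (While P c) K = insert (While P c # K) (stacks c (While P c # K))"

fun wf_com :: "nat \<Rightarrow> nat \<Rightarrow> com \<Rightarrow> bool" where
  "wf_com k s (Act f) \<longleftrightarrow> (\<forall>rs. length rs = k \<and> set rs \<subseteq> {..<s} \<longrightarrow>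
     length (f rs) = k \<and> fst ` set (f rs) \<subseteq> {..<s})"
| "wf_com k s (a ;; b) \<longleftrightarrow> wf_com k s a \<and> wf_com k s b"
| "wf_com k s (Cond P a b) \<longleftrightarrow> wf_com k s a \<and> wf_com k s b"
| "wf_com k s (While P c) \<longleftrightarrow> wf_com k s c"

lemma finite_stacks: "finite (stacks c K)"
  by (induction c arbitrary: K) auto

lemma start_in_stacks: "c # K \<in> stacks c K"
  by (cases c) auto

lemma Nil_notin_stacks: "[] \<notin> stacks c K"
  by (induction c arbitrary: K) auto

lemma next_stack_in_stacks:
  "L \<in> stacks c K \<Longrightarrow> fst (next_stack L rs) \<in> insert K (stacks c K)"
proof (induction c arbitrary: K)
  case (Seq a b)
  show ?case using Seq.prems Seq.IH(1)[of "b # K"] Seq.IH(2)[of K] start_in_stacks[of a "b # K"]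
      start_in_stacks[of b K] by auto
next
  case (Cond P a b)
  then show ?case using start_in_stacks[of a K] start_in_stacks[of b K] by auto
next
  case (While P c)
  then show ?case using start_in_stacks[of c "While P c # K"] by (auto split: if_splits)
qed auto

lemma wf_stacks:
  "wf_com k s c \<Longrightarrow> list_all (wf_com k s) K \<Longrightarrow> L \<in> stacks c K \<Longrightarrow> list_all (wf_com k s) L"
proof (induction c arbitrary: K)
  case (Seq a b)
  then show ?case by (metis (no_types, lifting) UnE insertE list.pred_inject(2) stacks.simps(2) wf_com.simps(2))
next
  case (While P c)
  then show ?case by (metis insertE list.pred_inject(2) stacks.simps(4) wf_com.simps(4))
qed auto

lemma length_idle [simp]: "length (idle rs) = length rs"
  by (simp add: idle_def)

lemma wf_next_stack:
  "list_all (wf_com k s) L \<Longrightarrow> length rs = k \<Longrightarrow> set rs \<subseteq> {..<s} \<Longrightarrow>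
   length (snd (next_stack L rs)) = k \<and> fst ` set (snd (next_stack L rs)) \<subseteq> {..<s}"
proof (induction L rs rule: next_stack.induct)
  case (2 f K rs) then show ?case by simp
qed (auto simp: idle_def)

lemma act_idle: "map2 act_tape (idle (map read_tape ts)) ts = ts"
  by (rule nth_equalityI) (auto simp: idle_def act_tape_def read_tape_def)

lemma com_turing_machine:
  assumes wf: "wf_com k s c" and k: "k \<ge> 2" and s: "s \<ge> 3"
  obtains M where "turing_machine M" "num_tapes M = k"
    "\<And>ts n ts'. exec c ts n ts' \<Longrightarrow> (step M ^^ n) (0, ts) = (num_states M, ts')"
proof -
  define S where "S = stacks c []"
  have fin: "finite (S - {[c]})" unfolding S_def using finite_stacks by blast
  obtain xs where xs: "distinct xs" "set xs = S - {[c]}"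
    using finite_distinct_list[OF fin] by blast
  \<comment> \<open>The start state has number 0, so \<open>[c]\<close> comes first.\<close>
  define L where "L = [c] # xs"
  have L: "distinct L" "set L = S"
    using xs start_in_stacks[of c "[]"] by (auto simp: L_def S_def)
  have ne: "[] \<notin> S" unfolding S_def by (rule Nil_notin_stacks)
  \<comment> \<open>The empty stack receives the number \<open>length L\<close>, that of the halting
    state.\<close>
  define code where "code K = (if K = [] then length L else (THE i. i < length L \<and> L ! i = K))" for K
  have code_nth: "code (L ! i) = i" if "i < length L" for i
  proof -
    have "L ! i \<noteq> []" using that L ne by (metis nth_mem)
    moreover have "(THE j. j < length L \<and> L ! j = L ! i) = i"
      using that L(1) by (auto simp: nth_eq_iff_index_eq intro!: the_equality)
    ultimately show ?thesis by (simp add: code_def)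
  qed
  have code_S: "code K < length L \<and> L ! code K = K" if "K \<in> S" for K
    using that L(2) code_nth by (metis in_set_conv_nth)
  have code_le: "code K \<le> length L" if "K \<in> insert [] S" for K
    using that code_S[of K] by (cases "K = []") (auto simp: code_def less_imp_le)
  define M where "M = \<lparr>num_tapes = k, num_symbols = s, num_states = length L,
     delta = (\<lambda>q rs. map_prod code id (next_stack (L ! q) rs))\<rparr>"
  have sim: "step M (code K, ts) = (code (fst (next_stack K (map read_tape ts))),
      map2 act_tape (snd (next_stack K (map read_tape ts))) ts)" if "K \<in> S" for K ts
    using code_S[OF that] by (auto simp: step_def halted_def M_def case_prod_beta Let_def)
  \<comment> \<open>The continuation \<open>K\<close> is arbitrary, so that the induction hypothesis
    covers a command followed by the rest of a sequence or by its own loop.\<close>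
  have run: "(step M ^^ n) (code (a # K), ts) = (code K, ts')"
    if "exec a ts n ts'" "stacks a K \<subseteq> S" for a ts n ts' K
    using that
  proof (induction arbitrary: K rule: exec.induct)
    case (exec_Act f ts)
    then show ?case by (simp add: sim)
  next
    case (exec_Seq a ts m ts' b n ts'')
    have st: "step M (code ((a ;; b) # K), ts) = (code (a # b # K), ts)"
      using exec_Seq.prems by (simp add: sim act_idle)
    show ?case
      using exec_Seq.prems exec_Seq.IH(1)[of "b # K"] exec_Seq.IH(2)[of K]
      by (simp add: funpow_add funpow_swap1 st del: funpow.simps add: funpow_Suc_right add.commute[of m])
  next
    case (exec_CondT P ts a n ts' b)
    have st: "step M (code (Cond P a b # K), ts) = (code (a # K), ts)"
      using exec_CondT by (simp add: sim act_idle)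
    show ?case using exec_CondT by (simp add: st del: funpow.simps add: funpow_Suc_right)
  next
    case (exec_CondF P ts b n ts' a)
    have st: "step M (code (Cond P a b # K), ts) = (code (b # K), ts)"
      using exec_CondF by (simp add: sim act_idle)
    show ?case using exec_CondF by (simp add: st del: funpow.simps add: funpow_Suc_right)
  next
    case (exec_WhileF P ts c)
    then show ?case by (simp add: sim act_idle)
  next
    case (exec_WhileT P ts c m ts' n ts'')
    have st: "step M (code (While P c # K), ts) = (code (c # While P c # K), ts)"
      using exec_WhileT by (simp add: sim act_idle)
    have "stacks c (While P c # K) \<subseteq> S" using exec_WhileT.prems by auto
    then show ?case
      using exec_WhileT.prems exec_WhileT.IH(1)[of "While P c # K"] exec_WhileT.IH(2)[of K]
      by (simp add: funpow_add st del: funpow.simps add: funpow_Suc_right add.commute[of m])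
  qed
  have tm: "turing_machine M"
    unfolding turing_machine_def
  proof (intro conjI allI impI)
    fix q rs assume *: "q < num_states M \<and> length rs = num_tapes M \<and> set rs \<subseteq> {..<num_symbols M}"
    then have q: "L ! q \<in> S" using L(2) nth_mem[of q L] by (simp add: M_def)
    then have "list_all (wf_com k s) (L ! q)" using wf_stacks[OF wf, of "[]"] by (simp add: S_def)
    from wf_next_stack[OF this, of rs] * 
    show "case delta M q rs of (q', acts) \<Rightarrow> q' \<le> num_states M \<and> length acts = num_tapes M \<and>
        fst ` set acts \<subseteq> {..<num_symbols M}"
      using code_le next_stack_in_stacks[of "L ! q" c "[]" rs] q
      by (auto simp: M_def S_def case_prod_beta)
  qed (use k s in \<open>auto simp: M_def\<close>)
  have "code [c] = 0" using code_nth[of 0] by (simp add: L_def)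
  moreover have "code [] = num_states M" by (simp add: code_def M_def)
  ultimately have "(step M ^^ n) (0, ts) = (num_states M, ts')" if "exec c ts n ts'" for ts n ts'
    using run[OF that, of "[]"] by (simp add: S_def)
  then show thesis using that[of M] tm by (simp add: M_def)
qed

section \<open>Counters on tapes\<close>

text \<open>With an upper bound in place of the exact count, rounds of different duration share one
  \<open>B\<close> in \<open>runs_While\<close>.\<close>

definition runs :: "com \<Rightarrow> tape list \<Rightarrow> nat \<Rightarrow> tape list \<Rightarrow> bool" where
  "runs c ts B ts' \<longleftrightarrow> (\<exists>n\<le>B. exec c ts n ts')"

lemma runs_mono: "runs c ts B ts' \<Longrightarrow> B \<le> B' \<Longrightarrow> runs c ts B' ts'"
  unfolding runs_def using le_trans by blast

lemma runs_Act: "ts' = map2 act_tape (f (map read_tape ts)) ts \<Longrightarrow> runs (Act f) ts 1 ts'"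
  unfolding runs_def using exec_Act by blast

lemma runs_Seq: "runs a ts A ts' \<Longrightarrow> runs b ts' B ts'' \<Longrightarrow> runs (a ;; b) ts (A + B + 1) ts''"
  unfolding runs_def by (metis Suc_eq_plus1 Suc_le_mono add_mono exec_Seq)

lemma runs_Cond:
  "runs (if P (map read_tape ts) then a else b) ts B ts' \<Longrightarrow> runs (Cond P a b) ts (B + 1) ts'"
  unfolding runs_def by (metis Suc_eq_plus1 Suc_le_mono exec_CondF exec_CondT)

lemma runs_While:
  assumes "\<And>i. i < m \<Longrightarrow> P (map read_tape (\<tau> i)) \<and> runs c (\<tau> i) B (\<tau> (Suc i))"
    and "\<not> P (map read_tape (\<tau> m))"
  shows "runs (While P c) (\<tau> 0) (m * (B + 1) + 1) (\<tau> m)"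
  using assms
proof (induction m arbitrary: \<tau>)
  case 0
  then show ?case unfolding runs_def using exec_WhileF[of P "\<tau> 0" c] by auto
next
  case (Suc m)
  have "runs (While P c) (\<tau> (Suc 0)) (m * (B + 1) + 1) (\<tau> (Suc m))"
    using Suc.IH[of "\<lambda>i. \<tau> (Suc i)"] Suc.prems by auto
  moreover have "P (map read_tape (\<tau> 0))" "runs c (\<tau> 0) B (\<tau> (Suc 0))"
    using Suc.prems(1)[of 0] by auto
  ultimately obtain n n' where "exec (While P c) (\<tau> (Suc 0)) n (\<tau> (Suc m))" "n \<le> m * (B + 1) + 1"
      "exec c (\<tau> 0) n' (\<tau> (Suc 0))" "n' \<le> B"
    unfolding runs_def by blast
  then show ?case unfolding runs_def
    using exec_WhileT[of P "\<tau> 0" c n' "\<tau> (Suc 0)" n "\<tau> (Suc m)"] \<open>P (map read_tape (\<tau> 0))\<close>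
    by (intro exI[of _ "Suc (n' + n)"]) simp
qed

text \<open>
  A counter is a tape whose only non-blank cell is cell \<open>0\<close>; its value is the position of the head.
\<close>

definition marker :: "int \<Rightarrow> nat" where
  "marker i = (if i = 0 then 1 else 0)"

text \<open>The output head rests on the first blank after \<open>y\<close>, so that
  \<open>Out\<close> appends.\<close>

definition tapes :: "nat \<Rightarrow> bool list \<Rightarrow> nat \<Rightarrow> bool list \<Rightarrow> (nat \<Rightarrow> nat) \<Rightarrow> tape list" where
  "tapes R x h y \<rho> = (string_tape x, int h) # (string_tape y, int (length y)) #
     map (\<lambda>r. (marker, int (\<rho> r))) [0..<R]"

definition on_tape :: "nat \<Rightarrow> (nat \<Rightarrow> nat \<times> move) \<Rightarrow> com" where
  "on_tape k g = Act (\<lambda>rs. map (\<lambda>i. if i = k then g (rs ! i) else (rs ! i, Stay)) [0..<length rs])"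

definition "Inc r = on_tape (Suc (Suc r)) (\<lambda>s. (s, Move_Right))"
definition "Dec r = on_tape (Suc (Suc r)) (\<lambda>s. (s, Move_Left))"
definition "In_right = on_tape 0 (\<lambda>s. (s, Move_Right))"
definition "In_left = on_tape 0 (\<lambda>s. (s, Move_Left))"
definition "Out b = on_tape 1 (\<lambda>s. (bit_symbol b, Move_Right))"
definition "Skip = Act idle"
text \<open>A counter head sees the marker only in cell 0, so the zero test reads a single
  symbol.\<close>

definition nonzero :: "nat \<Rightarrow> nat list \<Rightarrow> bool" where "nonzero r rs \<longleftrightarrow> rs ! Suc (Suc r) = 0"
definition "Loop r c = While (nonzero r) (Dec r ;; c)"

section \<open>Effect and duration of the basic counter programs\<close>

lemma length_tapes [simp]: "length (tapes R x h y \<rho>) = Suc (Suc R)"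
  by (simp add: tapes_def)

lemma tapes_nth [simp]:
  "tapes R x h y \<rho> ! 0 = (string_tape x, int h)"
  "tapes R x h y \<rho> ! Suc 0 = (string_tape y, int (length y))"
  "r < R \<Longrightarrow> tapes R x h y \<rho> ! Suc (Suc r) = (marker, int (\<rho> r))"
  by (auto simp: tapes_def)

lemma tapes_update [simp]:
  "(tapes R x h y \<rho>)[0 := (string_tape x, int h')] = tapes R x h' y \<rho>"
  "(tapes R x h y \<rho>)[Suc 0 := (string_tape y', int (length y'))] = tapes R x h y' \<rho>"
  "r < R \<Longrightarrow> (tapes R x h y \<rho>)[Suc (Suc r) := (marker, int n)] = tapes R x h y (\<rho>(r := n))"
  by (auto simp: tapes_def intro!: nth_equalityI simp: nth_list_update)

lemma runs_on_tape:
  assumes "k < length ts"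
  shows "runs (on_tape k g) ts 1 (ts[k := act_tape (g (read_tape (ts ! k))) (ts ! k)])"
  unfolding on_tape_def
  by (rule runs_Act, rule nth_equalityI)
    (use assms in \<open>auto simp: nth_list_update act_tape_def read_tape_def\<close>)

lemma runs_Inc: "r < R \<Longrightarrow> runs (Inc r) (tapes R x h y \<rho>) 1 (tapes R x h y (\<rho>(r := Suc (\<rho> r))))"
  using runs_on_tape[of "Suc (Suc r)" "tapes R x h y \<rho>" "\<lambda>s. (s, Move_Right)"]
    tapes_update(3)[of r R x h y \<rho> "Suc (\<rho> r)"]
  by (simp add: Inc_def act_tape_def read_tape_def add.commute)

lemma runs_Dec:
  "r < R \<Longrightarrow> \<rho> r > 0 \<Longrightarrow> runs (Dec r) (tapes R x h y \<rho>) 1 (tapes R x h y (\<rho>(r := \<rho> r - 1)))"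
  using runs_on_tape[of "Suc (Suc r)" "tapes R x h y \<rho>" "\<lambda>s. (s, Move_Left)"]
    tapes_update(3)[of r R x h y \<rho> "\<rho> r - 1"]
  by (simp add: Dec_def act_tape_def read_tape_def of_nat_diff)

lemma runs_In_right: "runs In_right (tapes R x h y \<rho>) 1 (tapes R x (Suc h) y \<rho>)"
  using runs_on_tape[of 0 "tapes R x h y \<rho>" "\<lambda>s. (s, Move_Right)"] tapes_update(1)[of R x h y \<rho> "Suc h"]
  by (simp add: In_right_def act_tape_def read_tape_def add.commute)

lemma runs_In_left: "runs In_left (tapes R x (Suc h) y \<rho>) 1 (tapes R x h y \<rho>)"
  using runs_on_tape[of 0 "tapes R x (Suc h) y \<rho>" "\<lambda>s. (s, Move_Left)"] tapes_update(1)[of R x "Suc h" y \<rho> h]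
  by (simp add: In_left_def act_tape_def read_tape_def)

lemma string_tape_snoc:
  "(string_tape y)(int (length y) := bit_symbol b) = string_tape (y @ [b])"
  by (rule ext) (auto simp: string_tape_def nth_append nat_less_iff)

lemma runs_Out: "runs (Out b) (tapes R x h y \<rho>) 1 (tapes R x h (y @ [b]) \<rho>)"
  using runs_on_tape[of "Suc 0" "tapes R x h y \<rho>" "\<lambda>s. (bit_symbol b, Move_Right)"]
    tapes_update(2)[of R x h y \<rho> "y @ [b]"]
  by (simp add: Out_def act_tape_def read_tape_def string_tape_snoc add.commute)

lemma runs_Skip: "runs Skip ts 1 ts"
  unfolding Skip_def by (rule runs_Act) (simp add: act_idle)

lemma nonzero_tapes [simp]:
  "r < R \<Longrightarrow> nonzero r (map read_tape (tapes R x h y \<rho>)) \<longleftrightarrow> \<rho> r \<noteq> 0"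
  by (simp add: nonzero_def read_tape_def marker_def)

lemma read_input [simp]: "map read_tape (tapes R x h y \<rho>) ! 0 = string_tape x (int h)"
  by (simp add: read_tape_def)

text \<open>\<open>Dec\<close> precedes the body, so round \<open>i\<close> finds
  \<open>m - Suc i\<close> in the loop counter and must leave it so. The sequences \<open>h\<close>,
  \<open>y\<close> and \<open>\<rho>\<close> describe everything else between rounds. The overhead 3
  per round pays for \<open>Dec\<close>, \<open>;;\<close> and the loop test.\<close>

lemma runs_Loop:
  assumes r: "r < R"
    and body: "\<And>i. i < m \<Longrightarrow> runs c (tapes R x (h i) (y i) ((\<rho> i)(r := m - Suc i))) B
        (tapes R x (h (Suc i)) (y (Suc i)) ((\<rho> (Suc i))(r := m - Suc i)))"
  shows "runs (Loop r c) (tapes R x (h 0) (y 0) ((\<rho> 0)(r := m))) (m * (B + 3) + 1)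
    (tapes R x (h m) (y m) ((\<rho> m)(r := 0)))"
proof -
  define \<tau> where "\<tau> i = tapes R x (h i) (y i) ((\<rho> i)(r := m - i))" for i
  have "runs (Dec r ;; c) (\<tau> i) (1 + B + 1) (\<tau> (Suc i))" if "i < m" for i
    unfolding \<tau>_def
  proof (rule runs_Seq)
    show "runs (Dec r) (tapes R x (h i) (y i) ((\<rho> i)(r := m - i))) 1
       (tapes R x (h i) (y i) ((\<rho> i)(r := m - Suc i)))"
      using runs_Dec[of r R "(\<rho> i)(r := m - i)" x "h i" "y i"] r that by simp
  qed (rule body[OF that])
  then have "runs (Loop r c) (\<tau> 0) (m * (1 + B + 1 + 1) + 1) (\<tau> m)"
    unfolding Loop_def by (intro runs_While) (use r in \<open>auto simp: \<tau>_def\<close>)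
  then show ?thesis by (simp add: \<tau>_def algebra_simps numeral_eq_Suc)
qed

lemma runs_add_loop:
  assumes "r < R" "s < R" "r \<noteq> s"
  shows "runs (Loop r (Inc s)) (tapes R x h y \<rho>) (\<rho> r * 4 + 1)
    (tapes R x h y (\<rho>(s := \<rho> s + \<rho> r, r := 0)))"
proof -
  have "runs (Loop r (Inc s)) (tapes R x h y ((\<rho>(s := \<rho> s + 0))(r := \<rho> r))) (\<rho> r * (1 + 3) + 1)
    (tapes R x h y ((\<rho>(s := \<rho> s + \<rho> r))(r := 0)))"
  proof (rule runs_Loop[where h = "\<lambda>_. h" and y = "\<lambda>_. y" and \<rho> = "\<lambda>i. \<rho>(s := \<rho> s + i)"])
    fix i
    show "runs (Inc s) (tapes R x h y (\<rho>(s := \<rho> s + i, r := \<rho> r - Suc i))) 1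
      (tapes R x h y (\<rho>(s := \<rho> s + Suc i, r := \<rho> r - Suc i)))"
      using runs_Inc[of s R x h y "\<rho>(s := \<rho> s + i, r := \<rho> r - Suc i)"] assms
      by (simp add: fun_upd_twist)
  qed (use assms in auto)
  then show ?thesis by simp
qed

text \<open>Reading a counter destroys it; its value therefore goes to two counters, one of which
  serves to restore it.\<close>

lemma runs_add2_loop:
  assumes "r < R" "s < R" "u < R" "r \<noteq> s" "r \<noteq> u" "s \<noteq> u"
  shows "runs (Loop r (Inc s ;; Inc u)) (tapes R x h y \<rho>) (\<rho> r * 6 + 1)
    (tapes R x h y (\<rho>(s := \<rho> s + \<rho> r, u := \<rho> u + \<rho> r, r := 0)))"
proof -
  have "runs (Loop r (Inc s ;; Inc u)) (tapes R x h y ((\<rho>(s := \<rho> s + 0, u := \<rho> u + 0))(r := \<rho> r)))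
     (\<rho> r * (3 + 3) + 1) (tapes R x h y ((\<rho>(s := \<rho> s + \<rho> r, u := \<rho> u + \<rho> r))(r := 0)))"
  proof (rule runs_Loop[where h = "\<lambda>_. h" and y = "\<lambda>_. y" and \<rho> = "\<lambda>i. \<rho>(s := \<rho> s + i, u := \<rho> u + i)"])
    fix i
    let ?\<sigma> = "\<rho>(s := \<rho> s + i, u := \<rho> u + i, r := \<rho> r - Suc i)"
    have "runs (Inc s ;; Inc u) (tapes R x h y ?\<sigma>) (1 + 1 + 1)
      (tapes R x h y (?\<sigma>(s := Suc (?\<sigma> s), u := Suc (?\<sigma> u))))"
      using runs_Seq[OF runs_Inc[of s R x h y ?\<sigma>] runs_Inc[of u R x h y "?\<sigma>(s := Suc (?\<sigma> s))"]] assms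
      by simp
    moreover have "?\<sigma>(s := Suc (?\<sigma> s), u := Suc (?\<sigma> u)) =
        \<rho>(s := \<rho> s + Suc i, u := \<rho> u + Suc i, r := \<rho> r - Suc i)"
      using assms by (auto simp: fun_eq_iff)
    ultimately show "runs (Inc s ;; Inc u) (tapes R x h y ?\<sigma>) 3
      (tapes R x h y (\<rho>(s := \<rho> s + Suc i, u := \<rho> u + Suc i, r := \<rho> r - Suc i)))"
      by (simp add: numeral_eq_Suc)
  qed (use assms in auto)
  then show ?thesis by simp
qed

lemma runs_sub_loop:
  assumes "r < R" "s < R" "r \<noteq> s"
  shows "runs (Loop r (Cond (nonzero s) (Dec s) Skip)) (tapes R x h y \<rho>) (\<rho> r * 5 + 1)
    (tapes R x h y (\<rho>(s := \<rho> s - \<rho> r, r := 0)))"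
proof -
  have "runs (Loop r (Cond (nonzero s) (Dec s) Skip)) (tapes R x h y ((\<rho>(s := \<rho> s - 0))(r := \<rho> r)))
     (\<rho> r * (2 + 3) + 1) (tapes R x h y ((\<rho>(s := \<rho> s - \<rho> r))(r := 0)))"
  proof (rule runs_Loop[where h = "\<lambda>_. h" and y = "\<lambda>_. y" and \<rho> = "\<lambda>i. \<rho>(s := \<rho> s - i)"])
    fix i
    let ?\<sigma> = "\<rho>(s := \<rho> s - i, r := \<rho> r - Suc i)"
    have "runs (if nonzero s (map read_tape (tapes R x h y ?\<sigma>)) then Dec s else Skip) (tapes R x h y ?\<sigma>) 1
      (tapes R x h y (\<rho>(s := \<rho> s - Suc i, r := \<rho> r - Suc i)))"
    proof (cases "\<rho> s - i = 0")
      case True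
      then show ?thesis using assms runs_Skip by simp
    next
      case False
      then show ?thesis using assms runs_Dec[of s R ?\<sigma> x h y] by (simp add: fun_upd_twist)
    qed
    from runs_Cond[of "nonzero s" _ "Dec s" Skip, OF this] show "runs (Cond (nonzero s) (Dec s) Skip) (tapes R x h y ?\<sigma>) 2
      (tapes R x h y (\<rho>(s := \<rho> s - Suc i, r := \<rho> r - Suc i)))"
      by (simp add: numeral_2_eq_2)
  qed (use assms in auto)
  then show ?thesis by simp
qed

lemma runs_clear_loop:
  assumes "r < R"
  shows "runs (Loop r Skip) (tapes R x h y \<rho>) (\<rho> r * 4 + 1) (tapes R x h y (\<rho>(r := 0)))"
proof -
  have "runs (Loop r Skip) (tapes R x h y (\<rho>(r := \<rho> r))) (\<rho> r * (1 + 3) + 1) (tapes R x h y (\<rho>(r := 0)))"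
    by (rule runs_Loop[where h = "\<lambda>_. h" and y = "\<lambda>_. y" and \<rho> = "\<lambda>i. \<rho>"]) (use assms runs_Skip in auto)
  then show ?thesis by simp
qed

text \<open>Counter \<open>u\<close> records how far the input head has moved, so that
  \<open>runs_left_loop\<close> can bring it back.\<close>

lemma runs_right_loop:
  assumes "r < R" "u < R" "r \<noteq> u"
  shows "runs (Loop r (In_right ;; Inc u)) (tapes R x h y \<rho>) (\<rho> r * 6 + 1)
    (tapes R x (h + \<rho> r) y (\<rho>(u := \<rho> u + \<rho> r, r := 0)))"
proof -
  have "runs (Loop r (In_right ;; Inc u)) (tapes R x (h + 0) y ((\<rho>(u := \<rho> u + 0))(r := \<rho> r)))
     (\<rho> r * (3 + 3) + 1) (tapes R x (h + \<rho> r) y ((\<rho>(u := \<rho> u + \<rho> r))(r := 0)))"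
  proof (rule runs_Loop[where h = "\<lambda>i. h + i" and y = "\<lambda>_. y" and \<rho> = "\<lambda>i. \<rho>(u := \<rho> u + i)"])
    fix i
    let ?\<sigma> = "\<rho>(u := \<rho> u + i, r := \<rho> r - Suc i)"
    show "runs (In_right ;; Inc u) (tapes R x (h + i) y ?\<sigma>) 3
      (tapes R x (h + Suc i) y (\<rho>(u := \<rho> u + Suc i, r := \<rho> r - Suc i)))"
      using runs_Seq[OF runs_In_right[of R x "h + i" y ?\<sigma>] runs_Inc[of u R x "Suc (h + i)" y ?\<sigma>]] assms
      by (simp add: numeral_eq_Suc fun_upd_twist)
  qed (use assms in auto)
  then show ?thesis by simp
qed

lemma runs_left_loop:
  assumes "r < R"
  shows "runs (Loop r In_left) (tapes R x (h + \<rho> r) y \<rho>) (\<rho> r * 4 + 1) (tapes R x h y (\<rho>(r := 0)))"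
proof -
  have "runs (Loop r In_left) (tapes R x (h + (\<rho> r - 0)) y (\<rho>(r := \<rho> r))) (\<rho> r * (1 + 3) + 1)
      (tapes R x (h + (\<rho> r - \<rho> r)) y (\<rho>(r := 0)))"
  proof (rule runs_Loop[where h = "\<lambda>i. h + (\<rho> r - i)" and y = "\<lambda>_. y" and \<rho> = "\<lambda>i. \<rho>"])
    fix i assume "i < \<rho> r"
    then have "\<rho> r - i = Suc (\<rho> r - Suc i)" by simp
    then show "runs In_left (tapes R x (h + (\<rho> r - i)) y (\<rho>(r := \<rho> r - Suc i))) 1
      (tapes R x (h + (\<rho> r - Suc i)) y (\<rho>(r := \<rho> r - Suc i)))"
      using runs_In_left[of R x "h + (\<rho> r - Suc i)" y "\<rho>(r := \<rho> r - Suc i)"] by simp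
  qed (use assms in auto)
  then show ?thesis by simp
qed

lemma runs_length_loop:
  assumes "s < R" "u < R" "s \<noteq> u"
  shows "runs (While (\<lambda>rs. rs ! 0 \<noteq> 0) (In_right ;; Inc s ;; Inc u)) (tapes R x 0 y \<rho>) (length x * 6 + 1)
    (tapes R x (length x) y (\<rho>(s := \<rho> s + length x, u := \<rho> u + length x)))"
proof -
  define \<tau> where "\<tau> i = tapes R x i y (\<rho>(s := \<rho> s + i, u := \<rho> u + i))" for i
  have "runs (In_right ;; Inc s ;; Inc u) (\<tau> i) 5 (\<tau> (Suc i))" for i
  proof -
    let ?\<sigma> = "\<rho>(s := \<rho> s + i, u := \<rho> u + i)"
    have "runs (In_right ;; Inc s ;; Inc u) (\<tau> i) (1 + (1 + 1 + 1) + 1)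
      (tapes R x (Suc i) y (?\<sigma>(s := Suc (?\<sigma> s), u := Suc ((?\<sigma>(s := Suc (?\<sigma> s))) u))))"
      unfolding \<tau>_def
      by (rule runs_Seq[OF runs_In_right runs_Seq[OF runs_Inc[OF assms(1)] runs_Inc[OF assms(2)]]])
    moreover have "?\<sigma>(s := Suc (?\<sigma> s), u := Suc ((?\<sigma>(s := Suc (?\<sigma> s))) u)) =
        \<rho>(s := \<rho> s + Suc i, u := \<rho> u + Suc i)"
      using assms by (auto simp: fun_eq_iff)
    ultimately show ?thesis by (simp add: \<tau>_def numeral_eq_Suc)
  qed
  then have "runs (While (\<lambda>rs. rs ! 0 \<noteq> 0) (In_right ;; Inc s ;; Inc u)) (\<tau> 0) (length x * (5 + 1) + 1)
      (\<tau> (length x))"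
    by (intro runs_While) (auto simp: \<tau>_def string_tape_def bit_symbol_def simp del: One_nat_def)
  then show ?thesis by (simp add: \<tau>_def)
qed

section \<open>Expressions with bounded sums\<close>

text \<open>Bounded sums yield products, bounded quantifiers and division, but no exponentiation;
  values stay polynomially bounded.\<close>

datatype exp =
    One | Var nat | Len | Bit exp | Add exp exp | Monus exp exp | Sum nat exp exp

primrec eval :: "exp \<Rightarrow> bool list \<Rightarrow> (nat \<Rightarrow> nat) \<Rightarrow> nat" where
  "eval One x \<rho> = 1"
| "eval (Var v) x \<rho> = \<rho> v"
| "eval Len x \<rho> = length x"
| "eval (Bit e) x \<rho> = of_bool (eval e x \<rho> < length x \<and> x ! eval e x \<rho>)"
| "eval (Add a b) x \<rho> = eval a x \<rho> + eval b x \<rho>"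
| "eval (Monus a b) x \<rho> = eval a x \<rho> - eval b x \<rho>"
| "eval (Sum v b f) x \<rho> = (\<Sum>i<eval b x \<rho>. eval f x (\<rho>(v := i)))"

primrec vars :: "exp \<Rightarrow> nat set" where
  "vars One = {}"
| "vars (Var v) = {v}"
| "vars Len = {}"
| "vars (Bit e) = vars e"
| "vars (Add a b) = vars a \<union> vars b"
| "vars (Monus a b) = vars a \<union> vars b"
| "vars (Sum v b f) = insert v (vars b \<union> vars f)"

text \<open>An upper bound on how far above \<open>t\<close> the compiled code touches
  counters.\<close>

primrec temps :: "exp \<Rightarrow> nat" where
  "temps One = 0"
| "temps (Var v) = 1"
| "temps Len = 1"
| "temps (Bit e) = 2 + temps e"
| "temps (Add a b) = 1 + temps a + temps b"
| "temps (Monus a b) = 1 + temps a + temps b"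
| "temps (Sum v b f) = 3 + temps b + temps f"

text \<open>
  The value of the expression is left in counter \<open>t\<close>; the counters above \<open>t\<close> are scratch space
  and are zero before and after. The loop for a sum runs its variable through counter \<open>v\<close>, whose
  old value is parked in counter \<open>t + 1\<close>.
\<close>

primrec comp :: "exp \<Rightarrow> nat \<Rightarrow> com" where
  "comp One t = Inc t"
| "comp (Var v) t = Loop v (Inc t ;; Inc (t + 1)) ;; Loop (t + 1) (Inc v)"
| "comp Len t = While (\<lambda>rs. rs ! 0 \<noteq> 0) (In_right ;; Inc t ;; Inc (t + 1)) ;; Loop (t + 1) In_left"
| "comp (Bit e) t = comp e (t + 1) ;; Loop (t + 1) (In_right ;; Inc (t + 2)) ;;
     Cond (\<lambda>rs. rs ! 0 = 2) (Inc t) Skip ;; Loop (t + 2) In_left"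
| "comp (Add a b) t = comp a t ;; comp b (t + 1) ;; Loop (t + 1) (Inc t)"
| "comp (Monus a b) t = comp a t ;; comp b (t + 1) ;; Loop (t + 1) (Cond (nonzero t) (Dec t) Skip)"
| "comp (Sum v b f) t = comp b (t + 2) ;; Loop v (Inc (t + 1)) ;;
     Loop (t + 2) (comp f (t + 3) ;; Loop (t + 3) (Inc t) ;; Inc v) ;;
     Loop v Skip ;; Loop (t + 1) (Inc v)"

text \<open>The variable of a sum stays below the value of \<open>b\<close>, so inside the body all
  variables are at most \<open>m\<close> plus the bound of \<open>b\<close>; hence the polynomial
  composition.\<close>

primrec bound :: "exp \<Rightarrow> nat poly" where
  "bound One = 1"
| "bound (Var v) = [:0, 1:]"
| "bound Len = [:0, 1:]"
| "bound (Bit e) = 1"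
| "bound (Add a b) = bound a + bound b"
| "bound (Monus a b) = bound a"
| "bound (Sum v b f) = bound b * (bound f \<circ>\<^sub>p ([:0, 1:] + bound b))"

primrec cost :: "exp \<Rightarrow> nat poly" where
  "cost One = 1"
| "cost (Var v) = [:3, 10:]"
| "cost Len = [:3, 10:]"
| "cost (Bit e) = cost e + 10 * bound e + 7"
| "cost (Add a b) = cost a + cost b + 4 * bound b + 3"
| "cost (Monus a b) = cost a + cost b + 5 * bound b + 3"
| "cost (Sum v b f) = cost b + [:8, 8:] + 4 * bound b +
     bound b * ((cost f + 4 * bound f + 7) \<circ>\<^sub>p ([:0, 1:] + bound b))"

section \<open>Correctness and running time of compiled expressions\<close>

lemma poly_nat_mono: "a \<le> b \<Longrightarrow> poly (p :: nat poly) a \<le> poly p b"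
  by (induction p) (auto intro: add_mono mult_mono)

lemma eval_cong: "(\<And>v. v \<in> vars e \<Longrightarrow> \<rho> v = \<rho>' v) \<Longrightarrow> eval e x \<rho> = eval e x \<rho>'"
proof (induction e arbitrary: \<rho> \<rho>')
  case (Bit e)
  have "eval e x \<rho> = eval e x \<rho>'" using Bit.prems by (intro Bit.IH) simp
  then show ?case by simp
next
  case (Add a b)
  have "eval a x \<rho> = eval a x \<rho>'" "eval b x \<rho> = eval b x \<rho>'"
    using Add.prems by (intro Add.IH; simp)+
  then show ?case by simp
next
  case (Monus a b)
  have "eval a x \<rho> = eval a x \<rho>'" "eval b x \<rho> = eval b x \<rho>'"
    using Monus.prems by (intro Monus.IH; simp)+
  then show ?case by simp
next
  case (Sum v b f)
  have "eval b x \<rho> = eval b x \<rho>'" using Sum.prems by (intro Sum.IH(1)) simp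
  moreover have "eval f x (\<rho>(v := i)) = eval f x (\<rho>'(v := i))" for i
    using Sum.prems by (intro Sum.IH(2)) auto
  ultimately show ?case by simp
qed auto

lemma eval_le_bound:
  "length x \<le> m \<Longrightarrow> (\<And>v. v \<in> vars e \<Longrightarrow> \<rho> v \<le> m) \<Longrightarrow> eval e x \<rho> \<le> poly (bound e) m"
proof (induction e arbitrary: \<rho> m)
  case (Add a b)
  then show ?case by (simp add: add_mono)
next
  case (Monus a b)
  then show ?case by (metis UnCI bound.simps(6) diff_le_self eval.simps(6) le_trans vars.simps(6))
next
  case (Sum v b f)
  let ?m = "m + poly (bound b) m"
  have b: "eval b x \<rho> \<le> poly (bound b) m" using Sum by simp
  have "eval f x (\<rho>(v := i)) \<le> poly (bound f) ?m" if "i < eval b x \<rho>" for i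
    using Sum.prems b that by (intro Sum.IH(2)) (auto intro: le_trans[OF _ le_add1])
  then have "eval (Sum v b f) x \<rho> \<le> eval b x \<rho> * poly (bound f) ?m"
    using sum_bounded_above[of "{..<eval b x \<rho>}" "\<lambda>i. eval f x (\<rho>(v := i))" "poly (bound f) ?m"] by simp
  also have "\<dots> \<le> poly (bound b) m * poly (bound f) ?m" using b by simp
  finally show ?case by (simp add: poly_pcompose)
qed auto

lemma runs_conv: "runs c ts B ts' \<Longrightarrow> ts' = ts'' \<Longrightarrow> B \<le> B' \<Longrightarrow> runs c ts B' ts''"
  using runs_mono by blast

text \<open>Since \<open>\<rho>'\<close> differs from \<open>\<rho>\<close> only at
  \<open>t\<close>, the scratch counters are zero again afterwards, and subexpressions can be
  evaluated one after the other at higher counters.\<close>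

lemma runs_comp:
  assumes "vars e \<subseteq> {..<t}" "t + temps e < R" "\<And>r. r \<ge> t \<Longrightarrow> \<rho> r = 0"
    and "length x \<le> m" "\<And>v. v \<in> vars e \<Longrightarrow> \<rho> v \<le> m"
    and "\<rho>' = \<rho>(t := eval e x \<rho>)"
  shows "runs (comp e t) (tapes R x 0 y \<rho>) (poly (cost e) m) (tapes R x 0 y \<rho>')"
  using assms
proof (induction e arbitrary: t \<rho> \<rho>' m)
  case One
  then have S: "\<rho>(t := Suc (\<rho> t)) = \<rho>'" by (auto simp: fun_eq_iff)
  have "t < R" using One by simp
  then show ?case unfolding comp.simps by (intro runs_conv[OF runs_Inc arg_cong[OF S, of "tapes R x 0 y"]]) simp_all
next
  case (Var v)
  let ?\<sigma> = "\<rho>(t := \<rho> t + \<rho> v, t + 1 := \<rho> (t + 1) + \<rho> v, v := 0)"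
  have R: "runs (comp (Var v) t) (tapes R x 0 y \<rho>) (\<rho> v * 6 + 1 + (?\<sigma> (t + 1) * 4 + 1) + 1)
    (tapes R x 0 y (?\<sigma>(v := ?\<sigma> v + ?\<sigma> (t + 1), t + 1 := 0)))"
    unfolding comp.simps by (rule runs_Seq[OF runs_add2_loop runs_add_loop]) (use Var in auto)
  have S: "?\<sigma>(v := ?\<sigma> v + ?\<sigma> (t + 1), t + 1 := 0) = \<rho>'"
    using Var by (auto simp: fun_eq_iff)
  have "?\<sigma> (t + 1) = \<rho> v" "\<rho> v \<le> m" using Var by auto
  then show ?case by (intro runs_conv[OF R arg_cong[OF S, of "tapes R x 0 y"]]) simp
next
  case Len
  let ?\<sigma> = "\<rho>(t := \<rho> t + length x, t + 1 := \<rho> (t + 1) + length x)"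
  have s: "?\<sigma> (t + 1) = length x" using Len by simp
  have R: "runs (comp Len t) (tapes R x 0 y \<rho>) (length x * 6 + 1 + (?\<sigma> (t + 1) * 4 + 1) + 1)
    (tapes R x 0 y (?\<sigma>(t + 1 := 0)))"
    unfolding comp.simps
  proof (rule runs_Seq[OF runs_length_loop])
    show "runs (Loop (t + 1) In_left) (tapes R x (length x) y ?\<sigma>) (?\<sigma> (t + 1) * 4 + 1)
       (tapes R x 0 y (?\<sigma>(t + 1 := 0)))"
      using runs_left_loop[of "t + 1" R x 0 ?\<sigma> y] Len s by simp
  qed (use Len in auto)
  have S: "?\<sigma>(t + 1 := 0) = \<rho>'"
    using Len by (auto simp: fun_eq_iff)
  show ?case by (rule runs_conv[OF R arg_cong[OF S, of "tapes R x 0 y"]]) (use s Len in simp)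
next
  case (Bit e)
  let ?e = "eval e x \<rho>"
  let ?\<rho>1 = "\<rho>(t + 1 := ?e)"
  let ?\<rho>2 = "?\<rho>1(t + 2 := ?\<rho>1 (t + 2) + ?\<rho>1 (t + 1), t + 1 := 0)"
  let ?\<rho>3 = "?\<rho>2(t := eval (Bit e) x \<rho>)"
  have e: "?e \<le> poly (bound e) m" using Bit by (intro eval_le_bound) auto
  have 1: "runs (comp e (t + 1)) (tapes R x 0 y \<rho>) (poly (cost e) m) (tapes R x 0 y ?\<rho>1)"
    using Bit.prems by (intro Bit.IH[OF _ _ _ _ _ refl]) auto
  have 2: "runs (Loop (t + 1) (In_right ;; Inc (t + 2))) (tapes R x 0 y ?\<rho>1) (?\<rho>1 (t + 1) * 6 + 1)
     (tapes R x (0 + ?\<rho>1 (t + 1)) y ?\<rho>2)"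
    using Bit.prems by (intro runs_right_loop) auto
  have "runs (if map read_tape (tapes R x ?e y ?\<rho>2) ! 0 = 2 then Inc t else Skip) (tapes R x ?e y ?\<rho>2) 1
     (tapes R x ?e y ?\<rho>3)"
  proof (cases "?e < length x \<and> x ! ?e")
    case True
    then have "map read_tape (tapes R x ?e y ?\<rho>2) ! 0 = 2"
      by (simp only: read_input) (simp add: string_tape_def bit_symbol_def)
    moreover have "?\<rho>2(t := Suc (?\<rho>2 t)) = ?\<rho>3" using Bit.prems True by (auto simp: fun_eq_iff)
    ultimately show ?thesis using runs_Inc[of t R x ?e y ?\<rho>2] Bit.prems by (simp del: fun_upd_apply)
  next
    case False
    then have "map read_tape (tapes R x ?e y ?\<rho>2) ! 0 \<noteq> 2"
      by (simp only: read_input) (auto simp: string_tape_def bit_symbol_def)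
    moreover have "?\<rho>2 = ?\<rho>3" using Bit.prems False by (auto simp: fun_eq_iff)
    ultimately show ?thesis using runs_Skip by (simp del: fun_upd_apply)
  qed
  from runs_Cond[of "\<lambda>rs. rs ! 0 = 2" _ "Inc t" Skip, OF this]
  have 3: "runs (Cond (\<lambda>rs. rs ! 0 = 2) (Inc t) Skip) (tapes R x (0 + ?\<rho>1 (t + 1)) y ?\<rho>2) (1 + 1)
     (tapes R x (0 + ?\<rho>3 (t + 2)) y ?\<rho>3)" using Bit.prems by simp
  have 4: "runs (Loop (t + 2) In_left) (tapes R x (0 + ?\<rho>3 (t + 2)) y ?\<rho>3) (?\<rho>3 (t + 2) * 4 + 1)
     (tapes R x 0 y (?\<rho>3(t + 2 := 0)))"
    using Bit.prems by (intro runs_left_loop) auto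
  have S: "?\<rho>3(t + 2 := 0) = \<rho>'" using Bit.prems by (auto simp: fun_eq_iff)
  have "?\<rho>1 (t + 1) = ?e" "?\<rho>3 (t + 2) = ?e" using Bit.prems by auto
  with e show ?case unfolding comp.simps
    by (intro runs_conv[OF runs_Seq[OF 1 runs_Seq[OF 2 runs_Seq[OF 3 4]]] arg_cong[OF S, of "tapes R x 0 y"]]) simp
next
  case (Add a b)
  let ?a = "eval a x \<rho>" and ?b = "eval b x \<rho>"
  let ?\<rho>1 = "\<rho>(t := ?a)"
  let ?\<rho>2 = "?\<rho>1(t + 1 := eval b x ?\<rho>1)"
  have e: "?b \<le> poly (bound b) m" using Add.prems by (intro eval_le_bound) auto
  have b1: "eval b x ?\<rho>1 = ?b" using Add.prems by (intro eval_cong) auto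
  have 1: "runs (comp a t) (tapes R x 0 y \<rho>) (poly (cost a) m) (tapes R x 0 y ?\<rho>1)"
    using Add.prems by (intro Add.IH(1)[OF _ _ _ _ _ refl]) auto
  have 2: "runs (comp b (t + 1)) (tapes R x 0 y ?\<rho>1) (poly (cost b) m) (tapes R x 0 y ?\<rho>2)"
    using Add.prems by (intro Add.IH(2)[OF _ _ _ _ _ refl]) auto
  have 3: "runs (Loop (t + 1) (Inc t)) (tapes R x 0 y ?\<rho>2) (?\<rho>2 (t + 1) * 4 + 1)
     (tapes R x 0 y (?\<rho>2(t := ?\<rho>2 t + ?\<rho>2 (t + 1), t + 1 := 0)))"
    using Add.prems by (intro runs_add_loop) auto
  have S: "?\<rho>2(t := ?\<rho>2 t + ?\<rho>2 (t + 1), t + 1 := 0) = \<rho>'"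
    using Add.prems b1 by (auto simp: fun_eq_iff)
  have "?\<rho>2 (t + 1) = ?b" using b1 by simp
  with e show ?case unfolding comp.simps
    by (intro runs_conv[OF runs_Seq[OF 1 runs_Seq[OF 2 3]] arg_cong[OF S, of "tapes R x 0 y"]]) simp
next
  case (Monus a b)
  let ?a = "eval a x \<rho>" and ?b = "eval b x \<rho>"
  let ?\<rho>1 = "\<rho>(t := ?a)"
  let ?\<rho>2 = "?\<rho>1(t + 1 := eval b x ?\<rho>1)"
  have e: "?b \<le> poly (bound b) m" using Monus.prems by (intro eval_le_bound) auto
  have b1: "eval b x ?\<rho>1 = ?b" using Monus.prems by (intro eval_cong) auto
  have 1: "runs (comp a t) (tapes R x 0 y \<rho>) (poly (cost a) m) (tapes R x 0 y ?\<rho>1)"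
    using Monus.prems by (intro Monus.IH(1)[OF _ _ _ _ _ refl]) auto
  have 2: "runs (comp b (t + 1)) (tapes R x 0 y ?\<rho>1) (poly (cost b) m) (tapes R x 0 y ?\<rho>2)"
    using Monus.prems by (intro Monus.IH(2)[OF _ _ _ _ _ refl]) auto
  have 3: "runs (Loop (t + 1) (Cond (nonzero t) (Dec t) Skip)) (tapes R x 0 y ?\<rho>2) (?\<rho>2 (t + 1) * 5 + 1)
     (tapes R x 0 y (?\<rho>2(t := ?\<rho>2 t - ?\<rho>2 (t + 1), t + 1 := 0)))"
    using Monus.prems by (intro runs_sub_loop) auto
  have S: "?\<rho>2(t := ?\<rho>2 t - ?\<rho>2 (t + 1), t + 1 := 0) = \<rho>'"
    using Monus.prems b1 by (auto simp: fun_eq_iff)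
  have "?\<rho>2 (t + 1) = ?b" using b1 by simp
  with e show ?case unfolding comp.simps
    by (intro runs_conv[OF runs_Seq[OF 1 runs_Seq[OF 2 3]] arg_cong[OF S, of "tapes R x 0 y"]]) simp
next
  case (Sum v b f)
  let ?b = "eval b x \<rho>" and ?B = "poly (bound b) m"
  let ?m = "m + ?B"
  let ?F = "\<lambda>i. eval f x (\<rho>(v := i))"
  let ?\<rho>1 = "\<rho>(t + 2 := ?b)"
  let ?\<rho>2 = "?\<rho>1(t + 1 := ?\<rho>1 (t + 1) + ?\<rho>1 v, v := 0)"
  \<comment> \<open>The counters before round \<open>i\<close>, apart from the loop counter
    \<open>t + 2\<close>: the old value of \<open>v\<close> is parked in \<open>t + 1\<close>,
    \<open>v\<close> holds \<open>i\<close>, and \<open>t\<close> holds the partial sum.\<close>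
  define \<sigma> where "\<sigma> i = \<rho>(t + 1 := \<rho> v, v := i, t := \<Sum>j<i. ?F j)" for i
  let ?\<rho>4 = "(\<sigma> ?b)(t + 2 := 0)"
  let ?\<rho>5 = "?\<rho>4(v := 0)"
  have v: "v < t" using Sum.prems(1) by simp
  have z: "\<rho> (t + k) = 0" "\<rho> t = 0" for k using Sum.prems(3) by auto
  have e: "?b \<le> ?B" using Sum.prems by (intro eval_le_bound) auto
  have 1: "runs (comp b (t + 2)) (tapes R x 0 y \<rho>) (poly (cost b) m) (tapes R x 0 y ?\<rho>1)"
    using Sum.prems by (intro Sum.IH(1)[OF _ _ _ _ _ refl]) auto
  have 2: "runs (Loop v (Inc (t + 1))) (tapes R x 0 y ?\<rho>1) (?\<rho>1 v * 4 + 1) (tapes R x 0 y ?\<rho>2)"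
    using Sum.prems v by (intro runs_add_loop) auto
  have "?\<rho>2 = (\<sigma> 0)(t + 2 := ?b)" using v z(1)[of 1] z(2) by (auto simp: fun_eq_iff \<sigma>_def)
  note 2 = 2[unfolded this]
  let ?L = "poly (cost f) ?m + (poly (bound f) ?m * 4 + 1 + 1 + 1) + 1"
  have 3: "runs (Loop (t + 2) (comp f (t + 3) ;; Loop (t + 3) (Inc t) ;; Inc v))
     (tapes R x 0 y ((\<sigma> 0)(t + 2 := ?b))) (?b * (?L + 3) + 1) (tapes R x 0 y ?\<rho>4)"
  proof (rule runs_Loop[where h = "\<lambda>_. 0" and y = "\<lambda>_. y" and \<rho> = \<sigma>])
    fix i assume i: "i < ?b"
    let ?\<tau> = "(\<sigma> i)(t + 2 := ?b - Suc i)"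
    \<comment> \<open>The body mentions only variables below \<open>t\<close>, so the scratch
      counters do not influence its value.\<close>
    have agree: "?\<tau> w = (\<rho>(v := i)) w" if "w \<in> vars f" for w
      using that Sum.prems(1) v by (auto simp: \<sigma>_def)
    have ev: "eval f x ?\<tau> = ?F i" using agree by (rule eval_cong)
    have le: "(\<rho>(v := i)) w \<le> ?m" if "w \<in> vars f" for w
      using that Sum.prems(5)[of w] i e by auto
    have fb: "?F i \<le> poly (bound f) ?m" using Sum.prems(4) le by (intro eval_le_bound) auto
    have tz: "?\<tau> r = 0" if "t + 3 \<le> r" for r using that Sum.prems(3) v by (auto simp: \<sigma>_def)
    have f1: "runs (comp f (t + 3)) (tapes R x 0 y ?\<tau>) (poly (cost f) ?m) (tapes R x 0 y (?\<tau>(t + 3 := eval f x ?\<tau>)))"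
      using Sum.prems tz le agree by (intro Sum.IH(2)[OF _ _ _ _ _ refl]) fastforce+
    let ?\<tau>1 = "?\<tau>(t + 3 := ?F i)"
    let ?\<tau>2 = "?\<tau>1(t := ?\<tau>1 t + ?\<tau>1 (t + 3), t + 3 := 0)"
    have f2: "runs (Loop (t + 3) (Inc t)) (tapes R x 0 y ?\<tau>1) (?\<tau>1 (t + 3) * 4 + 1) (tapes R x 0 y ?\<tau>2)"
      using Sum.prems by (intro runs_add_loop) auto
    have f3: "runs (Inc v) (tapes R x 0 y ?\<tau>2) 1 (tapes R x 0 y (?\<tau>2(v := Suc (?\<tau>2 v))))"
      using Sum.prems v by (intro runs_Inc) auto
    have S: "?\<tau>2(v := Suc (?\<tau>2 v)) = (\<sigma> (Suc i))(t + 2 := ?b - Suc i)"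
      using v z(1)[of 3] by (auto simp: \<sigma>_def fun_eq_iff)
    show "runs (comp f (t + 3) ;; Loop (t + 3) (Inc t) ;; Inc v) (tapes R x 0 y ?\<tau>) ?L
       (tapes R x 0 y ((\<sigma> (Suc i))(t + 2 := ?b - Suc i)))"
      by (rule runs_conv[OF runs_Seq[OF f1[unfolded ev] runs_Seq[OF f2 f3]] arg_cong[OF S, of "tapes R x 0 y"]]) (use fb in simp)
  qed (use Sum.prems in auto)
  have 4: "runs (Loop v Skip) (tapes R x 0 y ?\<rho>4) (?\<rho>4 v * 4 + 1) (tapes R x 0 y ?\<rho>5)"
    using Sum.prems v by (intro runs_clear_loop) auto
  have 5: "runs (Loop (t + 1) (Inc v)) (tapes R x 0 y ?\<rho>5) (?\<rho>5 (t + 1) * 4 + 1)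
     (tapes R x 0 y (?\<rho>5(v := ?\<rho>5 v + ?\<rho>5 (t + 1), t + 1 := 0)))"
    using Sum.prems v by (intro runs_add_loop) auto
  have S: "?\<rho>5(v := ?\<rho>5 v + ?\<rho>5 (t + 1), t + 1 := 0) = \<rho>'"
    using v z(1)[of 1] z(1)[of 2] Sum.prems(6) by (auto simp: fun_eq_iff \<sigma>_def)
  have c: "?\<rho>4 v = ?b" "?\<rho>5 (t + 1) = \<rho> v" "?\<rho>1 v = \<rho> v" using v by (auto simp: \<sigma>_def)
  have "?b * (?L + 3) \<le> ?B * (?L + 3)" using e by (rule mult_le_mono1)
  moreover have "\<rho> v \<le> m" using Sum.prems by simp
  moreover have "poly (cost (Sum v b f)) m = poly (cost b) m + 8 + 8 * m + 4 * ?B + ?B * (?L + 3)"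
    by (simp add: poly_pcompose algebra_simps)
  ultimately have T: "poly (cost b) m + (?\<rho>1 v * 4 + 1 + (?b * (?L + 3) + 1 + (?\<rho>4 v * 4 + 1 +
      (?\<rho>5 (t + 1) * 4 + 1) + 1) + 1) + 1) + 1 \<le> poly (cost (Sum v b f)) m"
    using e unfolding c by linarith
  show ?case unfolding comp.simps
    by (rule runs_conv[OF runs_Seq[OF 1 runs_Seq[OF 2 runs_Seq[OF 3 runs_Seq[OF 4 5]]]] arg_cong[OF S, of "tapes R x 0 y"] T])
qed

lemma wf_on_tape: "(\<And>s. s < n \<Longrightarrow> fst (g s) < n) \<Longrightarrow> wf_com k n (on_tape j g)"
  by (auto simp: on_tape_def subset_iff)

lemma wf_basic [simp]:
  "wf_com k 3 (Inc r)" "wf_com k 3 (Dec r)" "wf_com k 3 In_right" "wf_com k 3 In_left"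
  "wf_com k 3 (Out b)" "wf_com k 3 Skip"
  unfolding Inc_def Dec_def In_right_def In_left_def Out_def
  by (auto intro!: wf_on_tape simp: bit_symbol_def Skip_def idle_def)

lemma wf_Loop [simp]: "wf_com k 3 (Loop r c) \<longleftrightarrow> wf_com k 3 c"
  by (simp add: Loop_def)

lemma wf_comp [simp]: "wf_com k 3 (comp e t)"
  by (induction e arbitrary: t) auto

text \<open>The expression \<open>f\<close> refers to the position of an output bit as variable \<open>0\<close>.\<close>

lemma polytime_eval:
  "polytime_computable (\<lambda>x. map (\<lambda>i. eval f x ((\<lambda>_. 0)(0 := i)) \<noteq> 0) [0..<eval l x (\<lambda>_. 0)])"
proof -
  have "finite (vars e)" for e by (induction e) auto
  \<comment> \<open>Counter 0 holds the output position, so it must lie below the scratch counters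
    even if neither expression mentions it.\<close>
  then have "finite (insert 0 (vars l \<union> vars f))" by simp
  then obtain t where t: "insert 0 (vars l \<union> vars f) \<subseteq> {..<t}"
    using finite_nat_iff_bounded by blast
  define R where "R = t + temps l + temps f + 3"
  \<comment> \<open>Symbol 1 in cell 0 turns a blank tape into a counter of value 0.\<close>
  define mark where "mark = Act (\<lambda>rs. map (\<lambda>i. (if i < 2 then rs ! i else 1, Stay)) [0..<length rs])"
  define emit where "emit = Cond (nonzero (t + 1)) (Out True) (Out False)"
  \<comment> \<open>Counter \<open>t\<close> holds the number of bits still to be written, counter 0
    the number already written.\<close>
  define c where "c = mark ;; comp l t ;; Loop t (comp f (t + 1) ;; emit ;; Loop (t + 1) Skip ;; Inc 0)"
  have "wf_com (R + 2) 3 c"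
    unfolding c_def emit_def by (auto simp: mark_def subset_iff simp del: upt_Suc)
  then obtain M where M: "turing_machine M" "num_tapes M = R + 2"
      "\<And>ts n ts'. exec c ts n ts' \<Longrightarrow> (step M ^^ n) (0, ts) = (num_states M, ts')"
    by (rule com_turing_machine) auto
  define T where "T = cost l + 11 + bound l * ((cost f + 4 * bound f + 12) \<circ>\<^sub>p ([:0, 1:] + bound l))"
  have "\<exists>n\<le>poly T (length x). \<exists>\<rho>. exec c (snd (init_config M x)) n (tapes R x 0
      (map (\<lambda>i. eval f x ((\<lambda>_. 0)(0 := i)) \<noteq> 0) [0..<eval l x (\<lambda>_. 0)]) \<rho>)" for x
  proof -
    let ?z = "\<lambda>_. 0 :: nat"
    let ?l = "eval l x ?z" and ?m = "length x" and ?B = "poly (bound l) (length x)"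
    let ?M = "?m + ?B"
    let ?F = "\<lambda>i. eval f x (?z(0 := i))"
    define out where "out i = map (\<lambda>i. ?F i \<noteq> 0) [0..<i]" for i
    have init: "snd (init_config M x) = (string_tape x, 0) # replicate (R + 1) (\<lambda>_. 0, 0)"
      by (simp add: init_config_def M(2))
    have 1: "runs mark (snd (init_config M x)) 1 (tapes R x 0 [] ?z)"
      unfolding mark_def
      by (rule runs_Act, rule nth_equalityI)
        (auto simp: init tapes_def nth_Cons read_tape_def act_tape_def marker_def string_tape_def fun_eq_iff
          simp del: upt_Suc split: nat.splits)
    have 2: "runs (comp l t) (tapes R x 0 [] ?z) (poly (cost l) ?m) (tapes R x 0 [] (?z(t := ?l)))"
      using t by (intro runs_comp) (auto simp: R_def)
    have l: "?l \<le> ?B" by (intro eval_le_bound) auto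
    let ?L = "poly (cost f) ?M + (2 + (poly (bound f) ?M * 4 + 1 + 1 + 1) + 1) + 1"
    have t0: "t > 0" using t by auto
    have 3: "runs (Loop t (comp f (t + 1) ;; emit ;; Loop (t + 1) Skip ;; Inc 0))
      (tapes R x 0 (out 0) ((?z(0 := 0))(t := ?l))) (?l * (?L + 3) + 1) (tapes R x 0 (out ?l) ((?z(0 := ?l))(t := 0)))"
    proof (rule runs_Loop[where h = "\<lambda>_. 0" and y = out and \<rho> = "\<lambda>i. ?z(0 := i)"])
      fix i assume i: "i < ?l"
      let ?\<tau> = "?z(0 := i, t := ?l - Suc i)"
      have ev: "eval f x ?\<tau> = ?F i" using t by (intro eval_cong) auto
      have fb: "?F i \<le> poly (bound f) ?M" using i l by (intro eval_le_bound) auto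
      have f1: "runs (comp f (t + 1)) (tapes R x 0 (out i) ?\<tau>) (poly (cost f) ?M)
          (tapes R x 0 (out i) (?\<tau>(t + 1 := eval f x ?\<tau>)))"
        using t i l by (intro runs_comp) (auto simp: R_def)
      let ?\<tau>1 = "?\<tau>(t + 1 := ?F i)"
      have "runs (if nonzero (t + 1) (map read_tape (tapes R x 0 (out i) ?\<tau>1)) then Out True else Out False)
          (tapes R x 0 (out i) ?\<tau>1) 1 (tapes R x 0 (out (Suc i)) ?\<tau>1)"
        using runs_Out[of "?F i \<noteq> 0" R x 0 "out i" ?\<tau>1]
        by (auto simp: R_def out_def)
      from runs_Cond[of "nonzero (t + 1)" _ "Out True" "Out False", OF this]
      have f2: "runs emit (tapes R x 0 (out i) ?\<tau>1) 2 (tapes R x 0 (out (Suc i)) ?\<tau>1)"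
        by (simp add: emit_def numeral_2_eq_2)
      have f3: "runs (Loop (t + 1) Skip) (tapes R x 0 (out (Suc i)) ?\<tau>1) (?\<tau>1 (t + 1) * 4 + 1)
         (tapes R x 0 (out (Suc i)) (?\<tau>1(t + 1 := 0)))"
        by (intro runs_clear_loop) (simp add: R_def)
      let ?\<tau>2 = "?\<tau>1(t + 1 := 0)"
      have f4: "runs (Inc 0) (tapes R x 0 (out (Suc i)) ?\<tau>2) 1
         (tapes R x 0 (out (Suc i)) (?\<tau>2(0 := Suc (?\<tau>2 0))))"
        by (intro runs_Inc) (simp add: R_def)
      have S: "?\<tau>2(0 := Suc (?\<tau>2 0)) = ?z(0 := Suc i, t := ?l - Suc i)"
        using t0 by (auto simp: fun_eq_iff)
      show "runs (comp f (t + 1) ;; emit ;; Loop (t + 1) Skip ;; Inc 0) (tapes R x 0 (out i) ?\<tau>) ?L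
         (tapes R x 0 (out (Suc i)) (?z(0 := Suc i, t := ?l - Suc i)))"
        by (rule runs_conv[OF runs_Seq[OF f1[unfolded ev] runs_Seq[OF f2 runs_Seq[OF f3 f4]]]
            arg_cong[OF S, of "tapes R x 0 (out (Suc i))"]]) (use fb in simp)
    qed (simp add: R_def)
    have "(?z(0 := 0))(t := ?l) = ?z(t := ?l)" "out 0 = []" by (auto simp: fun_eq_iff out_def)
    note 4 = runs_Seq[OF 1 runs_Seq[OF 2 3[unfolded this]], folded c_def]
    have "?l * (?L + 3) \<le> ?B * (?L + 3)" using l by (rule mult_le_mono1)
    then have "1 + (poly (cost l) ?m + (?l * (?L + 3) + 1) + 1) + 1 \<le> poly T ?m"
      by (simp add: T_def poly_pcompose algebra_simps)
    from runs_mono[OF 4 this] show ?thesis unfolding runs_def out_def by blast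
  qed
  then obtain n \<rho> where n: "\<And>x. n x \<le> poly T (length x)"
      "\<And>x. exec c (snd (init_config M x)) (n x) (tapes R x 0
      (map (\<lambda>i. eval f x ((\<lambda>_. 0)(0 := i)) \<noteq> 0) [0..<eval l x (\<lambda>_. 0)]) (\<rho> x))"
    by metis
  have out: "has_output (q, tapes R x h y \<rho>) y" for q x h y \<rho>
    by (auto simp: has_output_def string_tape_def)
  have "computes_in_time M (\<lambda>x. map (\<lambda>i. eval f x ((\<lambda>_. 0)(0 := i)) \<noteq> 0) [0..<eval l x (\<lambda>_. 0)]) (poly T)"
    unfolding computes_in_time_def Let_def
  proof (intro allI exI conjI)
    fix x
    have "(step M ^^ n x) (init_config M x) = (num_states M, tapes R x 0
        (map (\<lambda>i. eval f x ((\<lambda>_. 0)(0 := i)) \<noteq> 0) [0..<eval l x (\<lambda>_. 0)]) (\<rho> x))"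
      using M(3)[OF n(2)[of x]] by (simp add: init_config_def)
    then show "halted M ((step M ^^ n x) (init_config M x))"
      "has_output ((step M ^^ n x) (init_config M x))
        (map (\<lambda>i. eval f x ((\<lambda>_. 0)(0 := i)) \<noteq> 0) [0..<eval l x (\<lambda>_. 0)])"
      using out by (simp_all only: halted_def fst_conv)
  qed (rule n(1))
  then show ?thesis unfolding polytime_computable_def using M(1) by blast
qed

section \<open>Definable functions\<close>

text \<open>
  A function of a state \<open>s\<close> is definable if an expression computes it from the string \<open>X s\<close> and the
  numbers \<open>a s\<close>, for \<open>a\<close> in the list \<open>\<Gamma>\<close> of the visible variables. A bounded sum adds the bound
  variable to the state, as the second component of a pair.
\<close>

definition dfn :: "('s \<Rightarrow> bool list) \<Rightarrow> ('s \<Rightarrow> nat) list \<Rightarrow> ('s \<Rightarrow> nat) \<Rightarrow> bool" where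
  "dfn X \<Gamma> f \<longleftrightarrow> (\<exists>e. \<forall>s \<rho>. (\<forall>k<length \<Gamma>. \<rho> k = (\<Gamma> ! k) s) \<longrightarrow> eval e (X s) \<rho> = f s)"

definition dfp :: "('s \<Rightarrow> bool list) \<Rightarrow> ('s \<Rightarrow> nat) list \<Rightarrow> ('s \<Rightarrow> bool) \<Rightarrow> bool" where
  "dfp X \<Gamma> P \<longleftrightarrow> dfn X \<Gamma> (\<lambda>s. of_bool (P s))"

definition bit_at :: "bool list \<Rightarrow> nat \<Rightarrow> bool" where
  "bit_at x i \<longleftrightarrow> i < length x \<and> x ! i"

section \<open>Closure properties of the definable functions\<close>

lemma dfnI: "(\<And>s \<rho>. (\<And>k. k < length \<Gamma> \<Longrightarrow> \<rho> k = (\<Gamma> ! k) s) \<Longrightarrow> eval e (X s) \<rho> = f s) \<Longrightarrow> dfn X \<Gamma> f"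
  unfolding dfn_def by blast

lemma dfnE:
  assumes "dfn X \<Gamma> f"
  obtains e where "\<And>s \<rho>. (\<And>k. k < length \<Gamma> \<Longrightarrow> \<rho> k = (\<Gamma> ! k) s) \<Longrightarrow> eval e (X s) \<rho> = f s"
  using assms unfolding dfn_def by blast

lemma dfn_var: "f \<in> set \<Gamma> \<Longrightarrow> dfn X \<Gamma> f"
proof -
  assume "f \<in> set \<Gamma>"
  then obtain k where "k < length \<Gamma>" "\<Gamma> ! k = f" by (auto simp: in_set_conv_nth)
  then show ?thesis by (intro dfnI[of _ "Var k"]) auto
qed

lemma dfn_length: "dfn X \<Gamma> (\<lambda>s. length (X s))"
  by (rule dfnI[of _ Len]) simp

lemma dfn_add: "dfn X \<Gamma> f \<Longrightarrow> dfn X \<Gamma> g \<Longrightarrow> dfn X \<Gamma> (\<lambda>s. f s + g s)"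
proof (elim dfnE)
  fix a b
  assume "\<And>s \<rho>. (\<And>k. k < length \<Gamma> \<Longrightarrow> \<rho> k = (\<Gamma> ! k) s) \<Longrightarrow> eval a (X s) \<rho> = f s"
    "\<And>s \<rho>. (\<And>k. k < length \<Gamma> \<Longrightarrow> \<rho> k = (\<Gamma> ! k) s) \<Longrightarrow> eval b (X s) \<rho> = g s"
  then show ?thesis by (intro dfnI[of _ "Add a b"]) auto
qed

lemma dfn_diff: "dfn X \<Gamma> f \<Longrightarrow> dfn X \<Gamma> g \<Longrightarrow> dfn X \<Gamma> (\<lambda>s. f s - g s)"
proof (elim dfnE)
  fix a b
  assume "\<And>s \<rho>. (\<And>k. k < length \<Gamma> \<Longrightarrow> \<rho> k = (\<Gamma> ! k) s) \<Longrightarrow> eval a (X s) \<rho> = f s"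
    "\<And>s \<rho>. (\<And>k. k < length \<Gamma> \<Longrightarrow> \<rho> k = (\<Gamma> ! k) s) \<Longrightarrow> eval b (X s) \<rho> = g s"
  then show ?thesis by (intro dfnI[of _ "Monus a b"]) auto
qed

lemma dfp_bit: "dfn X \<Gamma> f \<Longrightarrow> dfp X \<Gamma> (\<lambda>s. bit_at (X s) (f s))"
proof (unfold dfp_def, elim dfnE)
  fix a
  assume "\<And>s \<rho>. (\<And>k. k < length \<Gamma> \<Longrightarrow> \<rho> k = (\<Gamma> ! k) s) \<Longrightarrow> eval a (X s) \<rho> = f s"
  then show "dfn X \<Gamma> (\<lambda>s. of_bool (bit_at (X s) (f s)))"
    by (intro dfnI[of _ "Bit a"]) (auto simp: bit_at_def)
qed

text \<open>The new variable is appended at the end of the list, so the old variables keep their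
  indices and the same expression works; the variable bound by a sum accordingly has index
  \<open>length \<Gamma>\<close>.\<close>

lemma dfn_weaken:
  "dfn X \<Gamma> f \<Longrightarrow> dfn (\<lambda>p. X (fst p)) (map (\<lambda>a p. a (fst p)) \<Gamma> @ [snd]) (\<lambda>p. f (fst p))"
proof (elim dfnE)
  fix e assume e: "\<And>s \<rho>. (\<And>k. k < length \<Gamma> \<Longrightarrow> \<rho> k = (\<Gamma> ! k) s) \<Longrightarrow> eval e (X s) \<rho> = f s"
  show ?thesis
  proof (rule dfnI[of _ e])
    fix p and \<rho> :: "nat \<Rightarrow> nat"
    assume \<rho>: "\<And>k. k < length (map (\<lambda>a p. a (fst p)) \<Gamma> @ [snd]) \<Longrightarrow>
        \<rho> k = ((map (\<lambda>a p. a (fst p)) \<Gamma> @ [snd]) ! k) p"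
    have "\<rho> k = (\<Gamma> ! k) (fst p)" if "k < length \<Gamma>" for k
      using \<rho>[of k] that by (simp add: nth_append)
    then show "eval e (X (fst p)) \<rho> = f (fst p)" by (rule e)
  qed
qed

lemma dfp_weaken:
  "dfp X \<Gamma> P \<Longrightarrow> dfp (\<lambda>p. X (fst p)) (map (\<lambda>a p. a (fst p)) \<Gamma> @ [snd]) (\<lambda>p. P (fst p))"
  unfolding dfp_def by (rule dfn_weaken)

lemma dfn_sum:
  assumes "dfn X \<Gamma> b"
    and "dfn (\<lambda>p. X (fst p)) (map (\<lambda>a p. a (fst p)) \<Gamma> @ [snd]) (\<lambda>p. f (fst p) (snd p))"
  shows "dfn X \<Gamma> (\<lambda>s. \<Sum>i<b s. f s i)"
proof -
  from assms(1) obtain c where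
    c: "\<And>s \<rho>. (\<And>k. k < length \<Gamma> \<Longrightarrow> \<rho> k = (\<Gamma> ! k) s) \<Longrightarrow> eval c (X s) \<rho> = b s"
    by (rule dfnE) blast
  from assms(2) obtain d where
    d: "\<And>p \<rho>. (\<And>k. k < Suc (length \<Gamma>) \<Longrightarrow> \<rho> k = ((map (\<lambda>a p. a (fst p)) \<Gamma> @ [snd]) ! k) p) \<Longrightarrow>
      eval d (X (fst p)) \<rho> = f (fst p) (snd p)"
    by (rule dfnE) auto
  show ?thesis
  proof (rule dfnI[of _ "Sum (length \<Gamma>) c d"])
    fix s and \<rho> :: "nat \<Rightarrow> nat" assume \<rho>: "\<And>k. k < length \<Gamma> \<Longrightarrow> \<rho> k = (\<Gamma> ! k) s"
    have "eval d (X s) (\<rho>(length \<Gamma> := i)) = f s i" for i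
    proof -
      have "(\<rho>(length \<Gamma> := i)) k = ((map (\<lambda>a p. a (fst p)) \<Gamma> @ [snd]) ! k) (s, i)"
        if "k < Suc (length \<Gamma>)" for k
        using that \<rho>[of k] by (cases "k = length \<Gamma>") (auto simp: nth_append)
      from d[of "\<rho>(length \<Gamma> := i)" "(s, i)", OF this] show ?thesis by simp
    qed
    then show "eval (Sum (length \<Gamma>) c d) (X s) \<rho> = (\<Sum>i<b s. f s i)"
      using c[of \<rho> s, OF \<rho>] by simp
  qed
qed

lemma dfn_const: "dfn X \<Gamma> (\<lambda>s. n)"
proof (induction n)
  have one: "dfn X \<Gamma> (\<lambda>s. 1)" by (rule dfnI[of _ One]) simp
  { case 0 show ?case using dfn_diff[OF one one] by simp }
  { case (Suc n) then show ?case using dfn_add[OF one Suc] by simp }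
qed

lemma dfn_mult: "dfn X \<Gamma> f \<Longrightarrow> dfn X \<Gamma> g \<Longrightarrow> dfn X \<Gamma> (\<lambda>s. f s * g s)"
  using dfn_sum[of X \<Gamma> f "\<lambda>s _. g s"] dfn_weaken[of X \<Gamma> g] by simp

lemma dfn_of_bool: "dfp X \<Gamma> P \<Longrightarrow> dfn X \<Gamma> (\<lambda>s. of_bool (P s))"
  by (simp add: dfp_def)

lemma dfp_const: "dfp X \<Gamma> (\<lambda>s. P)"
  by (simp add: dfp_def dfn_const)

lemma dfp_not: "dfp X \<Gamma> P \<Longrightarrow> dfp X \<Gamma> (\<lambda>s. \<not> P s)"
proof -
  assume "dfp X \<Gamma> P"
  then have "dfn X \<Gamma> (\<lambda>s. 1 - of_bool (P s))" unfolding dfp_def by (intro dfn_diff dfn_const)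
  moreover have "1 - of_bool (P s) = (of_bool (\<not> P s) :: nat)" for s by simp
  ultimately show ?thesis by (simp add: dfp_def)
qed

lemma dfp_conj: "dfp X \<Gamma> P \<Longrightarrow> dfp X \<Gamma> Q \<Longrightarrow> dfp X \<Gamma> (\<lambda>s. P s \<and> Q s)"
  unfolding dfp_def of_bool_conj by (rule dfn_mult)

lemma dfp_disj: "dfp X \<Gamma> P \<Longrightarrow> dfp X \<Gamma> Q \<Longrightarrow> dfp X \<Gamma> (\<lambda>s. P s \<or> Q s)"
proof -
  assume "dfp X \<Gamma> P" "dfp X \<Gamma> Q"
  then have "dfp X \<Gamma> (\<lambda>s. \<not> (\<not> P s \<and> \<not> Q s))" by (intro dfp_not dfp_conj)
  then show ?thesis by simp
qed

lemma dfp_imp: "dfp X \<Gamma> P \<Longrightarrow> dfp X \<Gamma> Q \<Longrightarrow> dfp X \<Gamma> (\<lambda>s. P s \<longrightarrow> Q s)"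
  unfolding imp_conv_disj by (intro dfp_disj dfp_not)

lemma dfp_le: "dfn X \<Gamma> f \<Longrightarrow> dfn X \<Gamma> g \<Longrightarrow> dfp X \<Gamma> (\<lambda>s. f s \<le> g s)"
proof -
  assume "dfn X \<Gamma> f" "dfn X \<Gamma> g"
  then have "dfn X \<Gamma> (\<lambda>s. 1 - (f s - g s))" by (intro dfn_diff dfn_const)
  moreover have "1 - (f s - g s) = of_bool (f s \<le> g s)" for s by auto
  ultimately show ?thesis by (simp add: dfp_def)
qed

lemma dfp_less: "dfn X \<Gamma> f \<Longrightarrow> dfn X \<Gamma> g \<Longrightarrow> dfp X \<Gamma> (\<lambda>s. f s < g s)"
  unfolding not_le[symmetric] by (intro dfp_not dfp_le)

lemma dfp_eq: "dfn X \<Gamma> f \<Longrightarrow> dfn X \<Gamma> g \<Longrightarrow> dfp X \<Gamma> (\<lambda>s. f s = g s)"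
  unfolding order_eq_iff by (intro dfp_conj dfp_le)

lemma dfp_ex:
  assumes "dfn X \<Gamma> b"
    and "dfp (\<lambda>p. X (fst p)) (map (\<lambda>a p. a (fst p)) \<Gamma> @ [snd]) (\<lambda>p. P (fst p) (snd p))"
  shows "dfp X \<Gamma> (\<lambda>s. \<exists>i<b s. P s i)"
proof -
  have "dfp X \<Gamma> (\<lambda>s. 0 < (\<Sum>i<b s. of_bool (P s i) :: nat))"
    using assms by (intro dfp_less dfn_const dfn_sum) (simp_all add: dfp_def)
  moreover have "0 < (\<Sum>i<b s. of_bool (P s i) :: nat) \<longleftrightarrow> (\<exists>i<b s. P s i)" for s
    by (auto simp: gr0_conv_Suc[symmetric] simp flip: neq0_conv)
  ultimately show ?thesis by simp
qed

lemma dfp_all: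
  assumes "dfn X \<Gamma> b"
    and "dfp (\<lambda>p. X (fst p)) (map (\<lambda>a p. a (fst p)) \<Gamma> @ [snd]) (\<lambda>p. P (fst p) (snd p))"
  shows "dfp X \<Gamma> (\<lambda>s. \<forall>i<b s. P s i)"
  using dfp_not[OF dfp_ex[OF assms(1) dfp_not[OF assms(2)]]] by simp

lemma dfn_if:
  assumes "dfp X \<Gamma> P" "dfn X \<Gamma> f" "dfn X \<Gamma> g"
  shows "dfn X \<Gamma> (\<lambda>s. if P s then f s else g s)"
proof -
  have "dfn X \<Gamma> (\<lambda>s. of_bool (P s) * f s + of_bool (\<not> P s) * g s)"
    using assms by (intro dfn_add dfn_mult dfn_of_bool dfp_not)
  moreover have "of_bool (P s) * f s + of_bool (\<not> P s) * g s = (if P s then f s else g s)" for s by simp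
  ultimately show ?thesis by simp
qed

lemma dfp_if:
  assumes "dfp X \<Gamma> P" "dfp X \<Gamma> Q" "dfp X \<Gamma> R"
  shows "dfp X \<Gamma> (\<lambda>s. if P s then Q s else R s)"
  using dfp_conj[OF dfp_imp[OF assms(1,2)] dfp_imp[OF dfp_not[OF assms(1)] assms(3)]]
  by (simp add: if_bool_eq_conj)

lemma dfp_iff: "dfp X \<Gamma> P \<Longrightarrow> dfp X \<Gamma> Q \<Longrightarrow> dfp X \<Gamma> (\<lambda>s. P s \<longleftrightarrow> Q s)"
  unfolding iff_conv_conj_imp by (intro dfp_conj dfp_imp)

text \<open>The quotient counts the positive multiples of the divisor up to the dividend; the
  condition \<open>0 < g s\<close> gives the value 0 that division by zero has.\<close>

lemma dfn_div:
  assumes "dfn X \<Gamma> f" "dfn X \<Gamma> g"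
  shows "dfn X \<Gamma> (\<lambda>s. f s div g s)"
proof -
  have "dfn X \<Gamma> (\<lambda>s. \<Sum>i<f s. of_bool (0 < g s \<and> (i + 1) * g s \<le> f s))"
    by (intro dfn_sum dfn_of_bool dfp_conj dfp_less dfp_le dfn_mult dfn_add dfn_const
        dfn_weaken assms dfn_var) simp
  moreover have "(\<Sum>i<a. of_bool (0 < b \<and> (i + 1) * b \<le> a)) = a div b" for a b :: nat
  proof (cases "b = 0")
    case False
    then have "{i \<in> {..<a}. (i + 1) * b \<le> a} = {..<a div b}"
      using less_le_trans[OF _ div_le_dividend[of a b]]
      by (auto simp: less_eq_div_iff_mult_less_eq Suc_le_eq[symmetric] simp del: mult_Suc)
    then have "card {i \<in> {..<a}. (i + 1) * b \<le> a} = a div b" by simp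
    then show ?thesis using False sum.inter_filter[of "{..<a}" "\<lambda>_. 1::nat" "\<lambda>i. (i + 1) * b \<le> a"]
      by (simp add: of_bool_def)
  qed simp
  ultimately show ?thesis by simp
qed

lemma dfn_mod:
  assumes "dfn X \<Gamma> f" "dfn X \<Gamma> g"
  shows "dfn X \<Gamma> (\<lambda>s. f s mod g s)"
proof -
  have "dfn X \<Gamma> (\<lambda>s. f s - g s * (f s div g s))" by (intro dfn_diff dfn_mult dfn_div assms)
  then show ?thesis by (simp add: minus_mult_div_eq_mod)
qed

lemma dfn_Suc: "dfn X \<Gamma> f \<Longrightarrow> dfn X \<Gamma> (\<lambda>s. Suc (f s))"
  using dfn_add[OF _ dfn_const, of X \<Gamma> f 1] by simp

lemma dfn_poly: "dfn X \<Gamma> f \<Longrightarrow> dfn X \<Gamma> (\<lambda>s. poly p (f s))"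
  by (induction p) (auto intro!: dfn_add dfn_const dfn_mult)

text \<open>The list does not depend on the state, so its members may be objects outside the
  expression language, such as clause schemas.\<close>

lemma dfp_bex_list:
  "(\<And>a. a \<in> set as \<Longrightarrow> dfp X \<Gamma> (\<lambda>s. P s a)) \<Longrightarrow> dfp X \<Gamma> (\<lambda>s. \<exists>a\<in>set as. P s a)"
  by (induction as) (auto intro!: dfp_const dfp_disj)

text \<open>Repeated resolution with these rules proves definability along the syntax of a term; the
  constant rules, tried first, close the state-free subterms.\<close>

lemmas dfn_rules = dfn_const dfp_const dfn_length dfn_add dfn_diff dfn_mult dfn_div dfn_mod dfn_Suc dfn_poly
  dfn_of_bool dfn_if dfn_sum dfp_bit dfp_not dfp_conj dfp_disj dfp_imp dfp_iff dfp_if dfp_le dfp_less dfp_eq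
  dfp_ex dfp_all

lemma polytime_computable_dfn:
  assumes "dfn (\<lambda>x. x) [] L" "dfp fst [snd] (\<lambda>p. P (fst p) (snd p))"
  shows "polytime_computable (\<lambda>x. map (P x) [0..<L x])"
proof -
  from assms(1) obtain l where l: "\<And>s \<rho>. eval l s \<rho> = L s" by (rule dfnE) auto
  from assms(2) obtain f where
    f: "\<And>p \<rho>. \<rho> 0 = snd p \<Longrightarrow> eval f (fst p) \<rho> = of_bool (P (fst p) (snd p))"
    unfolding dfp_def by (rule dfnE) auto
  have "eval f x ((\<lambda>_. 0)(0 := i)) = of_bool (P x i)" for x i
    using f[of "(\<lambda>_. 0)(0 := i)" "(x, i)"] by simp
  then show ?thesis using polytime_eval[of f l] by (simp add: l)
qed

lemma polytime_decidable_dfp: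
  assumes "dfp (\<lambda>x. x) [] P"
  shows "polytime_decidable {x. P x}"
  using polytime_computable_dfn[OF dfn_const[of _ _ 1], of "\<lambda>x _. P x"] dfp_weaken[OF assms]
  by (simp add: polytime_decidable_def)

text \<open>Powers of two are definable as the numbers without odd divisors other than one.\<close>

definition pow2 :: "nat \<Rightarrow> bool" where
  "pow2 z \<longleftrightarrow> (\<exists>j. z = 2 ^ j)"

text \<open>A definable logarithm: at \<open>2 ^ j\<close> it has the value \<open>j\<close>.
  Exponents are recovered from powers in this way, since exponentiation itself would leave the
  polynomially bounded numbers.\<close>

definition pow2_below :: "nat \<Rightarrow> nat" where
  "pow2_below z = (\<Sum>i<z. of_bool (pow2 i))"

lemma pow2_iff: "pow2 z \<longleftrightarrow> 0 < z \<and> (\<forall>d<Suc z. z mod d = 0 \<longrightarrow> d = 1 \<or> d mod 2 = 0)"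
proof
  assume "pow2 z"
  then obtain j where j: "z = 2 ^ j" by (auto simp: pow2_def)
  have "d = 1 \<or> d mod 2 = 0" if "z mod d = 0" for d
  proof -
    have "d dvd 2 ^ j" using that j by auto
    then obtain i where "d = 2 ^ i" using divides_primepow_nat[OF two_is_prime_nat] by blast
    then show ?thesis by (cases i) auto
  qed
  then show "0 < z \<and> (\<forall>d<Suc z. z mod d = 0 \<longrightarrow> d = 1 \<or> d mod 2 = 0)" using j by auto
next
  assume "0 < z \<and> (\<forall>d<Suc z. z mod d = 0 \<longrightarrow> d = 1 \<or> d mod 2 = 0)"
  then have z: "0 < z" "\<forall>d<Suc z. d dvd z \<longrightarrow> d = 1 \<or> 2 dvd d"
    unfolding mod_eq_0_iff_dvd by blast+
  obtain m where m: "z = 2 ^ multiplicity 2 z * m" "odd m"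
    using multiplicity_decompose'[of z 2] z(1) by auto
  then have "m dvd z" by (metis dvd_triv_right)
  then have "m < Suc z" using dvd_imp_le[OF _ z(1)] by (simp add: less_Suc_eq_le)
  then have "m = 1" using z(2) m(2) \<open>m dvd z\<close> by blast
  then show "pow2 z" unfolding pow2_def using m(1) by auto
qed

lemma dfp_pow2: assumes "dfn X \<Gamma> f" shows "dfp X \<Gamma> (\<lambda>s. pow2 (f s))"
  unfolding pow2_iff
  by (rule dfn_rules assms dfn_weaken | (rule dfn_var, simp))+

lemma dfn_pow2_below: assumes "dfn X \<Gamma> f" shows "dfn X \<Gamma> (\<lambda>s. pow2_below (f s))"
  unfolding pow2_below_def 
  by (rule dfn_rules dfp_pow2 assms dfn_weaken | (rule dfn_var, simp))+

lemma pow2_below_power: "pow2_below (2 ^ j) = j"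
proof -
  have "{i \<in> {..<2 ^ j}. pow2 i} = (\<lambda>i. 2 ^ i) ` {..<j}"
    by (auto simp: pow2_def)
  then have "card {i \<in> {..<2 ^ j}. pow2 i} = j" by (simp add: card_image inj_on_def)
  then show ?thesis
    using sum.inter_filter[of "{..<2 ^ j :: nat}" "\<lambda>_. 1::nat" pow2]
    by (simp add: pow2_below_def of_bool_def)
qed

lemma mono_pow2_below: "a \<le> b \<Longrightarrow> pow2_below a \<le> pow2_below b"
  unfolding pow2_below_def by (rule sum_mono2) auto

text \<open>If \<open>2 ^ l\<close> with \<open>l = pow2_below z\<close> were below
  \<open>z\<close>, the \<open>l + 1\<close> powers up to it would all be counted.\<close>

lemma less_power_pow2_below: "z \<le> 2 ^ pow2_below z"
proof (rule ccontr)
  assume "\<not> z \<le> 2 ^ pow2_below z"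
  then have "Suc (2 ^ pow2_below z) \<le> z" by simp
  then have "pow2_below (Suc (2 ^ pow2_below z)) \<le> pow2_below z" by (rule mono_pow2_below)
  moreover have "pow2 (2 ^ pow2_below z)" by (auto simp: pow2_def)
  ultimately show False using pow2_below_power[of "pow2_below z"] by (simp add: pow2_below_def)
qed

section \<open>The Borsuk number in terms of colourings\<close>

text \<open>Covers \<open>with_proj G\<close> as well as its induced subgraphs, which are no pair
  digraphs but occur as the members of \<open>components\<close>.\<close>

locale arc_digraph = wf_digraph H for H :: "('a, 'a \<times> 'a) pre_digraph" +
  assumes tail_fst: "tail H = fst" and head_snd: "head H = snd"
begin

lemma awalk_iff_relpow:
  "(\<exists>p. awalk u p v \<and> length p = n) \<longleftrightarrow> u \<in> verts H \<and> (u, v) \<in> arcs H ^^ n"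
proof (induction n arbitrary: u)
  case 0
  show ?case by (auto simp: awalk_Nil_iff)
next
  case (Suc n)
  have "(\<exists>p. awalk u p v \<and> length p = Suc n) \<longleftrightarrow> (\<exists>e q. awalk u (e # q) v \<and> length q = n)"
    by (metis length_Suc_conv)
  also have "\<dots> \<longleftrightarrow> (\<exists>e\<in>arcs H. u = fst e \<and> (\<exists>q. awalk (snd e) q v \<and> length q = n))"
    unfolding awalk_Cons_iff tail_fst head_snd by blast
  also have "\<dots> \<longleftrightarrow> (\<exists>w. (u, w) \<in> arcs H \<and> (w, v) \<in> arcs H ^^ n)"
    unfolding Suc.IH using head_in_verts by (force simp: head_snd)
  also have "\<dots> \<longleftrightarrow> (u, v) \<in> arcs H ^^ Suc n"
    by (metis relpow_Suc_D2 relpow_Suc_I2)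
  finally show ?case using tail_in_verts by (auto simp: tail_fst elim!: relpow_Suc_E2) 
qed

lemma awalk_cost_one: "awalk_cost (\<lambda>_. 1) p = real (length p)"
  by (induction p) auto

lemma graph_dist_cases:
  assumes "u \<in> verts H"
  obtains "graph_dist H u v = \<infinity>" "\<And>n. (u, v) \<notin> arcs H ^^ n"
  | n where "graph_dist H u v = ereal (real n)" "(u, v) \<in> arcs H ^^ n" "\<And>i. i < n \<Longrightarrow> (u, v) \<notin> arcs H ^^ i"
proof (cases "\<exists>n. (u, v) \<in> arcs H ^^ n")
  case False
  then have "{p. awalk u p v} = {}" using awalk_iff_relpow[of u v] by auto
  then have "graph_dist H u v = \<infinity>" unfolding graph_dist_def \<mu>_def by (simp add: top_ereal_def)
  then show thesis using that(1) False by blast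
next
  case True
  define n where "n = (LEAST n. (u, v) \<in> arcs H ^^ n)"
  have n: "(u, v) \<in> arcs H ^^ n" unfolding n_def using True by (rule LeastI_ex)
  have l: "(u, v) \<notin> arcs H ^^ i" if "i < n" for i using that unfolding n_def by (rule not_less_Least)
  obtain p where p: "awalk u p v" "length p = n" using n assms awalk_iff_relpow by blast
  have "n \<le> length q" if "awalk u q v" for q
    using that l[of "length q"] awalk_iff_relpow[of u v "length q"] by (auto simp flip: not_less)
  then have "graph_dist H u v = ereal (real n)"
    unfolding graph_dist_def \<mu>_def using p
    by (intro antisym INF_greatest INF_lower2[of p]) (auto simp: awalk_cost_one)
  then show thesis using that(2) n l by blast
qed

lemma graph_dist_le_iff:
  assumes "u \<in> verts H"
  shows "graph_dist H u v \<le> ereal (real n) \<longleftrightarrow> (\<exists>i\<le>n. (u, v) \<in> arcs H ^^ i)"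
  using assms
proof (cases rule: graph_dist_cases[of u v])
  case (2 m)
  then show ?thesis by simp (meson le_trans not_less)
qed auto

lemma finite_dists: "finite (verts H) \<Longrightarrow> finite {graph_dist H u v | u v. u \<in> verts H \<and> v \<in> verts H}"
  by (rule finite_image_set2) auto

lemma diam_le_iff:
  assumes "finite (verts H)" "verts H \<noteq> {}"
  shows "diam H \<le> ereal (real n) \<longleftrightarrow> (\<forall>u\<in>verts H. \<forall>v\<in>verts H. \<exists>i\<le>n. (u, v) \<in> arcs H ^^ i)"
proof -
  have "{graph_dist H u v | u v. u \<in> verts H \<and> v \<in> verts H} \<noteq> {}" using assms(2) by auto
  then have "diam H \<le> ereal (real n) \<longleftrightarrow> (\<forall>u\<in>verts H. \<forall>v\<in>verts H. graph_dist H u v \<le> ereal (real n))"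
    unfolding diam_def using finite_dists[OF assms(1)] by (auto simp: Max_le_iff)
  then show ?thesis by (simp add: graph_dist_le_iff)
qed

text \<open>Allows the largest diameter of a component to be replaced by a natural number
  \<open>d\<close>.\<close>

lemma diam_infinite_or_nat:
  assumes "finite (verts H)" "verts H \<noteq> {}"
  shows "diam H = \<infinity> \<or> (\<exists>n. diam H = ereal (real n))"
proof -
  have "diam H \<in> {graph_dist H u v | u v. u \<in> verts H \<and> v \<in> verts H}"
    unfolding diam_def using finite_dists[OF assms(1)] assms(2) by (intro Max_in) auto
  then obtain u v where "u \<in> verts H" "diam H = graph_dist H u v" by auto
  then show ?thesis by (cases rule: graph_dist_cases[of u v]) auto
qed

end

lemma arc_digraph_with_proj: "pair_wf_digraph G \<Longrightarrow> arc_digraph (with_proj G)"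
  unfolding arc_digraph_def arc_digraph_axioms_def wf_digraph_def pair_wf_digraph_def by simp

lemma arc_digraph_induce: "arc_digraph H \<Longrightarrow> arc_digraph (H \<restriction> S)"
  unfolding arc_digraph_def arc_digraph_axioms_def by (auto simp: wf_digraph_def)

text \<open>Used in both directions of \<open>borsuk_number_less_iff\<close>: once \<open>c\<close>
  comes from the components of a given cut, once the cut comes from a given colouring.\<close>

lemma components_colouring:
  fixes c :: "'a \<Rightarrow> 'b"
  assumes wf: "pair_wf_digraph G"
    and c: "\<And>a b. a \<in> pverts G \<Longrightarrow> b \<in> pverts G \<Longrightarrow> c a = c b \<longleftrightarrow> (a, b) \<in> (parcs G)\<^sup>*"
  shows "components G = (\<lambda>m. with_proj G \<restriction> {b \<in> pverts G. c b = m}) ` c ` pverts G"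
    and "card (components G) = card (c ` pverts G)"
proof -
  interpret pair_wf_digraph G by fact
  let ?S = "\<lambda>m. {b \<in> pverts G. c b = m}"
  have reach: "u \<rightarrow>\<^sup>*\<^bsub>with_proj G\<^esub> v \<longleftrightarrow> u \<in> pverts G \<and> v \<in> pverts G \<and> c u = c v" for u v
    using c[of u v] reachable_conv[of u v] by auto
  have "sccs_verts = ?S ` c ` pverts G"
  proof (intro set_eqI iffI)
    fix S assume "S \<in> sccs_verts"
    then have S: "S \<noteq> {}" "\<And>u v. u \<in> S \<Longrightarrow> v \<in> S \<Longrightarrow> u \<rightarrow>\<^sup>*\<^bsub>with_proj G\<^esub> v"
      "\<And>u v. u \<in> S \<Longrightarrow> v \<notin> S \<Longrightarrow> \<not> u \<rightarrow>\<^sup>*\<^bsub>with_proj G\<^esub> v \<or> \<not> v \<rightarrow>\<^sup>*\<^bsub>with_proj G\<^esub> u"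
      unfolding in_sccs_verts_conv_reachable by blast+
    then obtain u where u: "u \<in> S" by blast
    have "S = ?S (c u)"
      using S(2)[OF u] S(2)[OF u u] S(3)[OF u] unfolding reach by (auto, metis)
    then show "S \<in> ?S ` c ` pverts G" using S(2)[OF u u] unfolding reach by blast
  next
    fix S assume "S \<in> ?S ` c ` pverts G"
    then show "S \<in> sccs_verts" unfolding in_sccs_verts_conv_reachable reach by auto
  qed
  then show *: "components G = (\<lambda>m. with_proj G \<restriction> ?S m) ` c ` pverts G"
    unfolding components_def sccs_conv_sccs_verts by (simp add: image_image)
  have "inj_on (\<lambda>m. with_proj G \<restriction> ?S m) (c ` pverts G)"
  proof (rule inj_onI)
    fix m m' assume "m \<in> c ` pverts G" "with_proj G \<restriction> ?S m = with_proj G \<restriction> ?S m'"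
    then have "?S m = ?S m'" by (metis induce_subgraph_verts)
    then show "m = m'" using \<open>m \<in> c ` pverts G\<close> by blast
  qed
  then show "card (components G) = card (c ` pverts G)" unfolding * by (rule card_image)
qed

definition borsuk_colouring :: "'a set \<Rightarrow> 'a rel \<Rightarrow> ('a \<Rightarrow> nat) \<Rightarrow> nat \<Rightarrow> bool" where
  "borsuk_colouring V R c d \<longleftrightarrow>
     (\<forall>a\<in>V. \<forall>b\<in>V. c a = c b \<longrightarrow> (\<exists>i\<le>d. (a, b) \<in> {(u, v) \<in> R. c u = c v} ^^ i)) \<and>
     (\<exists>u\<in>V. \<exists>v\<in>V. \<forall>i\<le>d. (u, v) \<notin> R ^^ i)"

lemma relpow_monochromatic: "(a, b) \<in> {(u, v) \<in> R. c u = c v} ^^ i \<Longrightarrow> c a = c b"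
  by (induction i arbitrary: b) auto

lemma relpow_mono: "(R :: 'a rel) \<subseteq> S \<Longrightarrow> R ^^ n \<subseteq> S ^^ n"
  by (induction n) (simp_all add: relcomp_mono)

lemma borsuk_number_less_iff:
  fixes G :: "nat pair_pre_digraph"
  assumes "pair_graph G" and ne: "pverts G \<noteq> {}"
  shows "borsuk_number G < enat k \<longleftrightarrow>
    (\<exists>c d. card (c ` pverts G) < k \<and> borsuk_colouring (pverts G) (parcs G) c d)"
proof -
  interpret pair_graph G by fact
  let ?V = "pverts G" and ?R = "parcs G"
  have G: "arc_digraph (with_proj G)" by (rule arc_digraph_with_proj) unfold_locales
  have symR: "sym ?R" using pair_sym_arcs by (simp add: symmetric_def)
  have wf_del: "pair_wf_digraph (delete_edges G F)" for F
    by unfold_locales (auto simp: delete_edges_def wellformed')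
  have comp: "arc_digraph (with_proj (delete_edges G F) \<restriction> S)" for F S
    by (intro arc_digraph_induce arc_digraph_with_proj wf_del)
  have far: "\<not> diam (with_proj G) \<le> ereal (real n) \<longleftrightarrow> (\<exists>u\<in>?V. \<exists>v\<in>?V. \<forall>i\<le>n. (u, v) \<notin> ?R ^^ i)" for n
    using arc_digraph.diam_le_iff[OF G, of n] pair_finite_verts ne by auto
  show ?thesis
  proof
    assume "borsuk_number G < enat k"
    then obtain F where F: "borsuk_cut G F" "card (components (delete_edges G F)) < k"
      unfolding borsuk_number_def Inf_less_iff by auto
    let ?G = "delete_edges G F" and ?R' = "?R - F"
    have G': "pverts ?G = ?V" "parcs ?G = ?R'" by (auto simp: delete_edges_def)
    have symR': "sym ?R'" using symR F(1) by (auto simp: borsuk_cut_def sym_def)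
    then have symR'': "sym (?R'\<^sup>*)" by (rule sym_rtrancl)
    \<comment> \<open>The least vertex reachable without \<open>F\<close> is a canonical
      representative of the component.\<close>
    define c where "c a = (LEAST b. (a, b) \<in> ?R'\<^sup>*)" for a
    have c: "c a = c b \<longleftrightarrow> (a, b) \<in> ?R'\<^sup>*" for a b
    proof
      assume "c a = c b"
      moreover have "(a, c a) \<in> ?R'\<^sup>*" "(b, c b) \<in> ?R'\<^sup>*" unfolding c_def by (rule LeastI[of _ a], simp, rule LeastI[of _ b], simp)
      ultimately show "(a, b) \<in> ?R'\<^sup>*" using symR'' by (metis rtrancl_trans symD)
    next
      assume "(a, b) \<in> ?R'\<^sup>*"
      then have "(a, z) \<in> ?R'\<^sup>* \<longleftrightarrow> (b, z) \<in> ?R'\<^sup>*" for z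
        using symR'' by (metis rtrancl_trans symD)
      then show "c a = c b" by (simp add: c_def)
    qed
    note comps = components_colouring[OF wf_del, of F c, unfolded G', OF c]
    let ?H = "\<lambda>m. with_proj ?G \<restriction> {b \<in> ?V. c b = m}"
    let ?M = "Max (diam ` components ?G)"
    have fin: "finite (diam ` components ?G)" "diam ` components ?G \<noteq> {}"
      unfolding comps(1) using pair_finite_verts ne by auto
    from Max_in[OF this] obtain a where a: "a \<in> ?V" "?M = diam (?H (c a))" unfolding comps(1) by auto
    have H: "finite (verts (?H (c b)))" "b \<in> ?V \<Longrightarrow> verts (?H (c b)) \<noteq> {}" for b
      using pair_finite_verts by auto
    have lt: "?M < diam (with_proj G)" using F(1) by (simp add: borsuk_cut_def)
    \<comment> \<open>Being strictly below another extended real, the largest component diameter is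
      not infinite; as a natural number it becomes \<open>d\<close>.\<close>
    then have "?M \<noteq> \<infinity>" by auto
    then obtain d where d: "?M = ereal (real d)"
      using arc_digraph.diam_infinite_or_nat[OF comp H(1) H(2)[OF a(1)]] a(2) by auto
    have "\<exists>i\<le>d. (x, y) \<in> {(u, v) \<in> ?R. c u = c v} ^^ i" if "x \<in> ?V" "y \<in> ?V" "c x = c y" for x y
    proof -
      have "diam (?H (c x)) \<le> ?M" using fin(1) that(1) unfolding comps(1) by (intro Max_ge) auto
      then have "\<exists>i\<le>d. (x, y) \<in> arcs (?H (c x)) ^^ i"
        using arc_digraph.diam_le_iff[OF comp H(1) H(2)[OF that(1)], of d] that d by auto
      moreover have "arcs (?H (c x)) \<subseteq> {(u, v) \<in> ?R. c u = c v}" by (auto simp: G')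
      ultimately show ?thesis using relpow_mono by blast
    qed
    moreover have "\<exists>u\<in>?V. \<exists>v\<in>?V. \<forall>i\<le>d. (u, v) \<notin> ?R ^^ i"
      using lt d unfolding far[of d, symmetric] by (simp add: not_le)
    ultimately show "\<exists>c d. card (c ` ?V) < k \<and> borsuk_colouring ?V ?R c d"
      using F(2) unfolding comps(2) borsuk_colouring_def by blast
  next
    assume "\<exists>c d. card (c ` ?V) < k \<and> borsuk_colouring ?V ?R c d"
    then obtain c d where c1: "card (c ` ?V) < k" and cd: "borsuk_colouring ?V ?R c d" by blast
    have c2: "\<exists>i\<le>d. (a, b) \<in> {(u, v) \<in> ?R. c u = c v} ^^ i" if "a \<in> ?V" "b \<in> ?V" "c a = c b" for a b
      using cd that unfolding borsuk_colouring_def by simp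
    have c3: "\<exists>u\<in>?V. \<exists>v\<in>?V. \<forall>i\<le>d. (u, v) \<notin> ?R ^^ i"
      using cd unfolding borsuk_colouring_def by (rule conjunct2)
    \<comment> \<open>The cut consists of the bichromatic edges.\<close>
    define F where "F = {(u, v) \<in> ?R. c u \<noteq> c v}"
    let ?G = "delete_edges G F" and ?R' = "{(u, v) \<in> ?R. c u = c v}"
    have G': "pverts ?G = ?V" "parcs ?G = ?R'" by (auto simp: delete_edges_def F_def)
    \<comment> \<open>The walks connect each colour class, and no monochromatic walk leaves it, so
      the classes are exactly the components.\<close>
    have cR: "c a = c b \<longleftrightarrow> (a, b) \<in> (parcs ?G)\<^sup>*" if "a \<in> pverts ?G" "b \<in> pverts ?G" for a b
      using c2[OF that[unfolded G']] unfolding G' using relpow_monochromatic[where a = a and b = b and R = ?R and c = c] by (auto simp: rtrancl_power)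
    let ?H = "\<lambda>m. with_proj ?G \<restriction> {b \<in> ?V. c b = m}"
    have comps: "components ?G = ?H ` c ` ?V" "card (components ?G) = card (c ` ?V)"
      using components_colouring[OF wf_del, of F c] cR unfolding G' by blast+
    have fin: "finite (diam ` components ?G)" "diam ` components ?G \<noteq> {}"
      unfolding comps(1) using pair_finite_verts ne by auto
    have "diam (?H (c x)) \<le> ereal (real d)" if x: "x \<in> ?V" for x
    proof -
      \<comment> \<open>A monochromatic walk starting in the class of \<open>x\<close> stays in the
        subgraph induced by that class.\<close>
      have stay: "(a, b) \<in> arcs (?H (c x)) ^^ i" if "a \<in> ?V" "c a = c x" "(a, b) \<in> ?R' ^^ i" for a b i
        using that(3)
      proof (induction i arbitrary: b)
        case (Suc i)
        then obtain z where z: "(a, z) \<in> ?R' ^^ i" "(z, b) \<in> ?R'" by auto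
        then have "c z = c x" "c b = c x" using relpow_monochromatic[OF z(1)] that by auto
        then have "(z, b) \<in> arcs (?H (c x))" using z(2) wellformed' by (auto simp: G')
        then show ?case using Suc.IH[OF z(1)] by auto
      qed simp
      show ?thesis
      proof (subst arc_digraph.diam_le_iff[OF comp])
        show "\<forall>a\<in>verts (?H (c x)). \<forall>b\<in>verts (?H (c x)). \<exists>i\<le>d. (a, b) \<in> arcs (?H (c x)) ^^ i"
        proof (intro ballI)
          fix a b assume "a \<in> verts (?H (c x))" "b \<in> verts (?H (c x))"
          then have ab: "a \<in> ?V" "b \<in> ?V" "c a = c x" "c a = c b" by auto
          from c2[OF ab(1,2,4)] obtain i where "i \<le> d" "(a, b) \<in> ?R' ^^ i" by blast
          then show "\<exists>i\<le>d. (a, b) \<in> arcs (?H (c x)) ^^ i" using stay[OF ab(1,3)] by blast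
        qed
      qed (use x pair_finite_verts in auto)
    qed
    then have "Max (diam ` components ?G) \<le> ereal (real d)"
      using fin unfolding comps(1) by (auto simp: Max_le_iff)
    also have "\<dots> < diam (with_proj G)" using far[of d] c3 by (simp add: not_le)
    finally have "borsuk_cut G F"
      using symR unfolding borsuk_cut_def by (auto simp: F_def sym_def)
    then have "borsuk_number G \<le> enat (card (components ?G))"
      unfolding borsuk_number_def by (intro Inf_lower) blast
    also have "\<dots> < enat k" using c1 unfolding comps(2) by simp
    finally show "borsuk_number G < enat k" .
  qed
qed

lemma connected_iff_rtrancl:
  assumes "pair_graph G"
  shows "connected (with_proj G) \<longleftrightarrow>
    pverts G \<noteq> {} \<and> (\<forall>u\<in>pverts G. \<forall>v\<in>pverts G. (u, v) \<in> (parcs G)\<^sup>*)"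
proof -
  interpret pair_graph G by fact
  have "(parcs G)\<^sup>s = parcs G"
    using pair_sym_arcs by (auto simp: symcl_def symmetric_def dest: symD)
  then have "connected (with_proj G) \<longleftrightarrow> strongly_connected (with_proj G)"
    unfolding connected_conv strongly_connected_def reachable_def by simp
  then show ?thesis unfolding strongly_connected_def using reachable_conv' by auto
qed

section \<open>Satisfiability with definable clauses\<close>

text \<open>\<open>Scan\<close> repeats what \<open>Head\<close> and \<open>Cell\<close> express
  together. It lets a transition clause name the symbols under all heads without a parameter for
  each head position, so that a time and two positions suffice for every clause.\<close>

datatype atom =
    State nat
  | Head nat
  | Cell nat nat
  | Scan nat nat

text \<open>A propositional variable given uniformly in the input, a time \<open>t\<close> and two
  positions \<open>p\<close> and \<open>r\<close>; the sign comes from the side of the clause on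
  which it stands.\<close>

type_synonym literal = "bool list \<Rightarrow> nat \<Rightarrow> nat \<Rightarrow> nat \<Rightarrow> nat"

primrec fact :: "config \<Rightarrow> int \<Rightarrow> atom \<Rightarrow> nat \<Rightarrow> bool" where
  "fact c d (State q) p \<longleftrightarrow> fst c = q"
| "fact c d (Head j) p \<longleftrightarrow> snd (snd c ! j) = int p - d"
| "fact c d (Cell j s) p \<longleftrightarrow> fst (snd c ! j) (int p - d) = s"
| "fact c d (Scan j s) p \<longleftrightarrow> read_tape (snd c ! j) = s"

primrec shift :: "move \<Rightarrow> nat \<Rightarrow> nat" where
  "shift Move_Left p = p - 1"
| "shift Stay p = p"
| "shift Move_Right p = p + 1"

lemma mixed_radix: "c < n \<Longrightarrow> (a * n + c) div n = a" "c < n \<Longrightarrow> (a * n + c) mod n = c" for a c n :: nat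
  by (subst div_mult_self3) auto

lemma length_doubled: "length (concat (map (\<lambda>b. [b, b]) x)) = 2 * length x"
  by (induction x) auto

lemma nth_doubled: "i < 2 * length x \<Longrightarrow> concat (map (\<lambda>b. [b, b]) x) ! i = x ! (i div 2)"
proof (induction x arbitrary: i)
  case (Cons b x)
  show ?case
  proof (cases "i < 2")
    case True
    then have "i = 0 \<or> i = 1" by auto
    then show ?thesis by auto
  next
    case False
    then obtain i' where "i = Suc (Suc i')" by (metis add_2_eq_Suc le_Suc_ex not_less)
    then show ?thesis using Cons by simp
  qed
qed simp

lemma length_string_pair: "length (string_pair x y) = 2 * length x + 2 + length y"
  unfolding string_pair_def by (simp add: length_doubled del: map_eq_conv)

lemma nth_string_pair:
  "i < 2 * length x \<Longrightarrow> string_pair x y ! i = x ! (i div 2)"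
  "string_pair x y ! (2 * length x) = False"
  "string_pair x y ! (2 * length x + 1) = True"
  "string_pair x y ! (2 * length x + 2 + i) = y ! i"
  by (simp_all add: string_pair_def nth_append length_doubled nth_doubled)

locale np_verifier =
  fixes M :: tm and pT pG :: "nat poly" and A K :: language
  assumes tm: "turing_machine M"
    and computes: "computes_in_time M (\<lambda>z. [z \<in> A]) (poly pT)"
    and K_iff: "\<And>x. x \<in> K \<longleftrightarrow> (\<exists>y. length y \<le> poly pG (length x) \<and> string_pair x y \<in> A)"
begin

abbreviation "k \<equiv> num_tapes M"
abbreviation "sy \<equiv> num_symbols M"
abbreviation "Q \<equiv> num_states M"

text \<open>
  Cell \<open>i\<close> of a tape is represented by position \<open>off x + i\<close>, so that the heads stay strictly inside
  the window \<open>0, \<dots>, width x - 1\<close>.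
\<close>

definition "inlen x = 2 * length (x :: bool list) + 2"
definition "guess x = poly pG (length (x :: bool list))"
text \<open>The summand 1 keeps the range of \<open>t\<close> nonempty, so that the clauses about
  time 0 have instances.\<close>

definition "time x = poly pT (inlen x + guess x) + 1"
definition "off x = time x + 1"
definition "width x = 2 * time x + inlen x + guess x + 3"

definition "atoms = map State [0..<Suc Q] @ map Head [0..<k] @
  [Cell j s. j \<leftarrow> [0..<k], s \<leftarrow> [0..<sy]] @ [Scan j s. j \<leftarrow> [0..<k], s \<leftarrow> [0..<sy]]"

definition "kind a = (LEAST i. i < length atoms \<and> atoms ! i = a)"

text \<open>A mixed-radix code of atom, time and position. Clamping keeps every index in range for
  arbitrary parameters; wherever a head can actually be during the run, its next position is not
  clamped.\<close>

definition "vidx x \<tau> t p = (\<tau> * Suc (time x) + min t (time x)) * width x + min p (width x - 1)"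

abbreviation "vx x a t p \<equiv> vidx x (kind a) t p"

definition "num_vars x = length atoms * Suc (time x) * width x"

text \<open>In the halting state the machine idles, so a run extends up to time
  \<open>time x\<close>.\<close>

definition next_act :: "nat \<Rightarrow> nat list \<Rightarrow> nat \<times> (nat \<times> move) list" where
  "next_act q rs = (if q = Q then (q, idle rs) else delta M q rs)"

text \<open>These describe the initial input tape for \<open>string_pair x y\<close> with
  \<open>y\<close> left open. Outside the guess region a cell is blank or holds a doubled bit of
  \<open>x\<close> or a bit of the separator; \<open>one0\<close>, consulted only where
  \<open>blank0\<close> fails, marks the symbol 1 of the bit False.\<close>

definition "guess_at x p \<longleftrightarrow> off x + inlen x \<le> p \<and> p < off x + inlen x + guess x"
definition "blank0 x p \<longleftrightarrow> p < off x \<or> off x + inlen x \<le> p"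
definition "one0 x p \<longleftrightarrow> p = off x + 2 * length x \<or>
  (p < off x + 2 * length x \<and> \<not> bit_at x ((p - off x) div 2))"
definition "init_kind x p = (if blank0 x p then kind (Cell 0 0) else
  if one0 x p then kind (Cell 0 1) else kind (Cell 0 2))"

definition guard :: "nat \<Rightarrow> nat list \<Rightarrow> literal list" where
  "guard q rs = (\<lambda>x t p r. vx x (State q) t 0) #
     map (\<lambda>j x t p r. vx x (Scan j (rs ! j)) t 0) [0..<k]"

text \<open>A pair is an implication from the conjunction of its first list to the disjunction of
  its second. All facts are propagated forward in time: a model makes every fact of the run true and
  possibly others. Acceptance is therefore expressed by forbidding each output symbol other than 2.
  The clause with three literals leaves a free choice of symbol in the guess region, and its
  literals coincide elsewhere. The next clause makes blanks spread to the right there, so the guess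
  is a string followed by blanks. The clauses about cells away from a head become tautologies for
  \<open>r = p\<close>.\<close>

definition schemas :: "(literal list \<times> literal list) list" where
  "schemas =
    [([], [\<lambda>x t p r. vx x (State 0) 0 0])] @
    map (\<lambda>j. ([], [\<lambda>x t p r. vx x (Head j) 0 (off x)])) [0..<k] @
    map (\<lambda>j. ([], [\<lambda>x t p r. vx x (Cell j 0) 0 p])) [1..<k] @
    [([], map (\<lambda>s x t p r. if guess_at x p then vx x (Cell 0 s) 0 p else vidx x (init_kind x p) 0 p) [0, 1, 2])] @
    [([\<lambda>x t p r. vx x (Cell 0 0) 0 p], [\<lambda>x t p r. vx x (Cell 0 0) 0 (if guess_at x p then p + 1 else p)])] @
    [([\<lambda>x t p r. vx x (Head j) t p, \<lambda>x t p r. vx x (Cell j s) t p], [\<lambda>x t p r. vx x (Scan j s) t 0]).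
      j \<leftarrow> [0..<k], s \<leftarrow> [0..<sy]] @
    [(guard q rs, [\<lambda>x t p r. vx x (State (fst (next_act q rs))) (t + 1) 0]).
      q \<leftarrow> [0..<Suc Q], rs \<leftarrow> List.n_lists k [0..<sy]] @
    [(guard q rs @ [\<lambda>x t p r. vx x (Head j) t p],
       [\<lambda>x t p r. vx x (Head j) (t + 1) (shift (snd (snd (next_act q rs) ! j)) p)]).
      q \<leftarrow> [0..<Suc Q], rs \<leftarrow> List.n_lists k [0..<sy], j \<leftarrow> [0..<k]] @
    [(guard q rs @ [\<lambda>x t p r. vx x (Head j) t p],
       [\<lambda>x t p r. vx x (Cell j (fst (snd (next_act q rs) ! j))) (t + 1) p]).
      q \<leftarrow> [0..<Suc Q], rs \<leftarrow> List.n_lists k [0..<sy], j \<leftarrow> [0..<k]] @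
    [([\<lambda>x t p r. vx x (Head j) t p, \<lambda>x t p r. vx x (Cell j s) t r],
       [\<lambda>x t p r. vx x (Cell j s) (if r = p then t else t + 1) r]).
      j \<leftarrow> [0..<k], s \<leftarrow> [0..<sy]] @
    map (\<lambda>s. ([\<lambda>x t p r. vx x (Cell 1 s) (time x) (off x)], [])) (filter (\<lambda>s. s \<noteq> 2) [0..<sy])"

lemma ball_schemas:
  "(\<forall>sc\<in>set schemas. \<phi> sc) \<longleftrightarrow>
    \<phi> ([], [\<lambda>x t p r. vx x (State 0) 0 0]) \<and>
    (\<forall>j<k. \<phi> ([], [\<lambda>x t p r. vx x (Head j) 0 (off x)])) \<and>
    (\<forall>j<k. 1 \<le> j \<longrightarrow> \<phi> ([], [\<lambda>x t p r. vx x (Cell j 0) 0 p])) \<and>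
    \<phi> ([], map (\<lambda>s x t p r. if guess_at x p then vx x (Cell 0 s) 0 p else vidx x (init_kind x p) 0 p) [0, 1, 2]) \<and>
    \<phi> ([\<lambda>x t p r. vx x (Cell 0 0) 0 p], [\<lambda>x t p r. vx x (Cell 0 0) 0 (if guess_at x p then p + 1 else p)]) \<and>
    (\<forall>j<k. \<forall>s<sy. \<phi> ([\<lambda>x t p r. vx x (Head j) t p, \<lambda>x t p r. vx x (Cell j s) t p], [\<lambda>x t p r. vx x (Scan j s) t 0])) \<and>
    (\<forall>q\<le>Q. \<forall>rs\<in>set (List.n_lists k [0..<sy]).
      \<phi> (guard q rs, [\<lambda>x t p r. vx x (State (fst (next_act q rs))) (t + 1) 0])) \<and>
    (\<forall>q\<le>Q. \<forall>rs\<in>set (List.n_lists k [0..<sy]). \<forall>j<k.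
      \<phi> (guard q rs @ [\<lambda>x t p r. vx x (Head j) t p],
       [\<lambda>x t p r. vx x (Head j) (t + 1) (shift (snd (snd (next_act q rs) ! j)) p)])) \<and>
    (\<forall>q\<le>Q. \<forall>rs\<in>set (List.n_lists k [0..<sy]). \<forall>j<k.
      \<phi> (guard q rs @ [\<lambda>x t p r. vx x (Head j) t p],
       [\<lambda>x t p r. vx x (Cell j (fst (snd (next_act q rs) ! j))) (t + 1) p])) \<and>
    (\<forall>j<k. \<forall>s<sy. \<phi> ([\<lambda>x t p r. vx x (Head j) t p, \<lambda>x t p r. vx x (Cell j s) t r],
       [\<lambda>x t p r. vx x (Cell j s) (if r = p then t else t + 1) r])) \<and>
    (\<forall>s<sy. s \<noteq> 2 \<longrightarrow> \<phi> ([\<lambda>x t p r. vx x (Cell 1 s) (time x) (off x)], []))"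
proof -
  have *: "(\<forall>q\<in>set [0..<Suc Q]. \<psi> q) \<longleftrightarrow> (\<forall>q\<le>Q. \<psi> q)" "(\<forall>j\<in>set [0..<n]. \<psi> j) \<longleftrightarrow> (\<forall>j<n. \<psi> j)"
    "(\<forall>j\<in>set [1..<n]. \<psi> j) \<longleftrightarrow> (\<forall>j<n. 1 \<le> j \<longrightarrow> \<psi> j)"
    "(\<forall>s\<in>set (filter (\<lambda>s. s \<noteq> 2) [0..<n]). \<psi> s) \<longleftrightarrow> (\<forall>s<n. s \<noteq> 2 \<longrightarrow> \<psi> s)" for \<psi> n
    by (auto simp del: upt_Suc)
  show ?thesis
    unfolding schemas_def
    by (simp only: set_append ball_Un set_concat set_map ball_UN UN_ball_bex_simps ball_simps list.set * conj_assoc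
        list.map simp_thms less_Suc_eq_le)
qed

definition clause_holds :: "(nat \<Rightarrow> bool) \<Rightarrow> bool list \<Rightarrow> literal list \<times> literal list \<Rightarrow> bool" where
  "clause_holds \<alpha> x sc \<longleftrightarrow> (\<forall>t<time x. \<forall>p<width x. \<forall>r<width x.
     (\<forall>f\<in>set (fst sc). \<alpha> (f x t p r)) \<longrightarrow> (\<exists>f\<in>set (snd sc). \<alpha> (f x t p r)))"

lemma tapes_symbols_ge: "k \<ge> 2" "sy \<ge> 3"
  using tm by (auto simp: turing_machine_def)

lemma time_width_pos: "time x > 0" "width x > 0"
  by (auto simp: time_def width_def)

lemma set_atoms: "set atoms = State ` {..Q} \<union> Head ` {..<k} \<union>
    (\<lambda>(j, s). Cell j s) ` ({..<k} \<times> {..<sy}) \<union> (\<lambda>(j, s). Scan j s) ` ({..<k} \<times> {..<sy})"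
  unfolding atoms_def by (auto simp del: upt_Suc)

lemma kind: assumes "a \<in> set atoms" shows "kind a < length atoms" "atoms ! kind a = a"
proof -
  have "\<exists>i. i < length atoms \<and> atoms ! i = a" using assms by (auto simp: in_set_conv_nth)
  from LeastI_ex[OF this] show "kind a < length atoms" "atoms ! kind a = a"
    unfolding kind_def by auto
qed

lemma vidx_decode:
  "vidx x \<tau> t p div width x div Suc (time x) = \<tau>"
  "vidx x \<tau> t p div width x mod Suc (time x) = min t (time x)"
  "vidx x \<tau> t p mod width x = min p (width x - 1)"
proof -
  have p: "min p (width x - 1) < width x" using time_width_pos(2)[of x] by linarith
  have t: "min t (time x) < Suc (time x)" by auto
  show "vidx x \<tau> t p div width x div Suc (time x) = \<tau>"
    "vidx x \<tau> t p div width x mod Suc (time x) = min t (time x)"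
    "vidx x \<tau> t p mod width x = min p (width x - 1)"
    unfolding vidx_def mixed_radix[OF p] by (rule mixed_radix[OF t] refl)+
qed

lemma vidx_less: assumes "\<tau> < length atoms" shows "vidx x \<tau> t p < num_vars x"
proof -
  have "\<tau> * Suc (time x) + min t (time x) < Suc \<tau> * Suc (time x)" by simp
  also have "\<dots> \<le> length atoms * Suc (time x)" using assms by (intro mult_le_mono1) simp
  finally have "Suc (\<tau> * Suc (time x) + min t (time x)) * width x \<le> length atoms * Suc (time x) * width x"
    by (intro mult_le_mono1) simp
  moreover have "min p (width x - 1) < width x" using time_width_pos(2)[of x] by linarith
  ultimately show ?thesis unfolding vidx_def num_vars_def by simp
qed

section \<open>Runs of the verifier inside the window\<close>

definition wf_config :: "config \<Rightarrow> bool" where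
  "wf_config c \<longleftrightarrow> fst c \<le> Q \<and> length (snd c) = k \<and> (\<forall>j<k. \<forall>i. fst (snd c ! j) i < sy)"

lemma next_act_wf:
  assumes "q \<le> Q" "length rs = k" "set rs \<subseteq> {..<sy}"
  shows "fst (next_act q rs) \<le> Q" "length (snd (next_act q rs)) = k"
    "j < k \<Longrightarrow> fst (snd (next_act q rs) ! j) < sy"
proof -
  have "fst (next_act q rs) \<le> Q \<and> length (snd (next_act q rs)) = k \<and> fst ` set (snd (next_act q rs)) \<subseteq> {..<sy}"
  proof (cases "q = Q")
    case True
    then show ?thesis using assms by (auto simp: next_act_def idle_def)
  next
    case False
    then have "q < Q" using assms by simp
    then show ?thesis using tm assms False unfolding turing_machine_def next_act_def
      by (auto simp: case_prod_beta)
  qed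
  then show "fst (next_act q rs) \<le> Q" "length (snd (next_act q rs)) = k"
    "j < k \<Longrightarrow> fst (snd (next_act q rs) ! j) < sy" by (auto simp: subset_iff)
qed

lemma wf_reads:
  assumes "wf_config c"
  shows "length (map read_tape (snd c)) = k" "set (map read_tape (snd c)) \<subseteq> {..<sy}"
  using assms by (auto simp: wf_config_def read_tape_def in_set_conv_nth) (metis fst_conv)

lemma step_next_act:
  "step M c = (fst (next_act (fst c) (map read_tape (snd c))),
    map2 act_tape (snd (next_act (fst c) (map read_tape (snd c)))) (snd c))"
  by (auto simp: step_def halted_def next_act_def case_prod_beta Let_def act_idle prod_eq_iff)

lemma step_nth:
  assumes "wf_config c" "j < k"
  shows "snd (step M c) ! j = act_tape (snd (next_act (fst c) (map read_tape (snd c))) ! j) (snd c ! j)"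
  using next_act_wf(2)[of "fst c", OF _ wf_reads[OF assms(1)]] assms step_next_act[of c]
  by (simp add: wf_config_def)

lemma wf_step: assumes "wf_config c" shows "wf_config (step M c)"
proof -
  have q: "fst c \<le> Q" using assms by (simp add: wf_config_def)
  note a = next_act_wf[OF q wf_reads[OF assms]]
  have "fst (step M c) \<le> Q" "length (snd (step M c)) = k"
    using a assms by (simp_all add: step_next_act wf_config_def)
  moreover have "fst (snd (step M c) ! j) i < sy" if "j < k" for j i
    using a(3)[OF that] assms that by (simp add: step_nth act_tape_def wf_config_def)
  ultimately show ?thesis by (simp add: wf_config_def)
qed

definition conf :: "bool list \<Rightarrow> nat \<Rightarrow> config" where
  "conf z t = (step M ^^ t) (init_config M z)"

lemma conf_Suc: "conf z (Suc t) = step M (conf z t)"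
  by (simp add: conf_def)

lemma conf_0_nth:
  "j < k \<Longrightarrow> snd (conf z 0) ! j = (if j = 0 then (string_tape z, 0) else (\<lambda>_. 0, 0))"
  using tapes_symbols_ge by (auto simp: conf_def init_config_def nth_Cons split: nat.splits)

lemma wf_conf: "wf_config (conf z t)"
proof (induction t)
  case 0
  have "string_tape z i < sy" for i
    using tapes_symbols_ge by (auto simp: string_tape_def bit_symbol_def)
  then have "fst (snd (conf z 0) ! j) i < sy" if "j < k" for j i
    using tapes_symbols_ge that by (simp add: conf_0_nth)
  moreover have "length (snd (conf z 0)) = k" "fst (conf z 0) \<le> Q"
    using tapes_symbols_ge by (auto simp: conf_def init_config_def)
  ultimately show ?case by (simp add: wf_config_def)
qed (simp add: conf_Suc wf_step)

text \<open>A head moves by at most one cell per step; the margins in \<open>off\<close> and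
  \<open>width\<close> come from this.\<close>

lemma head_bound: "j < k \<Longrightarrow> \<bar>snd (snd (conf z t) ! j)\<bar> \<le> int t"
proof (induction t)
  case 0
  then show ?case by (simp add: conf_0_nth)
next
  case (Suc t)
  have "\<bar>move_head m h\<bar> \<le> 1 + int t" if "\<bar>h\<bar> \<le> int t" for m h using that by (cases m) auto
  then show ?case using Suc by (simp add: conf_Suc step_nth wf_conf act_tape_def)
qed

text \<open>A halted configuration persists, so the one-bit output can be read at the fixed time
  \<open>time x\<close>, whatever the actual halting time is.\<close>

lemma accepts_iff:
  assumes "length y \<le> guess x"
  shows "string_pair x y \<in> A \<longleftrightarrow> fst (snd (conf (string_pair x y) (time x)) ! 1) 0 = 2"
proof -
  let ?z = "string_pair x y"
  obtain t where t: "t \<le> poly pT (length ?z)" "halted M (conf ?z t)" "has_output (conf ?z t) [?z \<in> A]"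
    using computes unfolding computes_in_time_def conf_def Let_def by blast
  have "poly pT (length ?z) \<le> time x"
    using poly_nat_mono[of "length ?z" "inlen x + guess x" pT] assms
    by (simp add: time_def length_string_pair inlen_def)
  then obtain d where d: "time x = t + d" using t(1) le_Suc_ex le_trans by blast
  have "conf ?z (t + d) = conf ?z t" for d
    using t(2) by (induction d) (auto simp: conf_Suc step_def)
  then have "conf ?z (time x) = conf ?z t" using d by simp
  then show ?thesis using t(3) by (auto simp: has_output_def bit_symbol_def split: if_splits)
qed

lemma init_cell:
  assumes "length y \<le> guess x"
  shows "string_tape (string_pair x y) (int p - int (off x)) =
    (if guess_at x p then
       if p - off x - inlen x < length y then bit_symbol (y ! (p - off x - inlen x)) else 0
     else if blank0 x p then 0 else if one0 x p then 1 else 2)"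
proof (cases "p < off x")
  case True
  then show ?thesis by (simp add: string_tape_def guess_at_def blank0_def)
next
  case False
  then obtain i where i: "p = off x + i" using le_Suc_ex not_less by blast
  let ?z = "string_pair x y"
  have z: "string_tape ?z (int p - int (off x)) = (if i < length ?z then bit_symbol (?z ! i) else 0)"
    by (simp add: string_tape_def i)
  consider "i < 2 * length x" | "i = 2 * length x" | "i = 2 * length x + 1"
    | i' where "i = 2 * length x + 2 + i'"
    by (metis add_2_eq_Suc' add.assoc add_Suc_right le_Suc_ex less_SucE not_less one_add_one plus_1_eq_Suc Suc_eq_plus1)
  then show ?thesis
  proof cases
    case 1
    then have "i div 2 < length x" by simp
    then show ?thesis using 1 unfolding z
      by (simp add: i guess_at_def blank0_def one0_def inlen_def length_string_pair nth_string_pair bit_at_def bit_symbol_def)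
  next
    case 2
    then show ?thesis unfolding z using nth_string_pair(2)[of x y]
      by (simp add: i guess_at_def blank0_def one0_def inlen_def length_string_pair bit_symbol_def)
  next
    case 3
    then show ?thesis unfolding z using nth_string_pair(3)[of x y]
      by (simp add: i guess_at_def blank0_def one0_def inlen_def length_string_pair bit_symbol_def)
  next
    case (4 i')
    then show ?thesis unfolding z using nth_string_pair(4)[of x y i'] assms
      by (simp add: i guess_at_def blank0_def inlen_def length_string_pair)
  qed
qed

section \<open>Accepting runs and satisfying assignments\<close>

lemma clause_holdsD:
  "clause_holds \<alpha> x (ns, ps) \<Longrightarrow> t < time x \<Longrightarrow> p < width x \<Longrightarrow> r < width x \<Longrightarrow>
   (\<forall>f\<in>set ns. \<alpha> (f x t p r)) \<Longrightarrow> \<exists>f\<in>set ps. \<alpha> (f x t p r)"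
  by (simp add: clause_holds_def)

lemma clause_holdsI:
  "(\<And>t p r. t < time x \<Longrightarrow> p < width x \<Longrightarrow> r < width x \<Longrightarrow>
   (\<forall>f\<in>set ns. \<alpha> (f x t p r)) \<Longrightarrow> \<exists>f\<in>set ps. \<alpha> (f x t p r)) \<Longrightarrow> clause_holds \<alpha> x (ns, ps)"
  by (simp add: clause_holds_def)

lemma atoms_simps [simp]:
  "State q \<in> set atoms \<longleftrightarrow> q \<le> Q" "Head j \<in> set atoms \<longleftrightarrow> j < k"
  "Cell j s \<in> set atoms \<longleftrightarrow> j < k \<and> s < sy" "Scan j s \<in> set atoms \<longleftrightarrow> j < k \<and> s < sy"
  by (auto simp: set_atoms)

lemma run_satisfies:
  assumes y: "length y \<le> guess x" "string_pair x y \<in> A"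
  shows "\<exists>\<alpha>. \<forall>sc\<in>set schemas. clause_holds \<alpha> x sc"
proof -
  define z where "z = string_pair x y"
  let ?W = "width x" and ?T = "time x" and ?o = "int (off x)"
  \<comment> \<open>The variable number is decoded into atom, time and position, and the truth value
    is read off the run.\<close>
  define \<alpha> where "\<alpha> i = fact (conf z (i div ?W mod Suc ?T)) ?o (atoms ! (i div ?W div Suc ?T)) (i mod ?W)" for i
  have \<alpha>: "\<alpha> (vx x a t p) \<longleftrightarrow> fact (conf z (min t ?T)) ?o a (min p (?W - 1))" if "a \<in> set atoms" for a t p
    using that by (simp add: \<alpha>_def vidx_decode kind)
  have k0: "0 < k" "1 < k" and sy2: "0 < sy" "1 < sy" "2 < sy" using tapes_symbols_ge by auto
  have off: "off x \<le> ?W - 1" by (simp add: off_def width_def)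
  have read: "read_tape (snd (conf z t) ! j) < sy" if "j < k" for t j
    using wf_conf[of z t] that by (simp add: wf_config_def read_tape_def)
  have guard: "q = fst (conf z t) \<and> rs = map read_tape (snd (conf z t))"
    if "q \<le> Q" "rs \<in> set (List.n_lists k [0..<sy])" "t < ?T" "\<forall>f\<in>set (guard q rs). \<alpha> (f x t p r)"
    for q rs t p r
  proof -
    have rs: "length rs = k" "\<And>j. j < k \<Longrightarrow> rs ! j < sy"
      using that(2) by (auto simp: set_n_lists subset_iff)
    have 1: "\<alpha> (vx x (State q) t 0)"
      using that(4) by (simp add: guard_def)
    note that4 = that(4)
    have 2: "\<alpha> (vx x (Scan j (rs ! j)) t 0)" if "j < k" for j
    proof -
      have "(\<lambda>x t p r. vx x (Scan j (rs ! j)) t 0) \<in> set (guard q rs)"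
        unfolding guard_def using \<open>j < k\<close> by auto
      from bspec[OF that4 this] show ?thesis .
    qed
    have "q = fst (conf z t)" using 1 that(1,3) by (simp add: \<alpha>)
    moreover have "rs = map read_tape (snd (conf z t))"
      using 2 rs that(3) wf_reads(1)[OF wf_conf[of z t]] by (intro nth_equalityI) (auto simp: \<alpha>)
    ultimately show ?thesis ..
  qed
  have "\<forall>sc\<in>set schemas. clause_holds \<alpha> x sc"
    unfolding ball_schemas
  proof (intro conjI allI impI ballI clause_holdsI, goal_cases)
    case (1 t p r)
    then show ?case by (simp add: \<alpha>) (simp add: conf_def init_config_def)
  next
    case (2 j t p r)
    then show ?case using off by (simp add: \<alpha> conf_0_nth)
  next
    case (3 j t p r)
    then show ?case using sy2 by (simp add: \<alpha> conf_0_nth)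
  next
    case (4 t p r)
    have c: "fst (snd (conf z 0) ! 0) (int p - ?o) = string_tape z (int p - ?o)" using k0 by (simp add: conf_0_nth)
    have \<alpha>0: "\<alpha> (vx x (Cell 0 s) 0 p) \<longleftrightarrow> string_tape z (int p - ?o) = s" if "s < sy" for s
      using that k0 4 c by (simp add: \<alpha>)
    show ?case using init_cell[OF y(1), of p] sy2
      by (auto simp: \<alpha>0 init_kind_def z_def bit_symbol_def)
  next
    case (5 t p r)
    have c: "fst (snd (conf z 0) ! 0) (int p - ?o) = string_tape z (int p - ?o)" for p
      using k0 by (simp add: conf_0_nth)
    have \<alpha>0: "\<alpha> (vx x (Cell 0 s) 0 p) \<longleftrightarrow> string_tape z (int p - ?o) = s" if "s < sy" "p < ?W" for s p
      using that k0 c by (simp add: \<alpha>)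
    \<comment> \<open>A blank in the guess region means that \<open>y\<close> has ended, so the next
      cell is blank too.\<close>
    have "string_tape z (int (p + 1) - ?o) = 0" "p + 1 < ?W" if g: "guess_at x p"
    proof -
      have "string_tape z (int p - ?o) = 0" using 5(4) 5(2) sy2 by (simp add: \<alpha>0)
      then have "\<not> p - off x - inlen x < length y"
        using init_cell[OF y(1), of p] g by (auto simp: z_def bit_symbol_def split: if_splits)
      then show "string_tape z (int (p + 1) - ?o) = 0"
        using init_cell[OF y(1), of "p + 1"] g by (auto simp: z_def guess_at_def blank0_def)
      show "p + 1 < ?W" using g by (simp add: guess_at_def off_def width_def)
    qed
    then show ?case using 5 sy2 by (auto simp: \<alpha>0)
  next
    case (6 j s t p r)
    then have "\<alpha> (vx x (Head j) t p)" "\<alpha> (vx x (Cell j s) t p)" by auto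
    then show ?case using 6(1-5) by (simp add: \<alpha> read_tape_def)
  next
    case (7 q rs t p r)
    then have g: "q = fst (conf z t)" "rs = map read_tape (snd (conf z t))" using guard by blast+
    have "fst (next_act q rs) \<le> Q"
      using next_act_wf(1)[OF 7(1)] wf_reads[OF wf_conf[of z t]] g by simp
    moreover have "fst (conf z (Suc t)) = fst (next_act q rs)"
      by (simp add: conf_Suc step_next_act wf_conf g)
    ultimately show ?case using 7(3) by (simp add: \<alpha>)
  next
    case (8 q rs j t p r)
    then have g: "q = fst (conf z t)" "rs = map read_tape (snd (conf z t))" using guard[of q rs t p r] by auto
    have "\<alpha> (vx x (Head j) t p)" using 8 by simp
    then have h: "snd (snd (conf z t) ! j) = int p - ?o" using 8 by (simp add: \<alpha>)
    then have "\<bar>int p - ?o\<bar> \<le> int t" using head_bound[OF 8(3), of z t] by simp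
    \<comment> \<open>Before time \<open>time x\<close> a head is strictly inside the window, so a
      move to either side is not clamped.\<close>
    then have p: "0 < p" "p < ?W - 1" using 8(4) by (auto simp: off_def width_def)
    let ?m = "snd (snd (next_act q rs) ! j)"
    have "int (min (shift ?m p) (?W - 1)) - ?o = move_head ?m (int p - ?o)"
      using p by (cases ?m) auto
    then show ?case using 8(3,4) h
      by (simp add: \<alpha> conf_Suc step_nth wf_conf g act_tape_def)
  next
    case (9 q rs j t p r)
    then have g: "q = fst (conf z t)" "rs = map read_tape (snd (conf z t))" using guard[of q rs t p r] by auto
    have "\<alpha> (vx x (Head j) t p)" using 9 by simp
    then have h: "snd (snd (conf z t) ! j) = int p - ?o" using 9 by (simp add: \<alpha>)
    have "fst (snd (next_act q rs) ! j) < sy"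
      using next_act_wf(3)[OF 9(1) _ _ 9(3)] wf_reads[OF wf_conf[of z t]] g by simp
    then show ?case using 9(3-5) h
      by (simp add: \<alpha> conf_Suc step_nth wf_conf g act_tape_def)
  next
    case (10 j s t p r)
    then have a: "\<alpha> (vx x (Head j) t p)" "\<alpha> (vx x (Cell j s) t r)" by auto
    then have h: "snd (snd (conf z t) ! j) = int p - ?o" "fst (snd (conf z t) ! j) (int r - ?o) = s"
      using 10(1-5) by (simp_all add: \<alpha>)
    show ?case
    proof (cases "r = p")
      case True
      then show ?thesis using a by simp
    next
      case False
      then show ?thesis using 10(1-5) h
        by (simp add: \<alpha> conf_Suc step_nth wf_conf act_tape_def)
    qed
  next
    case (11 s t p r)
    then have "\<alpha> (vx x (Cell 1 s) ?T (off x))" by simp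
    then have "fst (snd (conf z ?T) ! 1) 0 = s" using 11(1) k0 off by (simp add: \<alpha> min_def split: if_splits)
    then show ?case using accepts_iff[OF y(1)] y(2) 11(2) by (simp add: z_def)
  qed
  then show ?thesis by blast
qed

text \<open>The string \<open>y\<close> is read off the assignment. Induction on time shows that
  every fact about the run on \<open>string_pair x y\<close> is true under the assignment; the last
  schemas then leave 2 as the only possible output symbol.\<close>

lemma satisfied_accepts:
  assumes sat: "\<forall>sc\<in>set schemas. clause_holds \<alpha> x sc"
  shows "\<exists>y. length y \<le> guess x \<and> string_pair x y \<in> A"
proof -
  let ?W = "width x" and ?T = "time x" and ?o = "int (off x)"
  note R0 = sat[unfolded ball_schemas]
  note F1 = R0[THEN conjunct1] and R1 = R0[THEN conjunct2]
  note F2 = R1[THEN conjunct1, rule_format] and R2 = R1[THEN conjunct2]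
  note F3 = R2[THEN conjunct1, rule_format] and R3 = R2[THEN conjunct2]
  note F4 = R3[THEN conjunct1] and R4 = R3[THEN conjunct2]
  note F5 = R4[THEN conjunct1] and R5 = R4[THEN conjunct2]
  note F6 = R5[THEN conjunct1, rule_format] and R6 = R5[THEN conjunct2]
  note F7 = R6[THEN conjunct1, rule_format] and R7 = R6[THEN conjunct2]
  note F8 = R7[THEN conjunct1, rule_format] and R8 = R7[THEN conjunct2]
  note F9 = R8[THEN conjunct1, rule_format] and R9 = R8[THEN conjunct2]
  note F10 = R9[THEN conjunct1, rule_format] and F11 = R9[THEN conjunct2, rule_format]
  have k0: "0 < k" "1 < k" and sy2: "0 < sy" "1 < sy" "2 < sy" using tapes_symbols_ge by auto
  note pos = time_width_pos[of x]
  define e where "e = off x + inlen x"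
  define B where "B i \<longleftrightarrow> \<alpha> (vx x (Cell 0 0) 0 (e + i))" for i
  \<comment> \<open>The guess ends at the first cell that is marked blank, or with the whole
    region.\<close>
  define l where "l = (LEAST i. B i \<or> i = guess x)"
  \<comment> \<open>The assignment may put both bit symbols into one cell; then symbol 2 takes
    precedence.\<close>
  define y where "y = map (\<lambda>i. \<alpha> (vx x (Cell 0 2) 0 (e + i))) [0..<l]"
  define z where "z = string_pair x y"
  have eW: "e + guess x < ?W" by (simp add: e_def off_def width_def)
  have ga: "guess_at x (e + i) \<longleftrightarrow> i < guess x" for i by (auto simp: guess_at_def e_def)
  have l: "B l \<or> l = guess x" unfolding l_def by (rule LeastI_ex) blast
  have l_le: "l \<le> guess x" unfolding l_def by (rule Least_le) simp
  have lB: "\<not> B i" if "i < l" for i using not_less_Least[of i "\<lambda>i. B i \<or> i = guess x"] that unfolding l_def by blast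
  have ly: "length y = l" "length y \<le> guess x" using l_le by (auto simp: y_def)
  have B: "B i" if "l \<le> i" "i < guess x" for i
    using that
  proof (induction i rule: dec_induct)
    case base
    then show ?case using l by auto
  next
    case (step i)
    then have "\<alpha> (vx x (Cell 0 0) 0 (e + i))" by (simp add: B_def)
    then show ?case
      using clause_holdsD[OF F5 pos(1), of "e + i" 0] pos step eW by (simp add: B_def ga)
  qed
  have bit: "\<alpha> (vx x (Cell 0 (bit_symbol (y ! i))) 0 (e + i))" if "i < l" for i
  proof -
    have "\<alpha> (vx x (Cell 0 0) 0 (e + i)) \<or> \<alpha> (vx x (Cell 0 1) 0 (e + i)) \<or> \<alpha> (vx x (Cell 0 2) 0 (e + i))"
      using clause_holdsD[OF F4 pos(1), of "e + i" 0] pos that l_le eW ga[of i] by simp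
    then show ?thesis using lB[OF that] that by (auto simp: B_def y_def bit_symbol_def)
  qed
  have cell0: "\<alpha> (vx x (Cell 0 (string_tape z (int p - ?o))) 0 p)" if p: "p < ?W" for p
  proof (cases "guess_at x p")
    case True
    then obtain i where i: "p = e + i" "i < guess x"
      using ga by (metis guess_at_def e_def le_Suc_ex)
    then have "string_tape z (int p - ?o) = (if i < l then bit_symbol (y ! i) else 0)"
      using init_cell[OF ly(2), of p] True by (simp add: z_def e_def ly(1))
    then show ?thesis using bit[of i] B[of i] i by (auto simp: B_def)
  next
    case False
    then have "\<alpha> (vidx x (init_kind x p) 0 p)"
      using clause_holdsD[OF F4 pos(1) p pos(2)] by simp
    then show ?thesis using init_cell[OF ly(2), of p] False by (auto simp: z_def init_kind_def split: if_splits)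
  qed
  let ?h = "\<lambda>t j. nat (?o + snd (snd (conf z t) ! j))"
  have h: "int (?h t j) = ?o + snd (snd (conf z t) ! j)" "?h t j < ?W" "0 < ?h t j" if "j < k" "t \<le> ?T" for t j
    using head_bound[OF that(1), of z t] that(2) by (auto simp: off_def width_def)
  have "\<alpha> (vx x (State (fst (conf z t))) t 0) \<and> (\<forall>j<k. \<alpha> (vx x (Head j) t (?h t j))) \<and>
      (\<forall>j<k. \<forall>p<?W. \<alpha> (vx x (Cell j (fst (snd (conf z t) ! j) (int p - ?o))) t p))" if "t \<le> ?T" for t
    using that
  proof (induction t)
    case 0
    have "\<alpha> (vx x (State 0) 0 0)" using clause_holdsD[OF F1 pos(1) pos(2) pos(2)] by simp
    moreover have "\<alpha> (vx x (Head j) 0 (off x))" if "j < k" for j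
      using clause_holdsD[OF F2[OF that] pos(1) pos(2) pos(2)] by simp
    moreover have "\<alpha> (vx x (Cell j 0) 0 p)" if "j < k" "1 \<le> j" "p < ?W" for j p
      using clause_holdsD[OF F3[OF that(1,2)] pos(1) that(3) pos(2)] by simp
    moreover have "fst (conf z 0) = 0" by (simp add: conf_def init_config_def)
    ultimately show ?case using cell0 by (auto simp: conf_0_nth)
  next
    case (Suc t)
    then have t: "t < ?T" "t \<le> ?T" by auto
    let ?c = "conf z t"
    define rs where "rs = map read_tape (snd ?c)"
    define q where "q = fst ?c"
    have IH: "\<alpha> (vx x (State q) t 0)" "\<And>j. j < k \<Longrightarrow> \<alpha> (vx x (Head j) t (?h t j))"
      "\<And>j p. j < k \<Longrightarrow> p < ?W \<Longrightarrow> \<alpha> (vx x (Cell j (fst (snd ?c ! j) (int p - ?o))) t p)"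
      using Suc.IH[OF t(2)] by (auto simp: q_def)
    have q: "q \<le> Q" using wf_conf[of z t] by (simp add: wf_config_def q_def)
    have len: "length (snd ?c) = k" using wf_conf[of z t] by (simp add: wf_config_def)
    have cell: "fst (snd ?c ! j) i < sy" if "j < k" for i j using wf_conf[of z t] that by (simp add: wf_config_def)
    have rs: "rs \<in> set (List.n_lists k [0..<sy])"
      using wf_reads[OF wf_conf[of z t]] by (auto simp: set_n_lists rs_def)
    have hd: "fst (snd ?c ! j) (int (?h t j) - ?o) = rs ! j" if "j < k" for j
      using h(1)[OF that t(2)] that len by (simp add: rs_def read_tape_def)
    have scan: "\<alpha> (vx x (Scan j (rs ! j)) t 0)" if "j < k" for j
    proof -
      have "rs ! j < sy" using hd[OF that] cell[OF that] by metis
      moreover have "\<alpha> (vx x (Cell j (rs ! j)) t (?h t j))" using IH(3)[OF that h(2)[OF that t(2)]] hd[OF that] by simp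
      ultimately show ?thesis
        using clause_holdsD[OF F6[OF that] t(1) h(2)[OF that t(2)] pos(2)] IH(2)[OF that] by simp
    qed
    have guard: "\<forall>f\<in>set (guard q rs). \<alpha> (f x t p r)" for p r
      using IH(1) scan by (auto simp: guard_def)
    have conf: "fst (conf z (Suc t)) = fst (next_act q rs)"
      "\<And>j. j < k \<Longrightarrow> snd (conf z (Suc t)) ! j = act_tape (snd (next_act q rs) ! j) (snd ?c ! j)"
      unfolding conf_Suc q_def rs_def
      using step_next_act[of "conf z t"] step_nth[OF wf_conf[of z t]] by (simp_all only: fst_conv)
    have "\<alpha> (vx x (State (fst (next_act q rs))) (Suc t) 0)"
      using clause_holdsD[OF F7[OF q rs] t(1) pos(2) pos(2) guard] by simp
    moreover have "\<alpha> (vx x (Head j) (Suc t) (?h (Suc t) j))" if "j < k" for j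
    proof -
      let ?m = "snd (snd (next_act q rs) ! j)"
      have "\<alpha> (vx x (Head j) (Suc t) (shift ?m (?h t j)))"
        using clause_holdsD[OF F8[OF q rs that] t(1) h(2)[OF that t(2)] pos(2)] guard IH(2)[OF that] by auto
      moreover have "shift ?m (?h t j) = ?h (Suc t) j"
        using h[OF that t(2)] conf(2)[OF that] by (cases ?m) (auto simp: act_tape_def)
      ultimately show ?thesis by simp
    qed
    moreover have "\<alpha> (vx x (Cell j (fst (snd (conf z (Suc t)) ! j) (int p - ?o))) (Suc t) p)"
      if "j < k" "p < ?W" for j p
    proof (cases "p = ?h t j")
      case True
      then have "fst (snd (conf z (Suc t)) ! j) (int p - ?o) = fst (snd (next_act q rs) ! j)"
        using h(1)[OF that(1) t(2)] conf(2)[OF that(1)] by (simp add: act_tape_def)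
      then show ?thesis
        using clause_holdsD[OF F9[OF q rs that(1)] t(1) that(2) pos(2)] guard IH(2)[OF that(1)] True by auto
    next
      case False
      then have "int p - ?o \<noteq> snd (snd ?c ! j)" using h(1)[OF that(1) t(2)] by linarith
      then have "fst (snd (conf z (Suc t)) ! j) (int p - ?o) = fst (snd ?c ! j) (int p - ?o)"
        using conf(2)[OF that(1)] by (simp add: act_tape_def)
      then show ?thesis
        using clause_holdsD[OF F10[OF that(1) cell[OF that(1)]] t(1) h(2)[OF that(1) t(2)] that(2)] False
          IH(2)[OF that(1)] IH(3)[OF that] by auto
    qed
    ultimately show ?case unfolding conf(1) by auto
  qed
  from this[of ?T] have "\<forall>j<k. \<forall>p<?W. \<alpha> (vx x (Cell j (fst (snd (conf z ?T) ! j) (int p - ?o))) ?T p)" by blast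
  moreover have "off x < ?W" by (simp add: off_def width_def)
  ultimately have c: "\<alpha> (vx x (Cell 1 (fst (snd (conf z ?T) ! 1) (int (off x) - ?o))) ?T (off x))"
    using k0(2) by blast
  let ?s = "fst (snd (conf z ?T) ! 1) 0"
  have "?s < sy" using wf_conf[of z ?T] k0 by (simp add: wf_config_def)
  then have "?s = 2" using clause_holdsD[OF F11[of ?s] pos(1) pos(2) pos(2)] c by auto
  then have "string_pair x y \<in> A" using accepts_iff[OF ly(2)] by (simp add: z_def)
  then show ?thesis using ly(2) by blast
qed

lemma K_iff_satisfiable: "x \<in> K \<longleftrightarrow> (\<exists>\<alpha>. \<forall>sc\<in>set schemas. clause_holds \<alpha> x sc)"
  using K_iff[of x] run_satisfies[of _ x] satisfied_accepts[of _ x] by (auto simp: guess_def)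

section \<open>Definability and numbering of the clauses\<close>

lemma dfn_min: "dfn X \<Gamma> f \<Longrightarrow> dfn X \<Gamma> g \<Longrightarrow> dfn X \<Gamma> (\<lambda>s. min (f s) (g s))"
  unfolding min_def by (intro dfn_if dfp_le)

lemma dfn_sizes:
  "dfn X \<Gamma> (\<lambda>s. inlen (X s))" "dfn X \<Gamma> (\<lambda>s. guess (X s))" "dfn X \<Gamma> (\<lambda>s. time (X s))"
  "dfn X \<Gamma> (\<lambda>s. off (X s))" "dfn X \<Gamma> (\<lambda>s. width (X s))" "dfn X \<Gamma> (\<lambda>s. num_vars (X s))"
  unfolding num_vars_def width_def off_def time_def guess_def inlen_def
  by (rule dfn_rules)+

lemma dfn_vidx:
  assumes "dfn X \<Gamma> \<tau>" "dfn X \<Gamma> t" "dfn X \<Gamma> p"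
  shows "dfn X \<Gamma> (\<lambda>s. vidx (X s) (\<tau> s) (t s) (p s))"
  unfolding vidx_def by (rule dfn_rules dfn_min dfn_sizes assms)+

lemma dfp_guess_at: "dfn X \<Gamma> p \<Longrightarrow> dfp X \<Gamma> (\<lambda>s. guess_at (X s) (p s))"
  unfolding guess_at_def by (rule dfn_rules dfn_sizes | assumption)+

lemma dfn_init_kind: "dfn X \<Gamma> p \<Longrightarrow> dfn X \<Gamma> (\<lambda>s. init_kind (X s) (p s))"
  unfolding init_kind_def blank0_def one0_def by (rule dfn_rules dfn_sizes | assumption)+

lemma dfn_shift: "dfn X \<Gamma> p \<Longrightarrow> dfn X \<Gamma> (\<lambda>s. shift m (p s))"
  by (cases m; simp only: shift.simps; (rule dfn_rules | assumption)+)

lemma dfn_literal: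
  assumes "sc \<in> set schemas" "f \<in> set (fst sc) \<union> set (snd sc)" "dfn X \<Gamma> t" "dfn X \<Gamma> p" "dfn X \<Gamma> r"
  shows "dfn X \<Gamma> (\<lambda>s. f (X s) (t s) (p s) (r s))"
proof -
  have "\<forall>sc\<in>set schemas. \<forall>f\<in>set (fst sc) \<union> set (snd sc). dfn X \<Gamma> (\<lambda>s. f (X s) (t s) (p s) (r s))"
    unfolding ball_schemas guard_def
    by (auto intro!: dfn_const dfn_vidx dfn_sizes dfn_if dfp_guess_at dfn_init_kind dfn_shift dfn_Suc dfp_eq assms(3-5))
  then show ?thesis using assms(1,2) by blast
qed

text \<open>Holds for arbitrary parameters because \<open>vidx\<close> clamps them.\<close>

lemma literal_less:
  assumes "sc \<in> set schemas" "f \<in> set (fst sc) \<union> set (snd sc)"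
  shows "f x t p r < num_vars x"
proof -
  have k0: "0 < k" "1 < k" and sy2: "0 < sy" "1 < sy" "2 < sy" using tapes_symbols_ge by auto
  have v: "vx x a t p < num_vars x" if "a \<in> set atoms" for a t p using kind(1)[OF that] by (rule vidx_less)
  have i: "vidx x (init_kind x p) t p < num_vars x" for t p
    using v[of "Cell 0 0"] v[of "Cell 0 1"] v[of "Cell 0 2"] k0 sy2 by (auto simp: init_kind_def)
  have n: "fst (next_act q rs) \<le> Q" "\<And>j. j < k \<Longrightarrow> fst (snd (next_act q rs) ! j) < sy" "\<And>j. j < k \<Longrightarrow> rs ! j < sy"
    if "q \<le> Q" "rs \<in> set (List.n_lists k [0..<sy])" for q rs
  proof -
    have "length rs = k" "set rs \<subseteq> {..<sy}" using that(2) by (auto simp: set_n_lists)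
    then show "fst (next_act q rs) \<le> Q" "\<And>j. j < k \<Longrightarrow> fst (snd (next_act q rs) ! j) < sy"
        "\<And>j. j < k \<Longrightarrow> rs ! j < sy"
      using next_act_wf[OF that(1), of rs] by (auto simp: subset_iff)
  qed
  have "\<forall>sc\<in>set schemas. \<forall>f\<in>set (fst sc) \<union> set (snd sc). f x t p r < num_vars x"
    unfolding ball_schemas guard_def using k0 sy2 by (auto intro!: v i n)
  then show ?thesis using assms by blast
qed

definition "num_clauses x = length schemas * time x * width x * width x"

text \<open>A clause number is a mixed-radix code of schema, \<open>t\<close>, \<open>p\<close> and
  \<open>r\<close>. The schema is chosen by a finite disjunction, because a list of literal
  functions cannot be the value of an expression.\<close>

definition in_clause :: "(literal list \<times> literal list \<Rightarrow> literal list) \<Rightarrow> bool list \<Rightarrow> nat \<Rightarrow> nat \<Rightarrow> bool" where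
  "in_clause side x j i \<longleftrightarrow> (\<exists>c\<in>set [0..<length schemas]. j mod length schemas = c \<and>
     (\<exists>f\<in>set (side (schemas ! c)). f x (j div length schemas mod time x)
        (j div length schemas div time x mod width x)
        (j div length schemas div time x div width x mod width x) = i))"

lemma dfn_num_clauses: "dfn X \<Gamma> (\<lambda>s. num_clauses (X s))"
  unfolding num_clauses_def by (rule dfn_rules dfn_sizes)+

lemma dfp_in_clause:
  assumes "side = fst \<or> side = snd" "dfn X \<Gamma> j" "dfn X \<Gamma> i"
  shows "dfp X \<Gamma> (\<lambda>s. in_clause side (X s) (j s) (i s))"
  unfolding in_clause_def
proof (intro dfp_bex_list dfp_conj dfp_eq dfn_rules assms)
  fix c f assume "c \<in> set [0..<length schemas]" "f \<in> set (side (schemas ! c))"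
  then have "schemas ! c \<in> set schemas" "f \<in> set (fst (schemas ! c)) \<union> set (snd (schemas ! c))"
    using assms(1) by auto
  then show "dfn X \<Gamma> (\<lambda>s. f (X s) (j s div length schemas mod time (X s))
        (j s div length schemas div time (X s) mod width (X s))
        (j s div length schemas div time (X s) div width (X s) mod width (X s)))"
    by (rule dfn_literal) (rule dfn_rules dfn_sizes assms)+
qed

lemma K_iff_clauses:
  "x \<in> K \<longleftrightarrow> (\<exists>\<alpha>. \<forall>j<num_clauses x. \<exists>i<num_vars x.
     in_clause snd x j i \<and> \<alpha> i \<or> in_clause fst x j i \<and> \<not> \<alpha> i)"
proof -
  let ?n = "length schemas" and ?T = "time x" and ?W = "width x"
  have "(\<forall>sc\<in>set schemas. clause_holds \<alpha> x sc) \<longleftrightarrow> (\<forall>j<num_clauses x. \<exists>i<num_vars x.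
     in_clause snd x j i \<and> \<alpha> i \<or> in_clause fst x j i \<and> \<not> \<alpha> i)" (is "?L \<longleftrightarrow> ?R") for \<alpha>
  proof
    assume L: ?L
    show ?R
    proof (intro allI impI)
      fix j assume "j < num_clauses x"
      then have n: "?n > 0" by (auto simp: num_clauses_def intro: gr0I)
      define c t p r where "c = j mod ?n" and "t = j div ?n mod ?T" and "p = j div ?n div ?T mod ?W"
        and "r = j div ?n div ?T div ?W mod ?W"
      have b: "c < ?n" "t < ?T" "p < ?W" "r < ?W" using n time_width_pos[of x] by (auto simp: c_def t_def p_def r_def)
      have in_c: "in_clause side x j i \<longleftrightarrow> (\<exists>f\<in>set (side (schemas ! c)). f x t p r = i)" for side i
        using b(1) by (auto simp: in_clause_def c_def t_def p_def r_def)
      have m: "schemas ! c \<in> set schemas" using b(1) by simp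
      then have "clause_holds \<alpha> x (fst (schemas ! c), snd (schemas ! c))" using L by simp
      from clause_holdsD[OF this b(2-4)]
      show "\<exists>i<num_vars x. in_clause snd x j i \<and> \<alpha> i \<or> in_clause fst x j i \<and> \<not> \<alpha> i"
        unfolding in_c using literal_less[OF m] by blast
    qed
  next
    assume R: ?R
    show ?L
    proof
      fix sc assume "sc \<in> set schemas"
      then obtain c where c: "c < ?n" "sc = schemas ! c" by (auto simp: in_set_conv_nth)
      have "clause_holds \<alpha> x (fst sc, snd sc)"
      proof (rule clause_holdsI)
        fix t p r assume b: "t < ?T" "p < ?W" "r < ?W" and pre: "\<forall>f\<in>set (fst sc). \<alpha> (f x t p r)"
        define j where "j = ((r * ?W + p) * ?T + t) * ?n + c"
        have d: "j mod ?n = c" "j div ?n = (r * ?W + p) * ?T + t"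
          unfolding j_def using c(1) by (simp_all add: mixed_radix)
        have d2: "j div ?n mod ?T = t" "j div ?n div ?T = r * ?W + p"
          unfolding d using b by (simp_all add: mixed_radix)
        have d3: "j div ?n div ?T mod ?W = p" "j div ?n div ?T div ?W mod ?W = r"
          unfolding d2 using b by (simp_all add: mixed_radix)
        have "r * ?W + p < ?W * ?W"
          using b mult_le_mono1[of "Suc r" ?W ?W] by (simp add: Suc_le_eq)
        then have "(r * ?W + p) * ?T + t < ?W * ?W * ?T"
          using b mult_le_mono1[of "Suc (r * ?W + p)" "?W * ?W" ?T] by (simp add: Suc_le_eq)
        then have "j < ?W * ?W * ?T * ?n"
          unfolding j_def using c mult_le_mono1[of "Suc ((r * ?W + p) * ?T + t)" "?W * ?W * ?T" ?n] by (simp add: Suc_le_eq)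
        then have "j < num_clauses x" by (simp add: num_clauses_def mult.commute mult.left_commute)
        with R obtain i where i: "in_clause snd x j i \<and> \<alpha> i \<or> in_clause fst x j i \<and> \<not> \<alpha> i" by blast
        have in_c: "in_clause side x j i \<longleftrightarrow> (\<exists>f\<in>set (side sc). f x t p r = i)" for side i
          unfolding in_clause_def d(1) d2(1) d3 using c by auto
        show "\<exists>f\<in>set (snd sc). \<alpha> (f x t p r)" using i pre unfolding in_c by auto
      qed
      then show "clause_holds \<alpha> x sc" by simp
    qed
  qed
  then show ?thesis using K_iff_satisfiable by simp
qed

lemma num_vars_pos: "num_vars x > 0"
  using time_width_pos[of x] kind(1)[of "State 0"] by (auto simp: num_vars_def)

end

section \<open>From satisfiability to the Borsuk number\<close>

text \<open>
  Karp's reduction from satisfiability to colourability with \<open>n + 1\<close> colours: the palette is a clique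
  on the vertices \<open>1, \<dots>, n + 1\<close>, the literals of variable \<open>i\<close> are \<open>n + 2 + i\<close> and \<open>2 * n + 2 + i\<close>,
  whose colours can only be those of \<open>1\<close> (false) and \<open>i + 2\<close> (true), and clause \<open>j\<close> is
  \<open>3 * n + 2 + j\<close>, whose colour names a variable that makes it true. The Borsuk instance is the
  complement of this graph together with the universal vertex \<open>0\<close>; it has diameter 2, hence the
  parts of small diameter are cliques, that is, colour classes.
\<close>

definition conflict :: "nat \<Rightarrow> nat \<Rightarrow> (nat \<Rightarrow> nat \<Rightarrow> bool) \<Rightarrow> (nat \<Rightarrow> nat \<Rightarrow> bool) \<Rightarrow> nat \<Rightarrow> nat \<Rightarrow> bool" where
  "conflict n m P N u v \<longleftrightarrow>
     (1 \<le> u \<and> u \<le> n + 1 \<and> 1 \<le> v \<and> v \<le> n + 1 \<and> u \<noteq> v) \<or>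
     (2 \<le> u \<and> u \<le> n + 1 \<and> (\<exists>i<n. u \<noteq> i + 2 \<and> (v = n + 2 + i \<or> v = 2 * n + 2 + i))) \<or>
     (\<exists>i<n. u = n + 2 + i \<and> v = 2 * n + 2 + i) \<or>
     (u = 1 \<and> 3 * n + 2 \<le> v \<and> v < 3 * n + 2 + m) \<or>
     (\<exists>j<m. \<exists>i<n. u = 3 * n + 2 + j \<and> (v = n + 2 + i \<and> \<not> P j i \<or> v = 2 * n + 2 + i \<and> \<not> N j i))"

text \<open>\<open>conflict\<close> is not symmetric, so both orders are excluded.\<close>

definition sat_adj :: "nat \<Rightarrow> nat \<Rightarrow> (nat \<Rightarrow> nat \<Rightarrow> bool) \<Rightarrow> (nat \<Rightarrow> nat \<Rightarrow> bool) \<Rightarrow> nat \<Rightarrow> nat \<Rightarrow> bool" where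
  "sat_adj n m P N u v \<longleftrightarrow> u < 3 * n + 2 + m \<and> v < 3 * n + 2 + m \<and> u \<noteq> v \<and>
     \<not> conflict n m P N u v \<and> \<not> conflict n m P N v u"

definition sat_graph :: "nat \<Rightarrow> nat \<Rightarrow> (nat \<Rightarrow> nat \<Rightarrow> bool) \<Rightarrow> (nat \<Rightarrow> nat \<Rightarrow> bool) \<Rightarrow> nat pair_pre_digraph" where
  "sat_graph n m P N = \<lparr>pverts = {..<3 * n + 2 + m}, parcs = {(u, v). sat_adj n m P N u v}\<rparr>"

lemma sat_adj_sym: "sat_adj n m P N u v \<Longrightarrow> sat_adj n m P N v u"
  by (auto simp: sat_adj_def)

lemma pair_graph_sat_graph: "pair_graph (sat_graph n m P N)"
proof -
  have "parcs (sat_graph n m P N) \<subseteq> {..<3 * n + 2 + m} \<times> {..<3 * n + 2 + m}"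
    by (auto simp: sat_graph_def sat_adj_def)
  then have "finite (parcs (sat_graph n m P N))" by (rule finite_subset) simp
  then show ?thesis
    by unfold_locales (auto simp: sat_graph_def sat_adj_def symmetric_def sym_def)
qed

lemma zero_adj: "0 < v \<Longrightarrow> v < 3 * n + 2 + m \<Longrightarrow> sat_adj n m P N 0 v"
  by (auto simp: sat_adj_def conflict_def)

lemma connected_sat_graph: "connected (with_proj (sat_graph n m P N))"
proof -
  have "(u, v) \<in> (parcs (sat_graph n m P N))\<^sup>*" if "u < 3 * n + 2 + m" "v < 3 * n + 2 + m" for u v
  proof -
    have "(u, 0) \<in> (parcs (sat_graph n m P N))\<^sup>*"
      using zero_adj[of u n m P N] that(1) by (cases "u = 0") (auto simp: sat_graph_def intro: sat_adj_sym)
    moreover have "(0, v) \<in> (parcs (sat_graph n m P N))\<^sup>*"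
      using zero_adj[of v n m P N] that(2) by (cases "v = 0") (auto simp: sat_graph_def)
    ultimately show ?thesis by (rule rtrancl_trans)
  qed
  then show ?thesis
    unfolding connected_iff_rtrancl[OF pair_graph_sat_graph] by (auto simp: sat_graph_def lessThan_empty_iff)
qed

lemma colouring_imp_sat:
  assumes n: "n > 0" and card: "card (c ` {..<3 * n + 2 + m}) < n + 2"
    and bc: "borsuk_colouring {..<3 * n + 2 + m} {(u, v). sat_adj n m P N u v} c d"
  shows "\<exists>\<alpha>. \<forall>j<m. \<exists>i<n. P j i \<and> \<alpha> i \<or> N j i \<and> \<not> \<alpha> i"
proof -
  let ?V = "{..<3 * n + 2 + m}" and ?R = "{(u, v). sat_adj n m P N u v}"
  \<comment> \<open>Any two vertices are joined through the universal vertex 0 by a walk of length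
    at most 2, yet some pair is farther apart than \<open>d\<close>.\<close>
  have "d \<le> 1"
  proof (rule ccontr)
    assume d: "\<not> d \<le> 1"
    have "\<exists>i\<le>d. (u, v) \<in> ?R ^^ i" if "u \<in> ?V" "v \<in> ?V" for u v
    proof -
      consider "u = v" | "u = 0" "v \<noteq> 0" | "u \<noteq> 0" "v = 0" | "u \<noteq> 0" "v \<noteq> 0" by metis
      then show ?thesis
      proof cases
        case 1
        then show ?thesis by (intro exI[of _ 0]) simp
      next
        case 2
        then show ?thesis using d that zero_adj[of v n m P N] by (intro exI[of _ 1]) simp
      next
        case 3
        then show ?thesis using d that zero_adj[of u n m P N, THEN sat_adj_sym] by (intro exI[of _ 1]) simp
      next
        case 4
        then have "sat_adj n m P N u 0" "sat_adj n m P N 0 v"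
          using that zero_adj[of v n m P N] zero_adj[of u n m P N, THEN sat_adj_sym] by auto
        then have "(u, v) \<in> ?R ^^ 2" by (auto simp: numeral_2_eq_2)
        then show ?thesis using d by (intro exI[of _ 2]) simp
      qed
    qed
    then show False using bc unfolding borsuk_colouring_def by blast
  qed
  have col: "c u \<noteq> c v" if "conflict n m P N u v" "u \<in> ?V" "v \<in> ?V" "u \<noteq> v" for u v
  proof
    assume "c u = c v"
    with bc that obtain i where i: "i \<le> d" "(u, v) \<in> {(u, v) \<in> ?R. c u = c v} ^^ i"
      unfolding borsuk_colouring_def by blast
    have "i = 0 \<or> i = 1" using i(1) \<open>d \<le> 1\<close> by auto
    then show False using i(2) that by (auto simp: sat_adj_def)
  qed
  let ?p = "{1..n + 1}"
  have inj: "inj_on c ?p"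
  proof (rule inj_onI, rule ccontr)
    fix u v assume "u \<in> ?p" "v \<in> ?p" "c u = c v" "u \<noteq> v"
    then show False using col[of u v] by (auto simp: conflict_def)
  qed
  \<comment> \<open>The palette already uses all \<open>n + 1\<close> available colours, so every
    vertex has the colour of a palette vertex.\<close>
  have "c ` ?p = c ` ?V"
  proof (rule card_seteq)
    show "card (c ` ?V) \<le> card (c ` ?p)" using card card_image[OF inj] by simp
  qed (auto intro!: image_mono)
  then have pal: "\<exists>u\<in>?p. c v = c u" if "v \<in> ?V" for v using that by blast
  have lit: "c v = c 1 \<or> c v = c (i + 2)" if "i < n" "v = n + 2 + i \<or> v = 2 * n + 2 + i" for i v
  proof -
    have v: "v \<in> ?V" using that by auto
    obtain u where u: "u \<in> ?p" "c v = c u" using pal[OF v] by blast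
    have "u = 1 \<or> u = i + 2"
    proof (rule ccontr)
      assume "\<not> (u = 1 \<or> u = i + 2)"
      then have "conflict n m P N u v" using u(1) that by (auto simp: conflict_def)
      then show False using col[of u v] u v that by auto
    qed
    then show ?thesis using u(2) by auto
  qed
  define \<alpha> where "\<alpha> i \<longleftrightarrow> c (n + 2 + i) = c (i + 2)" for i
  have "\<exists>i<n. P j i \<and> \<alpha> i \<or> N j i \<and> \<not> \<alpha> i" if j: "j < m" for j
  proof -
    let ?j = "3 * n + 2 + j"
    have jV: "?j \<in> ?V" using j by simp
    obtain u where u: "u \<in> ?p" "c ?j = c u" using pal[OF jV] by blast
    have "u \<noteq> 1" using col[of 1 ?j] u(2) j by (auto simp: conflict_def)
    then have "u = (u - 2) + 2" "u - 2 < n" using u(1) by auto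
    then obtain i where i: "u = i + 2" "i < n" by blast
    show ?thesis
    proof (cases "\<alpha> i")
      case True
      have "P j i"
      proof (rule ccontr)
        assume "\<not> P j i"
        then have "conflict n m P N ?j (n + 2 + i)" using i j by (auto simp: conflict_def)
        then show False using col[of ?j "n + 2 + i"] True u i j by (auto simp: \<alpha>_def)
      qed
      then show ?thesis using True i by blast
    next
      case False
      \<comment> \<open>If the positive literal is not true, it has the colour of 1; its negation,
        in conflict with it, must then have the colour of \<open>i + 2\<close>.\<close>
      have "conflict n m P N (n + 2 + i) (2 * n + 2 + i)" using i by (auto simp: conflict_def)
      then have "c (n + 2 + i) \<noteq> c (2 * n + 2 + i)" using col i n by auto
      moreover have "c (n + 2 + i) = c 1" using lit[OF i(2), of "n + 2 + i"] False by (simp add: \<alpha>_def)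
      ultimately have eq: "c (2 * n + 2 + i) = c (i + 2)" using lit[OF i(2), of "2 * n + 2 + i"] by auto
      have "N j i"
      proof (rule ccontr)
        assume "\<not> N j i"
        then have "conflict n m P N ?j (2 * n + 2 + i)" using i j by (auto simp: conflict_def)
        then show False using col[of ?j "2 * n + 2 + i"] eq u i j by auto
      qed
      then show ?thesis using False i by blast
    qed
  qed
  then show ?thesis by blast
qed

lemma sat_imp_colouring:
  assumes n: "n > 0" and sat: "\<forall>j<m. \<exists>i<n. P j i \<and> \<alpha> i \<or> N j i \<and> \<not> \<alpha> i"
  shows "\<exists>c. card (c ` {..<3 * n + 2 + m}) < n + 2 \<and>
    borsuk_colouring {..<3 * n + 2 + m} {(u, v). sat_adj n m P N u v} c 1"
proof -
  let ?V = "{..<3 * n + 2 + m}" and ?R = "{(u, v). sat_adj n m P N u v}"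
  from sat obtain w where w: "\<And>j. j < m \<Longrightarrow> w j < n \<and> (P j (w j) \<and> \<alpha> (w j) \<or> N j (w j) \<and> \<not> \<alpha> (w j))" by metis
  \<comment> \<open>Palette vertex \<open>v\<close> has colour \<open>v - 1\<close>. Thus 0 stands
    for false and \<open>i + 1\<close> for a true literal of variable \<open>i\<close>; vertex 0 has
    no conflicts and shares colour 0. Clause \<open>j\<close> takes the colour of the variable
    \<open>w j\<close> that satisfies it.\<close>
  define c where "c v = (if v \<le> n + 1 then v - 1
    else if v < 2 * n + 2 then (if \<alpha> (v - (n + 2)) then v - (n + 2) + 1 else 0)
    else if v < 3 * n + 2 then (if \<alpha> (v - (2 * n + 2)) then 0 else v - (2 * n + 2) + 1)
    else w (v - (3 * n + 2)) + 1)" for v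
  have c: "c v = v - 1" if "v \<le> n + 1" for v using that by (simp add: c_def)
  have cp: "c (n + 2 + i) = (if \<alpha> i then i + 1 else 0)" if "i < n" for i using that by (simp add: c_def)
  have cn: "c (2 * n + 2 + i) = (if \<alpha> i then 0 else i + 1)" if "i < n" for i using that n by (simp add: c_def)
  have cc: "c (3 * n + 2 + j) = w j + 1" for j using n by (simp add: c_def)
  have "c v \<le> n" if v: "v \<in> ?V" for v
  proof -
    consider "v \<le> n + 1" | i where "i < n" "v = n + 2 + i" | i where "i < n" "v = 2 * n + 2 + i"
      | j where "j < m" "v = 3 * n + 2 + j"
    proof -
      have "v \<le> n + 1 \<or> (v - (n + 2) < n \<and> v = n + 2 + (v - (n + 2))) \<or>
        (v - (2 * n + 2) < n \<and> v = 2 * n + 2 + (v - (2 * n + 2))) \<or> (v - (3 * n + 2) < m \<and> v = 3 * n + 2 + (v - (3 * n + 2)))"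
        using v by (simp, linarith)
      then show thesis using that by blast
    qed
    then show ?thesis
    proof cases
      case 1
      then show ?thesis using c[of v] by simp
    next
      case (2 i)
      then show ?thesis using cp[of i] by auto
    next
      case (3 i)
      then show ?thesis using cn[of i] by auto
    next
      case (4 j)
      then show ?thesis using cc[of j] w[of j] by auto
    qed
  qed
  then have "c ` ?V \<subseteq> {..n}" by auto
  then have "card (c ` ?V) \<le> card {..n}" by (intro card_mono) auto
  then have card: "card (c ` ?V) < n + 2" by simp
  have conf: "c u \<noteq> c v" if uv: "conflict n m P N u v" "v < 3 * n + 2 + m" for u v
    using uv(1) unfolding conflict_def
  proof (elim disjE conjE exE)
    assume "1 \<le> u" "u \<le> n + 1" "1 \<le> v" "v \<le> n + 1" "u \<noteq> v"
    then show ?thesis by (simp add: c)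
  next
    fix i assume "2 \<le> u" "u \<le> n + 1" "i < n" "u \<noteq> i + 2" "v = n + 2 + i"
    then show ?thesis using cp[of i] by (auto simp: c)
  next
    fix i assume "2 \<le> u" "u \<le> n + 1" "i < n" "u \<noteq> i + 2" "v = 2 * n + 2 + i"
    then show ?thesis using cn[of i] by (auto simp: c)
  next
    fix i assume "i < n" "u = n + 2 + i" "v = 2 * n + 2 + i"
    then show ?thesis using cp[of i] cn[of i] by auto
  next
    assume "u = 1" "3 * n + 2 \<le> v" "v < 3 * n + 2 + m"
    then obtain j where "v = 3 * n + 2 + j" using le_Suc_ex by blast
    then show ?thesis using cc[of j] \<open>u = 1\<close> by (simp add: c)
  next
    fix j i assume "j < m" "i < n" "u = 3 * n + 2 + j" "v = n + 2 + i" "\<not> P j i"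
    then show ?thesis using cc[of j] cp[of i] w[of j] by auto
  next
    fix j i assume "j < m" "i < n" "u = 3 * n + 2 + j" "v = 2 * n + 2 + i" "\<not> N j i"
    then show ?thesis using cc[of j] cn[of i] w[of j] by auto
  qed
  have "\<exists>i\<le>1. (a, b) \<in> {(u, v) \<in> ?R. c u = c v} ^^ i" if "a \<in> ?V" "b \<in> ?V" "c a = c b" for a b
  proof (cases "a = b")
    case True
    then show ?thesis by (intro exI[of _ 0]) simp
  next
    case False
    then have "sat_adj n m P N a b" using that conf[of a b] conf[of b a] by (auto simp: sat_adj_def)
    then show ?thesis using that by (intro exI[of _ 1]) simp
  qed
  \<comment> \<open>The palette vertices 1 and 2 are in conflict, hence not adjacent; vertex 2
    belongs to the palette because \<open>n > 0\<close>.\<close>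
  moreover have "\<exists>u\<in>?V. \<exists>v\<in>?V. \<forall>i\<le>1. (u, v) \<notin> ?R ^^ i"
  proof (intro bexI allI impI)
    fix i :: nat assume "i \<le> 1"
    then have "i = 0 \<or> i = 1" by auto
    then show "(1, 2) \<notin> ?R ^^ i" using n by (auto simp: sat_adj_def conflict_def)
  qed (use n in auto)
  ultimately have "borsuk_colouring ?V ?R c 1" unfolding borsuk_colouring_def by simp
  then show ?thesis using card by blast
qed

lemma borsuk_sat_graph_iff:
  assumes "n > 0"
  shows "borsuk_number (sat_graph n m P N) < enat (n + 2) \<longleftrightarrow>
    (\<exists>\<alpha>. \<forall>j<m. \<exists>i<n. P j i \<and> \<alpha> i \<or> N j i \<and> \<not> \<alpha> i)"
proof -
  have G: "pverts (sat_graph n m P N) = {..<3 * n + 2 + m}" "parcs (sat_graph n m P N) = {(u, v). sat_adj n m P N u v}"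
    by (auto simp: sat_graph_def)
  have ne: "pverts (sat_graph n m P N) \<noteq> {}" unfolding G by (auto simp: lessThan_empty_iff)
  show ?thesis
    unfolding borsuk_number_less_iff[OF pair_graph_sat_graph ne] G
    using colouring_imp_sat[OF assms, of _ m P N] sat_imp_colouring[OF assms, of m P _ N] by blast
qed

section \<open>Encodings\<close>

text \<open>Thus \<open>pow2_below (Suc k)\<close> is the number of binary digits of
  \<open>k\<close>.\<close>

lemma pow2_below_Suc_less_iff: "j < pow2_below (Suc k) \<longleftrightarrow> 2 ^ j \<le> k"
proof
  assume "j < pow2_below (Suc k)"
  then have "\<not> Suc k \<le> 2 ^ j" using mono_pow2_below[of "Suc k" "2 ^ j"] by (auto simp: pow2_below_power)
  then show "2 ^ j \<le> k" by simp
next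
  assume "2 ^ j \<le> k"
  then have "(2::nat) ^ j < 2 ^ pow2_below (Suc k)"
    using less_power_pow2_below[of "Suc k"] by linarith
  then show "j < pow2_below (Suc k)" by simp
qed

text \<open>The substitution \<open>z = 2 ^ j\<close>. The left side is free of exponentiation and
  hence definable.\<close>

lemma sum_pow2_if:
  fixes g :: "nat \<Rightarrow> nat"
  shows "(\<Sum>z<Suc l. if pow2 z \<and> P (pow2_below z) then g z else 0) =
    (\<Sum>j<pow2_below (Suc l). if P j then g (2 ^ j) else 0)"
proof -
  have "{z. z < Suc l \<and> pow2 z} = (\<lambda>j. 2 ^ j) ` {..<pow2_below (Suc l)}"
    by (auto simp: pow2_def pow2_below_Suc_less_iff)
  moreover have "inj_on (\<lambda>j. 2 ^ j :: nat) {..<pow2_below (Suc l)}" by (auto simp: inj_on_def)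
  ultimately have "(\<Sum>z\<in>{z. z < Suc l \<and> pow2 z}. if P (pow2_below z) then g z else 0) =
      (\<Sum>j<pow2_below (Suc l). if P j then g (2 ^ j) else 0)"
    by (simp add: sum.reindex pow2_below_power)
  moreover have "(\<Sum>z<Suc l. if pow2 z \<and> P (pow2_below z) then g z else 0) =
      (\<Sum>z\<in>{z. z < Suc l \<and> pow2 z}. if P (pow2_below z) then g z else 0)"
    by (rule sum.mono_neutral_cong_right) (auto split: if_splits)
  ultimately show ?thesis by simp
qed

lemma binary_conv_map: "binary k = map (\<lambda>j. odd (k div 2 ^ j)) [0..<pow2_below (Suc k)]"
proof (induction k rule: binary.induct)
  case (1 k)
  show ?case
  proof (cases "k = 0")
    case True
    moreover have "\<not> pow2 0" by (auto simp: pow2_def)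
    ultimately show ?thesis by (simp add: binary.simps[of 0] pow2_below_def)
  next
    case False
    have "j < pow2_below (Suc k) \<longleftrightarrow> j < Suc (pow2_below (Suc (k div 2)))" for j
      using False by (cases j) (auto simp: pow2_below_Suc_less_iff less_eq_div_iff_mult_less_eq mult.commute)
    then have "pow2_below (Suc k) = Suc (pow2_below (Suc (k div 2)))"
      by (metis less_not_refl nat_neq_iff)
    then have "map (\<lambda>j. odd (k div 2 ^ j)) [0..<pow2_below (Suc k)] =
        odd k # map (\<lambda>j. odd (k div 2 ^ Suc j)) [0..<pow2_below (Suc (k div 2))]"
      by (simp add: upt_conv_Cons map_Suc_upt[symmetric] del: upt_Suc power_Suc)
    also have "\<dots> = odd k # binary (k div 2)" using 1[OF False] by (simp add: div_mult2_eq)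
    finally show ?thesis using False by (simp add: binary.simps[of k])
  qed
qed

text \<open>The last bit is the most significant one, so recognising the encoding of a positive
  number amounts to inspecting that bit.\<close>

lemma binary_surj: "bs \<noteq> [] \<Longrightarrow> last bs \<Longrightarrow> \<exists>k>0. bs = binary k"
proof (induction bs)
  case (Cons b bs)
  show ?case
  proof (cases "bs = []")
    case True
    then show ?thesis using Cons.prems by (intro exI[of _ 1]) (simp add: binary.simps[of "Suc 0"] binary.simps[of 0])
  next
    case False
    then obtain k where "k > 0" "bs = binary k" using Cons by auto
    then show ?thesis by (intro exI[of _ "2 * k + of_bool b"]) (simp add: binary.simps[of "2 * k + of_bool b"])
  qed
qed simp

lemma matrix_conv_map:
  "[(i, j) \<in> A. i \<leftarrow> [0..<n], j \<leftarrow> [0..<m]] = map (\<lambda>p. (p div m, p mod m) \<in> A) [0..<n * m]"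
proof (induction n)
  case (Suc n)
  have "map (\<lambda>j. (n, j) \<in> A) [0..<m] = map (\<lambda>p. (p div m, p mod m) \<in> A) [n * m..<Suc n * m]"
    by (rule nth_equalityI) auto
  moreover have "[0..<Suc n * m] = [0..<n * m] @ [n * m..<Suc n * m]"
    using upt_add_eq_append[of 0 "n * m" m] by (simp add: add.commute)
  ultimately show ?case using Suc by simp
qed simp

text \<open>Bit \<open>p\<close> of the encoded instance in closed form; beyond the end it is False,
  since high digits of \<open>k\<close> vanish.\<close>

definition instance_bit :: "nat \<Rightarrow> nat rel \<Rightarrow> nat \<Rightarrow> nat \<Rightarrow> bool" where
  "instance_bit n E k p \<longleftrightarrow> (if p < n then True else if p = n then False
     else if p < n + 1 + n * n then ((p - n - 1) div n, (p - n - 1) mod n) \<in> E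
     else odd (k div 2 ^ (p - (n + 1 + n * n))))"

lemma encode_instance_conv_map:
  "encode_instance n G k = map (instance_bit n (parcs G) k) [0..<n + 1 + n * n + pow2_below (Suc k)]"
proof -
  let ?s = "pow2_below (Suc k)"
  have "[0..<n + 1 + n * n + ?s] = [0..<n] @ [n] @ map (\<lambda>i. i + (n + 1)) [0..<n * n] @ map (\<lambda>i. i + (n + 1 + n * n)) [0..<?s]"
  proof -
    have 1: "[0..<n + 1 + n * n + ?s] = [0..<n + 1 + n * n] @ [n + 1 + n * n..<n + 1 + n * n + ?s]"
      by (rule upt_add_eq_append) simp
    have 2: "[0..<n + 1 + n * n] = [0..<n + 1] @ [n + 1..<n + 1 + n * n]"
      by (rule upt_add_eq_append) simp
    have 3: "[n + 1..<n + 1 + n * n] = map (\<lambda>i. i + (n + 1)) [0..<n * n]"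
      "[n + 1 + n * n..<n + 1 + n * n + ?s] = map (\<lambda>i. i + (n + 1 + n * n)) [0..<?s]"
      unfolding map_add_upt by (simp_all only: add.commute add.left_commute)
    show ?thesis unfolding 1 2 3 by simp
  qed
  moreover have "map (instance_bit n (parcs G) k) [0..<n] = replicate n True"
    by (rule nth_equalityI) (auto simp: instance_bit_def)
  moreover have "map (instance_bit n (parcs G) k) (map (\<lambda>i. i + (n + 1)) [0..<n * n]) =
      map (\<lambda>p. (p div n, p mod n) \<in> parcs G) [0..<n * n]"
    by (rule nth_equalityI) (auto simp: instance_bit_def)
  moreover have "map (instance_bit n (parcs G) k) (map (\<lambda>i. i + (n + 1 + n * n)) [0..<?s]) = binary k"
    unfolding binary_conv_map by (rule nth_equalityI) (auto simp: instance_bit_def)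
  moreover have "map (instance_bit n (parcs G) k) [n] = [False]" by (simp add: instance_bit_def)
  ultimately show ?thesis
    unfolding encode_instance_def encode_graph_def matrix_conv_map by (simp only: map_append append_assoc)
qed

lemma polytime_encode_instance:
  assumes n: "dfn (\<lambda>x. x) [] n" and k: "dfn (\<lambda>x. x) [] k"
    and E: "dfp fst [snd] (\<lambda>s. ((snd s - n (fst s) - 1) div n (fst s), (snd s - n (fst s) - 1) mod n (fst s)) \<in> parcs (G (fst s)))"
  shows "polytime_computable (\<lambda>x. encode_instance (n x) (G x) (k x))"
proof -
  \<comment> \<open>The sum has the single summand \<open>2 ^ j\<close> for the digit position
    \<open>j\<close>, obtained by searching for the power of two whose logarithm is
    \<open>j\<close>.\<close>
  define b where "b x p \<longleftrightarrow> (if p < n x then True else if p = n x then False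
     else if p < n x + 1 + n x * n x then ((p - n x - 1) div n x, (p - n x - 1) mod n x) \<in> parcs (G x)
     else (k x div (\<Sum>z<Suc (k x). if pow2 z \<and> pow2_below z = p - (n x + 1 + n x * n x) then z else 0)) mod 2 = 1)" for x p
  define L where "L x = n x + 1 + n x * n x + pow2_below (Suc (k x))" for x
  have n': "dfn fst [snd] (\<lambda>s. n (fst s))" and k': "dfn fst [snd] (\<lambda>s. k (fst s))"
    using dfn_weaken[OF n] dfn_weaken[OF k] by simp_all
  have "dfn (\<lambda>x. x) [] L" unfolding L_def by (rule dfn_rules dfn_pow2_below n k)+
  moreover have "dfp fst [snd] (\<lambda>s. b (fst s) (snd s))"
    unfolding b_def
    by (rule dfn_rules dfn_pow2_below dfp_pow2 n' k' E dfn_weaken[OF n'] dfn_weaken[OF k'] | (rule dfn_var, simp))+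
  ultimately have "polytime_computable (\<lambda>x. map (b x) [0..<L x])" by (rule polytime_computable_dfn)
  moreover have "map (b x) [0..<L x] = encode_instance (n x) (G x) (k x)" for x
    unfolding encode_instance_conv_map L_def
  proof (rule map_cong)
    fix p assume p: "p \<in> set [0..<n x + 1 + n x * n x + pow2_below (Suc (k x))]"
    define j where "j = p - (n x + 1 + n x * n x)"
    have "(\<Sum>z<Suc (k x). if pow2 z \<and> pow2_below z = j then z else 0) = 2 ^ j" if "j < pow2_below (Suc (k x))"
      using sum_pow2_if[where P = "\<lambda>i. i = j" and g = "\<lambda>z. z" and l = "k x"] that
      by (simp del: sum.lessThan_Suc)
    then show "b x p = instance_bit (n x) (parcs (G x)) (k x) p"
      using p unfolding b_def instance_bit_def j_def[symmetric]
      by (auto simp: odd_iff_mod_2_eq_one j_def)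
  qed simp
  ultimately show ?thesis by simp
qed

context np_verifier
begin

definition "reduction x = encode_instance (3 * num_vars x + 2 + num_clauses x)
  (sat_graph (num_vars x) (num_clauses x) (in_clause snd x) (in_clause fst x)) (num_vars x + 2)"

lemma dfp_conflict:
  assumes "dfn X \<Gamma> u" "dfn X \<Gamma> v"
  shows "dfp X \<Gamma> (\<lambda>s. conflict (num_vars (X s)) (num_clauses (X s)) (in_clause snd (X s)) (in_clause fst (X s)) (u s) (v s))"
  unfolding conflict_def
  by (rule dfn_rules dfn_sizes(6) dfn_num_clauses dfp_in_clause[OF disjI1[OF refl]] dfp_in_clause[OF disjI2[OF refl]] assms dfn_weaken | (rule dfn_var, simp))+

lemma polytime_reduction: "polytime_computable reduction"
  unfolding reduction_def
proof (rule polytime_encode_instance)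
  show "dfp fst [snd] (\<lambda>s. ((snd s - (3 * num_vars (fst s) + 2 + num_clauses (fst s)) - 1) div
      (3 * num_vars (fst s) + 2 + num_clauses (fst s)),
      (snd s - (3 * num_vars (fst s) + 2 + num_clauses (fst s)) - 1) mod (3 * num_vars (fst s) + 2 + num_clauses (fst s)))
      \<in> parcs (sat_graph (num_vars (fst s)) (num_clauses (fst s)) (in_clause snd (fst s)) (in_clause fst (fst s))))"
    unfolding sat_graph_def pair_pre_digraph.simps mem_Collect_eq case_prod_conv sat_adj_def
    by (rule dfn_rules dfn_sizes(6) dfn_num_clauses dfp_conflict | (rule dfn_var, simp))+
qed (rule dfn_rules dfn_sizes(6) dfn_num_clauses)+

end

definition borsuk_language :: language where
  "borsuk_language = {encode_instance n G k | n G k.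
    pair_graph G \<and> pverts G = {..<n} \<and> connected (with_proj G) \<and> k > 0 \<and> borsuk_number G < enat k}"

lemma (in np_verifier) reducible_borsuk: "polytime_reducible K borsuk_language"
proof -
  have "x \<in> K \<longleftrightarrow> reduction x \<in> borsuk_language" for x
  proof -
    let ?n = "num_vars x" and ?m = "num_clauses x"
    let ?G = "sat_graph ?n ?m (in_clause snd x) (in_clause fst x)"
    have G: "pair_graph ?G" "pverts ?G = {..<3 * ?n + 2 + ?m}" "connected (with_proj ?G)"
      by (rule pair_graph_sat_graph, simp add: sat_graph_def, rule connected_sat_graph)
    have "reduction x \<in> borsuk_language \<longleftrightarrow> borsuk_number ?G < enat (?n + 2)"
    proof
      assume "reduction x \<in> borsuk_language"
      then obtain n G k where e: "reduction x = encode_instance n G k" "pair_graph G" "pverts G = {..<n}"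
          "borsuk_number G < enat k"
        unfolding borsuk_language_def by blast
      \<comment> \<open>The encoding is injective, so the instance witnessing membership is the
        constructed one.\<close>
      then have "?G = G \<and> ?n + 2 = k"
        using encode_instance_inject[of "3 * ?n + 2 + ?m" ?G "?n + 2" n G k] G by (simp add: reduction_def)
      then show "borsuk_number ?G < enat (?n + 2)" using e by simp
    next
      assume "borsuk_number ?G < enat (?n + 2)"
      with G show "reduction x \<in> borsuk_language"
        unfolding borsuk_language_def reduction_def by (intro CollectI exI conjI refl) auto
    qed
    then show ?thesis using K_iff_clauses borsuk_sat_graph_iff[OF num_vars_pos] by simp
  qed
  then show ?thesis unfolding polytime_reducible_def using polytime_reduction by blast
qed

lemma NP_hard_borsuk: "NP_hard borsuk_language"
  unfolding NP_hard_def
proof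
  fix K assume "K \<in> NP"
  then obtain A p where A: "polytime_decidable A"
    "\<And>x. x \<in> K \<longleftrightarrow> (\<exists>y. length y \<le> poly p (length x) \<and> string_pair x y \<in> A)"
    unfolding NP_def by blast
  from A(1) obtain M q where "turing_machine M" "computes_in_time M (\<lambda>x. [x \<in> A]) (poly q)"
    unfolding polytime_decidable_def polytime_computable_def by blast
  then interpret np_verifier M q p A K by unfold_locales (use A(2) in auto)
  show "polytime_reducible K borsuk_language" by (rule reducible_borsuk)
qed

section \<open>Verifying Borsuk partitions\<close>

text \<open>
  The certificate consists of three tables: the colours and the distances from a vertex \<open>u\<close>, both as
  numbers in unary, and the bits that tell whether a monochromatic walk of length at most \<open>i\<close> leads
  from \<open>a\<close> to \<open>b\<close>.
\<close>

definition cert_colour :: "nat \<Rightarrow> (nat \<Rightarrow> bool) \<Rightarrow> nat \<Rightarrow> nat" where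
  "cert_colour n Y a = (\<Sum>i<n. of_bool (Y (a * n + i)))"

definition cert_dist :: "nat \<Rightarrow> (nat \<Rightarrow> bool) \<Rightarrow> nat \<Rightarrow> nat" where
  "cert_dist n Y a = (\<Sum>i<n * n. of_bool (Y (n * n + a * (n * n) + i)))"

definition cert_walk :: "nat \<Rightarrow> (nat \<Rightarrow> bool) \<Rightarrow> nat \<Rightarrow> nat \<Rightarrow> nat \<Rightarrow> bool" where
  "cert_walk n Y a b i \<longleftrightarrow> Y (n * n + n * (n * n) + (a * n + b) * (n * n) + i)"

definition adj_bit :: "nat \<Rightarrow> (nat \<Rightarrow> bool) \<Rightarrow> nat \<Rightarrow> nat \<Rightarrow> bool" where
  "adj_bit n X i j \<longleftrightarrow> X (n + 1 + (i * n + j))"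

text \<open>Decides whether \<open>l\<close> is below the number with the bits \<open>b\<close>
  without forming that number, which may be exponentially large. A set bit \<open>j\<close> with
  \<open>l < 2 ^ j\<close> settles the question; otherwise the number is a sum of powers of two that
  are at most \<open>l\<close>.\<close>

definition less_binary :: "nat \<Rightarrow> (nat \<Rightarrow> bool) \<Rightarrow> nat \<Rightarrow> bool" where
  "less_binary J b l \<longleftrightarrow> (\<exists>j<J. b j \<and> pow2_below (Suc l) \<le> j) \<or>
     l < (\<Sum>z<Suc l. if pow2 z \<and> b (pow2_below z) then z else 0)"

text \<open>The conditions on \<open>N\<close> say that the binary part is nonempty and ends in
  True, that is, encodes a positive number. Connectedness is left to
  \<open>valid_dist\<close>.\<close>

definition valid_instance :: "nat \<Rightarrow> (nat \<Rightarrow> bool) \<Rightarrow> nat \<Rightarrow> bool" where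
  "valid_instance N X n \<longleftrightarrow> 1 \<le> n \<and> (\<forall>i<n. X i) \<and> \<not> X n \<and> n + 1 + n * n < N \<and> X (N - 1) \<and>
     (\<forall>i<n. \<not> adj_bit n X i i) \<and> (\<forall>i<n. \<forall>j<n. adj_bit n X i j \<longrightarrow> adj_bit n X j i)"

text \<open>The values form a potential that need not be the exact distance. Descending neighbours
  show that every vertex reaches \<open>u\<close>; growth by at most one along edges makes each
  value a lower bound for the distance from \<open>u\<close>.\<close>

definition valid_dist :: "nat \<Rightarrow> (nat \<Rightarrow> bool) \<Rightarrow> (nat \<Rightarrow> bool) \<Rightarrow> nat \<Rightarrow> nat \<Rightarrow> bool" where
  "valid_dist n X Y u d \<longleftrightarrow> cert_dist n Y u = 0 \<and>
     (\<forall>v<n. v \<noteq> u \<longrightarrow> (\<exists>w<n. adj_bit n X v w \<and> cert_dist n Y w < cert_dist n Y v)) \<and>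
     (\<forall>a<n. \<forall>b<n. adj_bit n X a b \<longrightarrow> cert_dist n Y b \<le> cert_dist n Y a + 1) \<and>
     (\<exists>v<n. d < cert_dist n Y v)"

text \<open>Each positive entry is justified by an entry of the next smaller index after one
  monochromatic edge or after standing still at \<open>a\<close>; standing still is what turns
  length exactly \<open>i\<close> into length at most \<open>i\<close>.\<close>

definition valid_walks :: "nat \<Rightarrow> (nat \<Rightarrow> bool) \<Rightarrow> (nat \<Rightarrow> bool) \<Rightarrow> nat \<Rightarrow> bool" where
  "valid_walks n X Y d \<longleftrightarrow>
     (\<forall>a<n. \<forall>b<n. cert_colour n Y a = cert_colour n Y b \<longrightarrow> cert_walk n Y a b d) \<and>
     (\<forall>a<n. \<forall>b<n. \<forall>i<n * n. cert_walk n Y a b i \<longrightarrow> i = 0 \<and> a = b \<or>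
        0 < i \<and> (\<exists>c<n. cert_colour n Y c = cert_colour n Y a \<and> (c = a \<or> adj_bit n X a c) \<and> cert_walk n Y c b (i - 1)))"

text \<open>No more than \<open>n\<close> colours occur, so \<open>l\<close> can be searched up to
  \<open>n\<close>; \<open>d\<close> is below some distance, hence below
  \<open>n * n\<close>.\<close>

definition borsuk_check :: "nat \<Rightarrow> (nat \<Rightarrow> bool) \<Rightarrow> (nat \<Rightarrow> bool) \<Rightarrow> bool" where
  "borsuk_check N X Y \<longleftrightarrow> (\<exists>n<N. valid_instance N X n \<and>
     (\<exists>d<n * n. (\<exists>u<n. valid_dist n X Y u d) \<and> valid_walks n X Y d) \<and>
     (\<exists>l<Suc n. (\<forall>a<n. cert_colour n Y a < l) \<and> less_binary N (\<lambda>j. X (n + 1 + n * n + j)) l))"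

definition pair_check :: "bool list \<Rightarrow> bool" where
  "pair_check w \<longleftrightarrow> (\<exists>m<length w. (\<forall>i<m. bit_at w (2 * i) \<longleftrightarrow> bit_at w (2 * i + 1)) \<and>
     \<not> bit_at w (2 * m) \<and> bit_at w (2 * m + 1) \<and>
     borsuk_check m (\<lambda>i. i < m \<and> bit_at w (2 * i)) (\<lambda>i. bit_at w (2 * m + 2 + i)))"

lemma dfp_pair_check: "dfp (\<lambda>x. x) [] pair_check"
  unfolding pair_check_def borsuk_check_def valid_walks_def valid_dist_def valid_instance_def less_binary_def
    adj_bit_def cert_walk_def cert_dist_def cert_colour_def
  by (rule dfn_rules dfn_pow2_below dfp_pow2 dfn_weaken | (rule dfn_var, simp))+

lemma pair_check_string_pair:
  "pair_check (string_pair x y) \<longleftrightarrow> borsuk_check (length x) (bit_at x) (bit_at y)"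
proof -
  let ?w = "string_pair x y"
  have x: "bit_at ?w (2 * i) \<longleftrightarrow> bit_at x i" "bit_at ?w (2 * i + 1) \<longleftrightarrow> bit_at x i" if "i < length x" for i
    using that nth_string_pair(1)[of "2 * i" x y] nth_string_pair(1)[of "2 * i + 1" x y]
    by (auto simp: bit_at_def length_string_pair)
  have s: "\<not> bit_at ?w (2 * length x)" "bit_at ?w (2 * length x + 1)"
    using nth_string_pair(2,3)[of x y] by (auto simp: bit_at_def length_string_pair)
  have y: "(\<lambda>i. bit_at ?w (2 * length x + 2 + i)) = bit_at y"
    using nth_string_pair(4)[of x y] by (auto simp: bit_at_def length_string_pair fun_eq_iff)
  have X: "(\<lambda>i. i < length x \<and> bit_at ?w (2 * i)) = bit_at x"
    using x(1) by (auto simp: fun_eq_iff bit_at_def)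
  \<comment> \<open>Pairs before the separator consist of equal bits and the separator is 01, so the
    first unequal pair determines \<open>m\<close>.\<close>
  have m: "m = length x" if "\<forall>i<m. bit_at ?w (2 * i) \<longleftrightarrow> bit_at ?w (2 * i + 1)" "\<not> bit_at ?w (2 * m)" "bit_at ?w (2 * m + 1)" for m
    using that s x[of m] by (metis nat_neq_iff)
  show ?thesis
  proof
    assume "pair_check ?w"
    then obtain m where "\<forall>i<m. bit_at ?w (2 * i) \<longleftrightarrow> bit_at ?w (2 * i + 1)" "\<not> bit_at ?w (2 * m)" "bit_at ?w (2 * m + 1)"
      and bc: "borsuk_check m (\<lambda>i. i < m \<and> bit_at ?w (2 * i)) (\<lambda>i. bit_at ?w (2 * m + 2 + i))"
      unfolding pair_check_def by blast
    from m[OF this(1-3)] show "borsuk_check (length x) (bit_at x) (bit_at y)" using bc X y by simp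
  next
    assume "borsuk_check (length x) (bit_at x) (bit_at y)"
    then have "borsuk_check (length x) (\<lambda>i. i < length x \<and> bit_at ?w (2 * i)) (\<lambda>i. bit_at ?w (2 * length x + 2 + i))"
      unfolding X y .
    moreover have "length x < length ?w" by (simp add: length_string_pair)
    moreover have "\<forall>i<length x. bit_at ?w (2 * i) \<longleftrightarrow> bit_at ?w (2 * i + 1)" using x by simp
    ultimately show "pair_check ?w" unfolding pair_check_def using s by blast
  qed
qed

section \<open>Soundness and completeness of the certificates\<close>

lemma bit_at_encode_instance: "bit_at (encode_instance n G k) p \<longleftrightarrow> instance_bit n (parcs G) k p"
proof (cases "p < n + 1 + n * n + pow2_below (Suc k)")
  case True
  then show ?thesis unfolding encode_instance_conv_map bit_at_def by (simp del: upt_Suc)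
next
  case False
  then have "\<not> p - (n + 1 + n * n) < pow2_below (Suc k)" by linarith
  then have "k < 2 ^ (p - (n + 1 + n * n))" by (simp add: pow2_below_Suc_less_iff)
  then have "k div 2 ^ (p - (n + 1 + n * n)) = 0" by simp
  then show ?thesis using False unfolding encode_instance_conv_map bit_at_def instance_bit_def by auto
qed

lemma length_encode_instance: "length (encode_instance n G k) = n + 1 + n * n + pow2_below (Suc k)"
  by (simp add: encode_instance_conv_map)

lemma instance_bit_simps:
  "p < n \<Longrightarrow> instance_bit n E k p" "\<not> instance_bit n E k n"
  "i < n \<Longrightarrow> j < n \<Longrightarrow> instance_bit n E k (n + 1 + (i * n + j)) \<longleftrightarrow> (i, j) \<in> E"
  "instance_bit n E k (n + 1 + n * n + j) \<longleftrightarrow> odd (k div 2 ^ j)"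
proof -
  show "p < n \<Longrightarrow> instance_bit n E k p" "\<not> instance_bit n E k n"
    "instance_bit n E k (n + 1 + n * n + j) \<longleftrightarrow> odd (k div 2 ^ j)" by (auto simp: instance_bit_def)
  assume ij: "i < n" "j < n"
  have "i * n + j < n * n" using ij mult_le_mono1[of "Suc i" n n] by (simp add: Suc_le_eq)
  then show "instance_bit n E k (n + 1 + (i * n + j)) \<longleftrightarrow> (i, j) \<in> E"
    using ij mixed_radix[of j n i] by (simp add: instance_bit_def)
qed

text \<open>A set bit \<open>j\<close> gives \<open>2 ^ j \<le> k\<close>, so a high one forces
  \<open>l < k\<close>; without high bits, \<open>k\<close> equals its truncation to the digits
  summed in \<open>less_binary\<close>.\<close>

lemma less_binary_iff:
  assumes b: "\<And>j. b j \<longleftrightarrow> odd (k div 2 ^ j)" and J: "\<And>j. b j \<Longrightarrow> j < J"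
  shows "less_binary J b l \<longleftrightarrow> l < k"
proof (cases "\<exists>j. b j \<and> pow2_below (Suc l) \<le> j")
  case True
  then obtain j where j: "b j" "pow2_below (Suc l) \<le> j" by blast
  then have "\<not> 2 ^ j \<le> l" using pow2_below_Suc_less_iff[of j l] by simp
  moreover have "2 ^ j \<le> k"
  proof (rule ccontr)
    assume "\<not> 2 ^ j \<le> k"
    then have "k div 2 ^ j = 0" by simp
    then show False using j(1) b by simp
  qed
  ultimately show ?thesis using True J unfolding less_binary_def by auto
next
  case False
  let ?q = "pow2_below (Suc l)"
  have bk: "b j \<longleftrightarrow> bit k j" for j using b by (simp add: bit_iff_odd)
  have "take_bit ?q k = k"
    using False by (intro bit_eqI) (auto simp: bit_take_bit_iff bk not_le)
  moreover have "take_bit ?q k = (\<Sum>j<?q. if b j then 2 ^ j else 0)"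
    unfolding take_bit_sum atLeast0LessThan
    by (rule sum.cong) (auto simp: bk push_bit_eq_mult)
  ultimately have "(\<Sum>z<Suc l. if pow2 z \<and> b (pow2_below z) then z else 0) = k"
    using sum_pow2_if[where P = b and g = "\<lambda>z. z" and l = l] by (simp del: sum.lessThan_Suc)
  then show ?thesis using False unfolding less_binary_def by auto
qed

lemma check_sound:
  assumes "borsuk_check (length x) (bit_at x) Y"
  shows "x \<in> borsuk_language"
proof -
  let ?X = "bit_at x"
  from assms obtain n d u l where vi: "valid_instance (length x) ?X n" and d: "d < n * n"
    and u: "u < n" "valid_dist n ?X Y u d" and vw: "valid_walks n ?X Y d"
    and l: "\<forall>a<n. cert_colour n Y a < l" "less_binary (length x) (\<lambda>j. ?X (n + 1 + n * n + j)) l"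
    unfolding borsuk_check_def by blast
  define E where "E = {(i, j). i < n \<and> j < n \<and> adj_bit n ?X i j}"
  define G where "G = \<lparr>pverts = {..<n}, parcs = E\<rparr>"
  define bs where "bs = drop (n + 1 + n * n) x"
  have n: "1 \<le> n" "\<And>i. i < n \<Longrightarrow> ?X i" "\<not> ?X n" "n + 1 + n * n < length x" "?X (length x - 1)"
    "\<And>i. i < n \<Longrightarrow> \<not> adj_bit n ?X i i" "\<And>i j. i < n \<Longrightarrow> j < n \<Longrightarrow> adj_bit n ?X i j \<Longrightarrow> adj_bit n ?X j i"
    using vi unfolding valid_instance_def by blast+
  have ne: "bs \<noteq> []" using n(4) by (simp add: bs_def)
  have "last bs = last x" unfolding bs_def using n(4) by (rule last_drop)
  also have "\<dots> = x ! (length x - 1)" using n(4) by (intro last_conv_nth) auto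
  finally have "last bs = x ! (length x - 1)" .
  then have "last bs" using n(5) by (simp add: bit_at_def)
  then obtain k where k: "k > 0" "bs = binary k" using binary_surj[OF ne] by blast
  have len: "length x = n + 1 + n * n + pow2_below (Suc k)"
    using arg_cong[OF k(2), of length] n(4) by (simp add: bs_def binary_conv_map)
  have x: "x = encode_instance n G k"
  proof (rule nth_equalityI)
    show "length x = length (encode_instance n G k)" using len by (simp add: length_encode_instance)
    fix p assume p: "p < length x"
    have "x ! p \<longleftrightarrow> instance_bit n E k p"
    proof -
      consider "p < n" | "p = n" | "n < p" "p < n + 1 + n * n" | "n + 1 + n * n \<le> p" by linarith
      then show ?thesis
      proof cases
        case 1
        then show ?thesis using n(2)[of p] by (simp add: bit_at_def instance_bit_def)
      next
        case 2
        then show ?thesis using n(3) p by (simp add: bit_at_def instance_bit_def)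
      next
        case 3
        let ?q = "p - n - 1"
        have q: "?q div n < n" "?q mod n < n" using 3 n(1) by (auto simp: div_less_iff_less_mult)
        have "n + 1 + (?q div n * n + ?q mod n) = p" using 3 by simp
        then have "(?q div n, ?q mod n) \<in> E \<longleftrightarrow> x ! p" using q p by (simp add: E_def adj_bit_def bit_at_def)
        then show ?thesis using 3 by (simp add: instance_bit_def)
      next
        case 4
        then obtain j where j: "p = n + 1 + n * n + j" using le_Suc_ex by blast
        then have "x ! p = bs ! j" using n(4) by (simp add: bs_def)
        also have "\<dots> \<longleftrightarrow> odd (k div 2 ^ j)" using j p len unfolding k(2) binary_conv_map by simp
        finally show ?thesis unfolding j instance_bit_simps(4) .
      qed
    qed
    then show "x ! p = encode_instance n G k ! p"
      using p len bit_at_encode_instance[of n G k p] by (simp add: bit_at_def length_encode_instance G_def)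
  qed
  have symE: "sym E" using n(7) by (auto simp: E_def sym_def)
  have G: "pair_graph G"
  proof -
    have "finite E" by (rule finite_subset[of _ "{..<n} \<times> {..<n}"]) (auto simp: E_def)
    then show ?thesis
      using symE n(6) by unfold_locales (auto simp: G_def E_def symmetric_def)
  qed
  have ud: "cert_dist n Y u = 0" "\<And>v. v < n \<Longrightarrow> v \<noteq> u \<Longrightarrow> \<exists>w<n. adj_bit n ?X v w \<and> cert_dist n Y w < cert_dist n Y v"
    "\<And>a b. (a, b) \<in> E \<Longrightarrow> cert_dist n Y b \<le> cert_dist n Y a + 1" "\<exists>v<n. d < cert_dist n Y v"
    using u(2) unfolding valid_dist_def E_def by blast+
  \<comment> \<open>Passing to neighbours of ever smaller value must end at \<open>u\<close>, since
    every other vertex has such a neighbour.\<close>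
  have reach: "(v, u) \<in> E\<^sup>*" if "v < n" for v
    using that
  proof (induction "cert_dist n Y v" arbitrary: v rule: less_induct)
    case less
    show ?case
    proof (cases "v = u")
      case False
      then obtain w where w: "w < n" "adj_bit n ?X v w" "cert_dist n Y w < cert_dist n Y v"
        using ud(2) less.prems by blast
      then have "(v, w) \<in> E" using less.prems by (simp add: E_def)
      then show ?thesis using less.hyps[OF w(3,1)] by (rule converse_rtrancl_into_rtrancl)
    qed simp
  qed
  have conn: "connected (with_proj G)"
    unfolding connected_iff_rtrancl[OF G]
    using reach sym_rtrancl[OF symE] n(1) by (auto simp: G_def lessThan_empty_iff) (metis rtrancl_trans symD)
  let ?c = "cert_colour n Y"
  have far: "cert_dist n Y v \<le> cert_dist n Y u + i" if "(u, v) \<in> E ^^ i" for v i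
    using that
  proof (induction i arbitrary: v)
    case (Suc i)
    then obtain w where "(u, w) \<in> E ^^ i" "(w, v) \<in> E" by auto
    then show ?case using Suc.IH[of w] ud(3)[of w v] by linarith
  qed simp
  have vw2: "i = 0 \<and> a = b \<or>
      0 < i \<and> (\<exists>c<n. ?c c = ?c a \<and> (c = a \<or> adj_bit n ?X a c) \<and> cert_walk n Y c b (i - 1))"
    if "a < n" "b < n" "i < n * n" "cert_walk n Y a b i" for a b i
    using vw that unfolding valid_walks_def by blast
  have walk: "\<exists>i'\<le>i. (a, b) \<in> {(u, v) \<in> E. ?c u = ?c v} ^^ i'"
    if "a < n" "b < n" "i < n * n" "cert_walk n Y a b i" for a b i
    using that
  proof (induction i arbitrary: a)
    case 0
    then have "a = b" using vw2[of a b 0] by simp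
    then show ?case by simp
  next
    case (Suc i)
    then obtain c where c: "c < n" "?c c = ?c a" "c = a \<or> adj_bit n ?X a c" "cert_walk n Y c b i"
      using vw2[of a b "Suc i"] by auto
    obtain i' where i': "i' \<le> i" "(c, b) \<in> {(u, v) \<in> E. ?c u = ?c v} ^^ i'"
      using Suc.IH[OF c(1) Suc.prems(2) _ c(4)] Suc.prems(3) by auto
    show ?case
    proof (cases "c = a")
      case True
      then show ?thesis using i' le_SucI by blast
    next
      case False
      then have "(a, c) \<in> {(u, v) \<in> E. ?c u = ?c v}" using c Suc.prems by (auto simp: E_def)
      then have "(a, b) \<in> {(u, v) \<in> E. ?c u = ?c v} ^^ Suc i'" using i'(2) by (rule relpow_Suc_I2)
      then show ?thesis using i'(1) by (meson Suc_le_mono)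
    qed
  qed
  have "borsuk_colouring {..<n} E ?c d"
    unfolding borsuk_colouring_def
  proof (intro conjI ballI impI)
    fix a b assume ab: "a \<in> {..<n}" "b \<in> {..<n}" "?c a = ?c b"
    then have "cert_walk n Y a b d" using vw unfolding valid_walks_def by blast
    then show "\<exists>i\<le>d. (a, b) \<in> {(u, v) \<in> E. ?c u = ?c v} ^^ i" using walk ab d by blast
  next
    obtain v where "v < n" "d < cert_dist n Y v" using ud(4) by blast
    then show "\<exists>u\<in>{..<n}. \<exists>v\<in>{..<n}. \<forall>i\<le>d. (u, v) \<notin> E ^^ i"
      using u(1) far ud(1) by (metis add_0 le_trans lessThan_iff not_le)
  qed
  moreover have "card (?c ` {..<n}) < k"
  proof -
    have "?c ` {..<n} \<subseteq> {..<l}" using l(1) by auto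
    then have "card (?c ` {..<n}) \<le> l" using card_mono[of "{..<l}"] by fastforce
    moreover have "l < k"
    proof -
      have bits: "bit_at x (n + 1 + n * n + j) \<longleftrightarrow> odd (k div 2 ^ j)" for j
        unfolding x bit_at_encode_instance instance_bit_simps(4) ..
      have "j < length x" if "bit_at x (n + 1 + n * n + j)" for j using that by (simp add: bit_at_def)
      from less_binary_iff[where b = "\<lambda>j. ?X (n + 1 + n * n + j)", OF bits this] l(2) show ?thesis by simp
    qed
    ultimately show ?thesis by simp
  qed
  ultimately have "borsuk_number G < enat k"
    using borsuk_number_less_iff[OF G, of k] n(1) by (auto simp: G_def lessThan_empty_iff)
  then show ?thesis unfolding borsuk_language_def using x G conn k(1)
    by (intro CollectI exI[of _ n] exI[of _ G] exI[of _ k]) (simp add: G_def)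
qed

lemma sum_of_bool_less: "c \<le> n \<Longrightarrow> (\<Sum>i<n. of_bool (i < c)) = (c :: nat)"
proof -
  assume "c \<le> n"
  then have "{i \<in> {..<n}. i < c} = {..<c}" by auto
  then show ?thesis using sum.inter_filter[of "{..<n}" "\<lambda>_. 1 :: nat" "\<lambda>i. i < c"] by (simp add: of_bool_def)
qed

lemma certificate:
  fixes c l :: "nat \<Rightarrow> nat" and W :: "nat \<Rightarrow> nat \<Rightarrow> nat \<Rightarrow> bool"
  assumes c: "\<And>a. a < n \<Longrightarrow> c a \<le> n" and l: "\<And>a. a < n \<Longrightarrow> l a \<le> n * n"
  obtains y where "length y = n * n + n * (n * n) + (n * n) * (n * n)"
    "\<And>a. a < n \<Longrightarrow> cert_colour n (bit_at y) a = c a" "\<And>a. a < n \<Longrightarrow> cert_dist n (bit_at y) a = l a"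
    "\<And>a b i. a < n \<Longrightarrow> b < n \<Longrightarrow> i < n * n \<Longrightarrow> cert_walk n (bit_at y) a b i \<longleftrightarrow> W a b i"
proof
  let ?N = "n * n"
  let ?L = "?N + n * ?N + ?N * ?N"
  define f where "f t \<longleftrightarrow> (if t < ?N then t mod n < c (t div n)
     else if t < ?N + n * ?N then (t - ?N) mod ?N < l ((t - ?N) div ?N)
     else W ((t - (?N + n * ?N)) div ?N div n) ((t - (?N + n * ?N)) div ?N mod n) ((t - (?N + n * ?N)) mod ?N))" for t
  define y where "y = map f [0..<?L]"
  show "length y = ?L" by (simp add: y_def)
  have y: "bit_at y t \<longleftrightarrow> f t" if "t < ?L" for t using that by (simp add: y_def bit_at_def)
  have less: "a * m + i < k * m" if "a < k" "i < m" for a i k m :: nat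
    using that mult_le_mono1[of "Suc a" k m] by (simp add: Suc_le_eq)
  fix a assume a: "a < n"
  have "bit_at y (a * n + i) \<longleftrightarrow> i < c a" if "i < n" for i
  proof -
    have t: "a * n + i < ?N" using less a that by blast
    then have "a * n + i < ?L" by linarith
    then show ?thesis using t that mixed_radix[of i n a] by (simp add: y f_def)
  qed
  then have "cert_colour n (bit_at y) a = (\<Sum>i<n. of_bool (i < c a))" unfolding cert_colour_def by simp
  then show "cert_colour n (bit_at y) a = c a" using sum_of_bool_less[OF c[OF a]] by simp
  have "bit_at y (?N + a * ?N + i) \<longleftrightarrow> i < l a" if "i < ?N" for i
  proof -
    have t: "a * ?N + i < n * ?N" using less a that by blast
    then have "?N + a * ?N + i < ?L" by linarith
    then show ?thesis using t that mixed_radix[of i ?N a] by (simp add: y f_def)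
  qed
  then have "cert_dist n (bit_at y) a = (\<Sum>i<?N. of_bool (i < l a))" unfolding cert_dist_def by simp
  then show "cert_dist n (bit_at y) a = l a" using sum_of_bool_less[OF l[OF a]] by simp
  fix b i assume b: "b < n" "i < ?N"
  have t: "a * n + b < ?N" using less a b by blast
  then have "(a * n + b) * ?N + i < ?N * ?N" using less b by blast
  then have "?N + n * ?N + (a * n + b) * ?N + i < ?L" by linarith
  then show "cert_walk n (bit_at y) a b i \<longleftrightarrow> W a b i"
    using b mixed_radix[of i ?N "a * n + b"] mixed_radix[of b n a] by (simp add: cert_walk_def y f_def)
qed

lemma check_complete:
  assumes "x \<in> borsuk_language"
  shows "\<exists>y. length y \<le> 3 * length x ^ 4 \<and> borsuk_check (length x) (bit_at x) (bit_at y)"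
proof -
  from assms obtain n G k where x: "x = encode_instance n G k" and G: "pair_graph G" "pverts G = {..<n}"
    and conn: "connected (with_proj G)" and k: "k > 0" and b: "borsuk_number G < enat k"
    unfolding borsuk_language_def by blast
  interpret pair_graph G by (rule G(1))
  define E where "E = parcs G"
  let ?X = "bit_at x"
  have symE: "sym E" using pair_sym_arcs by (simp add: E_def symmetric_def)
  have EV: "a < n" "b < n" if "(a, b) \<in> E" for a b
    using that in_arcsD1 in_arcsD2 G(2) by (auto simp: E_def)
  have irrefl: "(a, a) \<notin> E" for a using pair_no_loops[of "(a, a)"] by (auto simp: E_def)
  have ne: "pverts G \<noteq> {}" and reach: "\<And>u v. u < n \<Longrightarrow> v < n \<Longrightarrow> (u, v) \<in> E\<^sup>*"
    using conn unfolding connected_iff_rtrancl[OF G(1)] E_def G(2) by auto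
  have n: "1 \<le> n" using ne G(2) by (cases n) auto
  from b obtain c0 d where c0: "card (c0 ` {..<n}) < k" "borsuk_colouring {..<n} E c0 d"
    using borsuk_number_less_iff[OF G(1) ne, of k] unfolding G(2) E_def by blast
  define l where "l = card (c0 ` {..<n})"
  \<comment> \<open>The colours are renumbered to lie below \<open>l\<close>, so that they fit into
    the unary table.\<close>
  obtain h where h: "bij_betw h (c0 ` {..<n}) {0..<l}"
    using ex_bij_betw_finite_nat[of "c0 ` {..<n}"] by (auto simp: l_def)
  define c where "c a = h (c0 a)" for a
  have ceq: "c a = c b \<longleftrightarrow> c0 a = c0 b" if "a < n" "b < n" for a b
    using bij_betw_imp_inj_on[OF h] that by (auto simp: c_def inj_on_def)
  have cl: "c a < l" if "a < n" for a using bij_betwE[OF h] that by (auto simp: c_def)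
  have ln: "l \<le> n" using card_image_le[of "{..<n}" c0] by (simp add: l_def)
  obtain u v where uv: "u < n" "v < n" "\<And>i. i \<le> d \<Longrightarrow> (u, v) \<notin> E ^^ i"
    using c0(2) unfolding borsuk_colouring_def by auto
  define dist where "dist w = (LEAST i. (u, w) \<in> E ^^ i)" for w
  have finE: "finite E" "card E \<le> n * n"
  proof -
    have "E \<subseteq> {..<n} \<times> {..<n}" using EV by auto
    then show "finite E" "card E \<le> n * n"
      using card_mono[of "{..<n} \<times> {..<n}" E] finite_subset[of E "{..<n} \<times> {..<n}"] by auto
  qed
  have dist: "(u, w) \<in> E ^^ dist w" "dist w \<le> n * n" if "w < n" for w
  proof -
    have "(u, w) \<in> E\<^sup>*" using reach uv(1) that by blast
    \<comment> \<open>Reachability in a finite relation takes at most as many steps as it has pairs;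
      this is the origin of the width \<open>n * n\<close> of the tables.\<close>
    then obtain i where i: "i \<le> card E" "(u, w) \<in> E ^^ i"
      unfolding rtrancl_finite_eq_relpow[OF finE(1)] by auto
    show "(u, w) \<in> E ^^ dist w" unfolding dist_def using i(2) by (rule LeastI)
    have "dist w \<le> i" unfolding dist_def using i(2) by (rule Least_le)
    then show "dist w \<le> n * n" using i(1) finE(2) by linarith
  qed
  have dist_le: "dist w \<le> i" if "(u, w) \<in> E ^^ i" for w i unfolding dist_def using that by (rule Least_le)
  let ?M = "{(u, v) \<in> E. c0 u = c0 v}"
  define W where "W a b i \<longleftrightarrow> (\<exists>i'\<le>i. (a, b) \<in> ?M ^^ i')" for a b i
  have cn: "c a \<le> n" if "a < n" for a using cl[OF that] ln by linarith
  obtain y where y: "length y = n * n + n * (n * n) + (n * n) * (n * n)"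
    "\<And>a. a < n \<Longrightarrow> cert_colour n (bit_at y) a = c a" "\<And>a. a < n \<Longrightarrow> cert_dist n (bit_at y) a = dist a"
    "\<And>a b i. a < n \<Longrightarrow> b < n \<Longrightarrow> i < n * n \<Longrightarrow> cert_walk n (bit_at y) a b i \<longleftrightarrow> W a b i"
    by (rule certificate[of n c dist W, OF cn dist(2)]) blast+
  have adj: "adj_bit n ?X i j \<longleftrightarrow> (i, j) \<in> E" if "i < n" "j < n" for i j
    unfolding adj_bit_def x bit_at_encode_instance instance_bit_simps(3)[OF that] E_def ..
  have "2 ^ 0 \<le> k" using k by simp
  then have "0 < pow2_below (Suc k)" unfolding pow2_below_Suc_less_iff .
  then have len: "length x = n + 1 + n * n + pow2_below (Suc k)" "n + 1 + n * n < length x" "n < length x"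
    by (simp_all add: x length_encode_instance)
  have vi: "valid_instance (length x) ?X n"
  proof -
    have "?X (length x - 1)"
    proof -
      define j where "j = pow2_below (Suc k) - 1"
      have j: "length x - 1 = n + 1 + n * n + j" using len \<open>0 < pow2_below (Suc k)\<close> by (simp add: j_def)
      \<comment> \<open>\<open>j\<close> is the position of the leading digit of
        \<open>k\<close>.\<close>
      have "2 ^ j \<le> k" "\<not> 2 ^ Suc j \<le> k"
        using \<open>0 < pow2_below (Suc k)\<close> by (auto simp: j_def pow2_below_Suc_less_iff[symmetric] simp del: power_Suc)
      then have "k div 2 ^ j = 1" by (intro div_nat_eqI) auto
      then show ?thesis unfolding j unfolding x bit_at_encode_instance instance_bit_simps(4) by simp
    qed
    moreover have "?X i" if "i < n" for i unfolding x bit_at_encode_instance by (rule instance_bit_simps(1)[OF that])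
    moreover have "\<not> ?X n" unfolding x bit_at_encode_instance by (rule instance_bit_simps(2))
    ultimately show ?thesis
      using n len(2) adj irrefl symE unfolding valid_instance_def by (auto dest: symD)
  qed
  have d: "d < dist v" using uv(3) dist(1)[OF uv(2)] by (meson not_le)
  then have dn: "d < n * n" using dist(2)[OF uv(2)] by linarith
  have vd: "valid_dist n ?X (bit_at y) u d"
    unfolding valid_dist_def
  proof (intro conjI allI impI)
    have "dist u \<le> 0" by (rule dist_le) simp
    then show "cert_dist n (bit_at y) u = 0" using y(3)[OF uv(1)] by simp
  next
    fix w assume w: "w < n" "w \<noteq> u"
    then have "dist w \<noteq> 0" using dist(1)[OF w(1)] by (auto intro: ccontr)
    then obtain i where i: "dist w = Suc i" by (cases "dist w") auto
    then obtain z where z: "(u, z) \<in> E ^^ i" "(z, w) \<in> E" using dist(1)[OF w(1)] by auto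
    then have "z < n" "(w, z) \<in> E" "dist z < dist w" using EV symE dist_le[OF z(1)] i by (auto dest: symD)
    then show "\<exists>z<n. adj_bit n ?X w z \<and> cert_dist n (bit_at y) z < cert_dist n (bit_at y) w"
      using w y(3) adj by auto
  next
    fix a b assume ab: "a < n" "b < n" "adj_bit n ?X a b"
    then have "(u, b) \<in> E ^^ Suc (dist a)" using dist(1)[OF ab(1)] adj by auto
    then show "cert_dist n (bit_at y) b \<le> cert_dist n (bit_at y) a + 1" using dist_le ab y(3) by fastforce
  next
    show "\<exists>v<n. d < cert_dist n (bit_at y) v" using d uv(2) y(3) by auto
  qed
  have vw: "valid_walks n ?X (bit_at y) d"
    unfolding valid_walks_def
  proof (intro conjI allI impI)
    fix a b assume ab: "a < n" "b < n" "cert_colour n (bit_at y) a = cert_colour n (bit_at y) b"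
    then have "c0 a = c0 b" using y(2) ceq by simp
    then have "W a b d" using c0(2) ab unfolding borsuk_colouring_def W_def by blast
    then show "cert_walk n (bit_at y) a b d" using y(4) ab dn by simp
  next
    fix a b i assume ab: "a < n" "b < n" "i < n * n" "cert_walk n (bit_at y) a b i"
    then obtain i' where i': "i' \<le> i" "(a, b) \<in> ?M ^^ i'" using y(4) by (auto simp: W_def)
    let ?P = "\<lambda>c. cert_colour n (bit_at y) c = cert_colour n (bit_at y) a \<and> (c = a \<or> adj_bit n ?X a c) \<and> cert_walk n (bit_at y) c b (i - 1)"
    have "i = 0 \<and> a = b" if "i = 0" using i' that by simp
    moreover have "\<exists>c<n. ?P c" if "0 < i"
    proof (cases i')
      case 0
      \<comment> \<open>The walk is already complete, so the step is spent standing still at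
        \<open>a\<close>.\<close>
      then have "(a, b) \<in> ?M ^^ 0" using i' by simp
      then have "W a b (i - 1)" unfolding W_def by blast
      then have "?P a" using y(4) ab by simp
      then show ?thesis using ab(1) by blast
    next
      case (Suc i'')
      then have "(a, b) \<in> ?M ^^ Suc i''" using i'(2) by simp
      then obtain z where z: "(a, z) \<in> ?M" "(z, b) \<in> ?M ^^ i''" by (meson relpow_Suc_D2)
      then have "z < n" using EV by auto
      moreover have "W z b (i - 1)" unfolding W_def using z(2) i'(1) Suc by (intro exI[of _ i'']) simp
      ultimately have "?P z" using z(1) y(2,4) ab ceq adj by auto
      then show ?thesis using \<open>z < n\<close> by blast
    qed
    ultimately show "i = 0 \<and> a = b \<or> 0 < i \<and> (\<exists>c<n. ?P c)" by blast
  qed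
  have lb: "less_binary (length x) (\<lambda>j. ?X (n + 1 + n * n + j)) l"
  proof -
    have bits: "?X (n + 1 + n * n + j) \<longleftrightarrow> odd (k div 2 ^ j)" for j
      unfolding x bit_at_encode_instance instance_bit_simps(4) ..
    have "j < length x" if "?X (n + 1 + n * n + j)" for j using that by (simp add: bit_at_def)
    from less_binary_iff[where b = "\<lambda>j. ?X (n + 1 + n * n + j)", OF bits this] c0(1) show ?thesis by (simp add: l_def)
  qed
  have "borsuk_check (length x) ?X (bit_at y)"
    unfolding borsuk_check_def
  proof (rule exI[of _ n], intro conjI)
    show "\<exists>d<n * n. (\<exists>u<n. valid_dist n ?X (bit_at y) u d) \<and> valid_walks n ?X (bit_at y) d"
      using dn uv(1) vd vw by blast
    show "\<exists>l<Suc n. (\<forall>a<n. cert_colour n (bit_at y) a < l) \<and> less_binary (length x) (\<lambda>j. ?X (n + 1 + n * n + j)) l"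
      using ln cl y(2) lb by (intro exI[of _ l]) auto
  qed (use len vi in auto)
  moreover have "length y \<le> 3 * length x ^ 4"
  proof -
    \<comment> \<open>The three tables have \<open>n ^ 2\<close>, \<open>n ^ 3\<close> and
      \<open>n ^ 4\<close> bits, whence the factor 3 and the exponent 4.\<close>
    have "n ^ 2 \<le> n ^ 4" "n ^ 3 \<le> n ^ 4" using n by (auto intro: power_increasing)
    moreover have "n ^ 4 \<le> length x ^ 4" using len(3) by (intro power_mono) auto
    moreover have "length y = n ^ 2 + n ^ 3 + n ^ 4"
      using y(1) by (simp add: power2_eq_square power3_eq_cube power4_eq_xxxx mult.assoc)
    ultimately show ?thesis by linarith
  qed
  ultimately show ?thesis by blast
qed

lemma borsuk_in_NP: "borsuk_language \<in> NP"
proof -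
  have "x \<in> borsuk_language \<longleftrightarrow>
    (\<exists>y. length y \<le> poly (monom 3 4) (length x) \<and> string_pair x y \<in> {w. pair_check w})" for x
    using check_sound[of x] check_complete[of x] by (auto simp: poly_monom pair_check_string_pair)
  then show ?thesis unfolding NP_def using polytime_decidable_dfp[OF dfp_pair_check] by blast
qed

theorem theorem4:
  shows "NP_complete {encode_instance n G k | n G k.
    pair_graph G \<and> pverts G = {..<n} \<and> connected (with_proj G) \<and> k > 0 \<and>
    borsuk_number G < enat k}"
  using borsuk_in_NP NP_hard_borsuk unfolding NP_complete_def borsuk_language_def by blast

end
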